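(* Let $\nu>0$ and set $r=\max\{1+\nu,2\}$. For $p\ge 2$ define $$E_p=\begin{cases}\dfrac{(r-1-\nu)(p-2)}{4p}, & 2\le p\le 6,\\[6pt] \dfrac12+\dfrac{r-4-\nu}{p}, & p>6.\end{cases}$$ Then for every $p\ge2$ and every $\varepsilon>0$ there is a constant $C_{\nu,p,\varepsilon}>0$, depending only on $\nu,p,\varepsilon$, such that for every integer $N\ge1$ and every $u_0(x)=\sum_{n=1}^N a_n e^{2\pi i n x}$ with complex coefficients $a_1,\dots,a_N$, the solution $u$ of the fractional dispersive equation $$i\partial_t u(x,t)+2\pi\left(-\frac1{4\pi^2}\partial_x^2\right)^{\frac{1+\nu}{2}}u(x,t)=0,\quad (x,t)\in\mathbb T\times[0,1],\qquad u(x,0)=u_0(x),$$ satisfies $$\|u\|_{L^p(\mathbb T\times[0,1])}\le C_{\nu,p,\varepsilon}\,N^{E_p+\varepsilon}\,\|u_0\|_{L^2(\mathbb T)}.$$ Equivalently, for all such $N$ and all complex $a_1,\dots,a_N$, $$\left\|\sum_{n=1}^N a_n e^{2\pi i(nx+n^{1+\nu}t)}\right\|_{L^p([0,1]^2)}\le C_{\nu,p,\varepsilon}\,N^{E_p+\varepsilon}\left(\sum_{n=1}^N|a_n|^2\right)^{\frac12}.$$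
   Context: $\mathbb T=\mathbb R/\mathbb Z$. The operator $\left(-\frac1{4\pi^2}\partial_x^2\right)^{\frac{1+\nu}{2}}$ is the Fourier multiplier on $\mathbb T$ sending $e^{2\pi i n x}$ to $|n|^{1+\nu}e^{2\pi i n x}$; thus for $u_0(x)=\sum_{n=1}^N a_ne^{2\pi i n x}$ the solution is $u(x,t)=\sum_{n=1}^N a_n e^{2\pi i(nx+n^{1+\nu}t)}$, and $\|u_0\|_{L^2(\mathbb T)}=\left(\sum_{n=1}^N|a_n|^2\right)^{1/2}$. *)

theory Defs
  imports "HOL-Analysis.Analysis"
begin

text \<open>
  Functions on the torus are represented by 1-periodic functions on the real line; their
  \<open>L\<^sup>p\<close> norms and Fourier coefficients are computed on the period \<open>{0..1}\<close>.
\<close>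

definition e1 :: "real \<Rightarrow> complex"
  where "e1 y = exp (2 * of_real pi * \<i> * of_real y)"

definition trig_poly :: "nat \<Rightarrow> (nat \<Rightarrow> complex) \<Rightarrow> real \<Rightarrow> complex"
  where "trig_poly N a x = (\<Sum>n=1..N. a n * e1 (real n * x))"

definition frac_sum :: "real \<Rightarrow> nat \<Rightarrow> (nat \<Rightarrow> complex) \<Rightarrow> real \<times> real \<Rightarrow> complex"
  where "frac_sum \<nu> N a = (\<lambda>(x, t). \<Sum>n=1..N. a n * e1 (real n * x + real n powr (1 + \<nu>) * t))"

text \<open>
  The Bochner integral is 0 for non-integrable integrands. Below, the norm is only taken of functions
  that are continuous on a compact domain, for which the integral is a genuine one.
\<close>
definition Lp_norm :: "'a measure \<Rightarrow> real \<Rightarrow> ('a \<Rightarrow> complex) \<Rightarrow> real"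
  where "Lp_norm M p f = (LINT z|M. norm (f z) powr p) powr (1 / p)"

definition fourier_coeff :: "(real \<Rightarrow> complex) \<Rightarrow> int \<Rightarrow> complex"
  where "fourier_coeff f n = (LINT x|lebesgue_on {0..1}. f x * e1 (- (of_int n * x)))"

text \<open>
  \<open>is_frac_op \<nu> f g\<close>: \<open>g\<close> is the image of \<open>f\<close> under \<open>(- 1/(4\<pi>\<^sup>2) \<partial>\<^sub>x\<^sup>2)\<close> to the power \<open>(1+\<nu>)/2\<close>, i.e.
  under the Fourier multiplier with symbol \<open>\<bar>n\<bar>\<close> to the power \<open>1+\<nu>\<close>. It is a relation because the
  operator is unbounded; it determines \<open>g\<close> up to null sets.
\<close>
definition is_frac_op :: "real \<Rightarrow> (real \<Rightarrow> complex) \<Rightarrow> (real \<Rightarrow> complex) \<Rightarrow> bool"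
  where "is_frac_op \<nu> f g \<longleftrightarrow>
    integrable (lebesgue_on {0..1}) f \<and> integrable (lebesgue_on {0..1}) g \<and>
    (\<forall>n. fourier_coeff g n = of_real (\<bar>of_int n\<bar> powr (1 + \<nu>)) * fourier_coeff f n)"

text \<open>
  Classical solutions on the torus times \<open>{0..1}\<close>: \<open>u\<close> and its time derivative \<open>v\<close> (one-sided at the
  end points) are continuous, and the equation holds at every point.
\<close>
definition frac_solution ::
    "real \<Rightarrow> (real \<Rightarrow> complex) \<Rightarrow> (real \<times> real \<Rightarrow> complex) \<Rightarrow> bool"
  where "frac_solution \<nu> u0 u \<longleftrightarrow>
    (\<forall>x. \<forall>t\<in>{0..1}. u (x + 1, t) = u (x, t)) \<and>
    continuous_on (UNIV \<times> {0..1}) u \<and>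
    (\<forall>x. u (x, 0) = u0 x) \<and>
    (\<exists>v. continuous_on (UNIV \<times> {0..1}) v \<and>
      (\<forall>x. \<forall>t\<in>{0..1}. ((\<lambda>s. u (x, s)) has_vector_derivative v (x, t)) (at t within {0..1})) \<and>
      (\<forall>t\<in>{0..1}. \<exists>g. is_frac_op \<nu> (\<lambda>x. u (x, t)) g \<and>
        (\<forall>x. \<i> * v (x, t) + 2 * of_real pi * g x = 0)))"

definition exponent :: "real \<Rightarrow> real \<Rightarrow> real"
  where "exponent \<nu> p = (let r = max (1 + \<nu>) 2 in
    if p \<le> 6 then (r - 1 - \<nu>) * (p - 2) / (4 * p) else 1 / 2 + (r - 4 - \<nu>) / p)"


lemma e1_add: "e1 (x + y) = e1 x * e1 y"
  by (simp add: e1_def exp_add[symmetric] algebra_simps)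

lemma e1_of_int: "e1 (of_int n) = 1"
  unfolding e1_def by (simp add: exp_eq_1 mult.commute)

lemma e1_has_vector_derivative:
  "((\<lambda>s. e1 (c + d * s)) has_vector_derivative 2 * of_real pi * \<i> * of_real d * e1 (c + d * t))
    (at t within S)"
proof -
  have "((\<lambda>z. exp (2 * of_real pi * \<i> * (of_real c + of_real d * z))) has_field_derivative
     2 * of_real pi * \<i> * of_real d * e1 (c + d * t)) (at (of_real t))"
    unfolding e1_def by (auto intro!: derivative_eq_intros simp: algebra_simps)
  from has_vector_derivative_real_field[OF this]
  show ?thesis unfolding e1_def
    by (auto simp: o_def intro: has_vector_derivative_at_within)
qed

lemma continuous_on_e1 [continuous_intros]:
  "continuous_on S f \<Longrightarrow> continuous_on S (\<lambda>x. e1 (f x))"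
  unfolding e1_def by (intro continuous_intros)

lemma integrable_continuous_01:
  fixes f :: "real \<Rightarrow> complex"
  assumes "continuous_on UNIV f"
  shows "integrable (lebesgue_on {0..1}) f"
  using assms
  by (metis continuous_imp_integrable_real continuous_on_subset top_greatest)

lemma integral_e1:
  "(LINT x|lebesgue_on {0..1}. e1 (of_int k * x)) = (if k = 0 then 1 else 0)"
proof (cases "k = 0")
  case True
  then show ?thesis by (simp add: e1_def measure_restrict_space)
next
  case False
  let ?c = "2 * of_real pi * \<i> * of_int k :: complex"
  have c: "?c \<noteq> 0" using False by simp
  have "((\<lambda>s. e1 (of_int k * s) / ?c) has_vector_derivative e1 (of_int k * t)) (at t within {0..1})" for t
  proof -
    have "((\<lambda>s. e1 (0 + of_int k * s) / ?c) has_vector_derivative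
      (2 * of_real pi * \<i> * of_real (of_int k) * e1 (0 + of_int k * t)) / ?c) (at t within {0..1})"
      by (intro has_vector_derivative_divide e1_has_vector_derivative)
    then show ?thesis using c by simp
  qed
  then have "((\<lambda>x. e1 (of_int k * x)) has_integral (e1 (of_int k * 1) / ?c - e1 (of_int k * 0) / ?c)) {0..1}"
    by (intro fundamental_theorem_of_calculus) auto
  moreover have "e1 (of_int k * 1) = 1" "e1 (of_int k * 0) = 1"
    using e1_of_int[of k] e1_of_int[of 0] by simp_all
  ultimately have "integral {0..1} (\<lambda>x. e1 (of_int k * x)) = 0"
    by (simp add: integral_unique)
  moreover have "integrable (lebesgue_on {0..1}) (\<lambda>x. e1 (of_int k * x))"
    by (intro integrable_continuous_01 continuous_intros)
  ultimately show ?thesis using False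
    by (simp add: lebesgue_integral_eq_integral)
qed

lemma fourier_coeff_trig_poly:
  "fourier_coeff (trig_poly N a) n = (if n \<in> {1..int N} then a (nat n) else 0)"
proof -
  have "fourier_coeff (trig_poly N a) n =
    (LINT x|lebesgue_on {0..1}. (\<Sum>m=1..N. a m * e1 (of_int (int m - n) * x)))"
    unfolding fourier_coeff_def trig_poly_def sum_distrib_right
    by (intro Bochner_Integration.integral_cong sum.cong refl)
       (simp add: mult.assoc e1_add[symmetric] algebra_simps)
  also have "\<dots> = (\<Sum>m=1..N. LINT x|lebesgue_on {0..1}. a m * e1 (of_int (int m - n) * x))"
    by (intro Bochner_Integration.integral_sum integrable_continuous_01 continuous_intros)
  also have "\<dots> = (\<Sum>m=1..N. if int m = n then a m else 0)"
    by (intro sum.cong refl) (simp only: integral_mult_right_zero integral_e1, simp)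
  also have "\<dots> = (if n \<in> {1..int N} then a (nat n) else 0)"
  proof (cases "n \<in> {1..int N}")
    case True
    then have "(\<Sum>m=1..N. if int m = n then a m else 0) = (\<Sum>m=1..N. if m = nat n then a m else 0)"
      by (intro sum.cong) auto
    also have "\<dots> = a (nat n)" using True by (subst sum.delta) auto
    finally show ?thesis using True by simp
  next
    case False
    then have "(\<Sum>m=1..N. if int m = n then a m else 0) = 0"
      by (intro sum.neutral) auto
    with False show ?thesis by (simp only: if_False)
  qed
  finally show ?thesis .
qed

lemma continuous_on_trig_poly: "continuous_on S (trig_poly N a)"
  unfolding trig_poly_def[abs_def] by (intro continuous_intros)

lemma frac_sum_eq_trig_poly:
  "frac_sum \<nu> N a (x, t) = trig_poly N (\<lambda>n. a n * e1 (real n powr (1 + \<nu>) * t)) x"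
  unfolding frac_sum_def trig_poly_def by (simp add: e1_add mult_ac)

lemma frac_solution_frac_sum: "frac_solution \<nu> (trig_poly N a) (frac_sum \<nu> N a)"
proof -
  define w where "w n = real n powr (1 + \<nu>)" for n
  define v where "v = (\<lambda>(x, t). \<Sum>n=1..N. a n * (2 * of_real pi * \<i> * of_real (w n) * e1 (real n * x + w n * t)))"
  define b where "b t n = a n * e1 (w n * t)" for t n
  define g where "g t = trig_poly N (\<lambda>n. of_real (w n) * b t n)" for t
  have fs: "frac_sum \<nu> N a (x, t) = trig_poly N (b t) x" for x t
    unfolding frac_sum_eq_trig_poly b_def[abs_def] w_def by simp
  have per: "trig_poly N c (x + 1) = trig_poly N c x" for c x
    using e1_of_int[of "int _"] unfolding trig_poly_def
    by (intro sum.cong) (auto simp: distrib_left e1_add)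
  have cont: "continuous_on (UNIV \<times> {0..1}) (frac_sum \<nu> N a)"
    unfolding frac_sum_def case_prod_unfold by (intro continuous_intros)
  have cont_v: "continuous_on (UNIV \<times> {0..1}) v"
    unfolding v_def case_prod_unfold by (intro continuous_intros)
  have init: "frac_sum \<nu> N a (x, 0) = trig_poly N a x" for x
    unfolding frac_sum_def trig_poly_def by simp
  have deriv: "((\<lambda>s. frac_sum \<nu> N a (x, s)) has_vector_derivative v (x, t)) (at t within {0..1})" for x t
    unfolding frac_sum_def v_def prod.case w_def[symmetric]
    by (intro has_vector_derivative_sum has_vector_derivative_mult_right e1_has_vector_derivative)
  have op: "is_frac_op \<nu> (\<lambda>x. frac_sum \<nu> N a (x, t)) (g t)" for t
    unfolding is_frac_op_def fs g_def
    by (auto intro!: integrable_continuous_01 continuous_on_trig_poly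
        simp: fourier_coeff_trig_poly w_def)
  have eqn: "\<i> * v (x, t) + 2 * of_real pi * g t x = 0" for x t
    unfolding v_def g_def trig_poly_def b_def prod.case sum_distrib_left sum.distrib[symmetric]
    by (intro sum.neutral) (auto simp: e1_add algebra_simps)
  show ?thesis
    unfolding frac_solution_def
    using per cont cont_v init deriv op eqn
    by (auto simp only: fs[symmetric] intro!: exI[of _ v]) (metis fs per)+
qed

end

theory Submission
  imports Defs "HOL-Probability.Probability"
begin

text \<open>
  Everything reduces to \<open>p = 6\<close>: the case \<open>p = 2\<close> is orthogonality, \<open>p = \<infinity>\<close> is Cauchy--Schwarz, and the
  exponent interpolates between the three. On a dyadic block \<open>n \<approx> M\<close> and after stretching time to
  length about \<open>max 1 (M powr (1 - \<nu>))\<close>, which accounts for the loss when \<open>\<nu> < 1\<close>, the frequencies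
  \<open>n powr (1 + \<nu>)\<close> lie on a curve of curvature at least 1. For such a curve the sixth moment is
  \<open>O(M powr \<epsilon>)\<close> by discrete \<open>\<ell>\<^sup>2\<close> decoupling, proved by an efficient congruencing argument: with a
  time weight whose Fourier transform has compact support the sixth moment counts approximate
  solutions of a six-variable system, two separated blocks interact only along the diagonal at
  a finer scale, and iterating this improves any exponent \<open>\<eta> \<ge> \<epsilon>\<close> by a fixed factor smaller than 1.
  The estimate applies to solutions of the equation because Fourier coefficients of a classical
  solution satisfy a scalar linear equation and determine a continuous periodic function.
\<close>

section \<open>Exponential sums along a curved sequence of frequencies\<close>

text \<open>The argument needs non-resonant integrals to vanish exactly. Since
  \<open>n powr (1 + \<nu>)\<close> is in general not an integer, no period in time achieves this,
  and a sharp cutoff to {0..1} makes such integrals decay only slowly. Hence the weight with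
  compactly supported transform; it costs a constant only, being bounded below on {0..1}.

  The constant for a block must not depend on the block. The curvature is therefore a parameter
  \<open>lam\<close> that cancels from the resonance condition, and \<open>C\<close>, in the
  application the ratio of the largest to the smallest second derivative, depends on
  \<open>\<nu>\<close> alone on a dyadic block.

  There is no recursion in the length of the interval. A round of improvement may multiply the
  constant by any amount, because the number of rounds depends on \<open>\<epsilon>\<close> only.
  Its gain comes from taking \<open>R\<close> as the power 1/(2^k + 1) of the length: the narrow
  part then lives on intervals of length about R^(2^k), shorter by a fixed power, and the broad part
  is made no larger by iterating over \<open>k\<close> scales.\<close>

lemma borel_measurable_cnj_comp [measurable (raw)]:
  "f \<in> borel_measurable M \<Longrightarrow> (\<lambda>x. cnj (f x)) \<in> borel_measurable M"
  by (rule borel_measurable_continuous_on[OF _, where f=cnj]) (intro continuous_intros)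

lemma Cauchy_Schwarz_integral:
  fixes u v :: "'a \<Rightarrow> real"
  assumes [measurable]: "u \<in> borel_measurable M" "v \<in> borel_measurable M"
    and nonneg: "\<And>x. u x \<ge> 0" "\<And>x. v x \<ge> 0"
    and int: "integrable M (\<lambda>x. (u x)\<^sup>2)" "integrable M (\<lambda>x. (v x)\<^sup>2)" "integrable M (\<lambda>x. u x * v x)"
  shows "(LINT x|M. u x * v x)\<^sup>2 \<le> (LINT x|M. (u x)\<^sup>2) * (LINT x|M. (v x)\<^sup>2)"
proof -
  have "(\<integral>\<^sup>+x. ennreal (u x) * ennreal (v x) \<partial>M)\<^sup>2
      \<le> (\<integral>\<^sup>+x. (ennreal (u x))\<^sup>2 \<partial>M) * (\<integral>\<^sup>+x. (ennreal (v x))\<^sup>2 \<partial>M)"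
    by (rule Cauchy_Schwarz_nn_integral) measurable
  then have "(\<integral>\<^sup>+x. ennreal (u x * v x) \<partial>M)\<^sup>2
      \<le> (\<integral>\<^sup>+x. ennreal ((u x)\<^sup>2) \<partial>M) * (\<integral>\<^sup>+x. ennreal ((v x)\<^sup>2) \<partial>M)"
    by (simp add: ennreal_mult nonneg ennreal_power)
  then show ?thesis
    using int nonneg by (simp add: nn_integral_eq_integral ennreal_power integral_nonneg_AE
        flip: ennreal_mult)
qed

lemma div_int_less:
  fixes x b c :: int
  assumes "b > 0" "x < c * b"
  shows "x div b < c"
proof -
  have "x div b * b \<le> x"
    using div_mult_mod_eq[of x b] pos_mod_sign[OF assms(1), of x] by linarith
  then have "x div b * b < c * b" using assms(2) by linarith
  then show ?thesis using assms(1) by simp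
qed

lemma div_diff_le:
  fixes x y b :: int
  assumes "b > 0" "\<bar>x - y\<bar> \<le> l * b"
  shows "\<bar>x div b - y div b\<bar> \<le> l"
proof -
  have *: "u div b - v div b \<le> l" if "u - v \<le> l * b" for u v
  proof -
    have "u \<le> v + l * b" using that by simp
    then have "u div b \<le> (v + l * b) div b" using assms(1) by (intro zdiv_mono1)
    then show ?thesis using assms(1) by simp
  qed
  show ?thesis using *[of x y] *[of y x] assms(2) by (simp add: abs_le_iff)
qed

lemma div_eq_bounds:
  fixes n b k :: int
  assumes "b > 0" "n div b = k"
  shows "k * b \<le> n" "n < k * b + b"
proof -
  have "n = k * b + n mod b" using div_mult_mod_eq[of n b] unfolding assms(2) by (rule sym)
  then show "k * b \<le> n" "n < k * b + b"
    using pos_mod_bound[OF assms(1), of n] pos_mod_sign[OF assms(1), of n] by linarith+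
qed

text \<open>
  An exponential sum along a curve \<open>(n, h n)\<close> of curvature about \<open>lam\<close>, with slope \<open>g\<close>. The measure
  enters only through \<open>orth\<close>: sixfold products resonate only if the frequencies balance exactly in the
  first coordinate and up to 1 in the second. The class is closed under passing to subintervals of
  \<open>J\<close>, which replaces the parabolic rescaling of decoupling theory.
\<close>
locale curve_system = finite_measure M for M :: "'m measure" +
  fixes e :: "int \<Rightarrow> 'm \<Rightarrow> complex" and h g :: "int \<Rightarrow> real" and J :: "int set"
    and C lam :: real and a :: "int \<Rightarrow> complex"
  assumes e_meas [measurable]: "e n \<in> borel_measurable M"
    and norm_e: "cmod (e n z) = 1"
    and orth: "x1 + x2 + x3 \<noteq> y1 + y2 + y3 \<or> \<bar>h x1 + h x2 + h x3 - h y1 - h y2 - h y3\<bar> \<ge> 1 \<Longrightarrow>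
      (LINT z|M. e x1 z * e x2 z * e x3 z * cnj (e y1 z * e y2 z * e y3 z)) = 0"
    and C_nonneg: "C \<ge> 0" and lam_ge_1: "lam \<ge> 1"
    and tangent: "x \<in> J \<Longrightarrow> d \<in> J \<Longrightarrow> \<bar>h x - h d - g d * of_int (x - d)\<bar> \<le> C * lam * (of_int (x - d))\<^sup>2"
    and transversal: "x \<in> J \<Longrightarrow> y \<in> J \<Longrightarrow> d \<in> J \<Longrightarrow> s \<ge> 0 \<Longrightarrow>
      d + s \<le> x \<and> d + s \<le> y \<or> x + s \<le> d \<and> y + s \<le> d \<Longrightarrow>
      lam * of_int s * \<bar>of_int x - of_int y\<bar> \<le> \<bar>h x - h y - g d * (of_int x - of_int y)\<bar>"
begin

definition F :: "int set \<Rightarrow> 'm \<Rightarrow> complex" where "F X z = (\<Sum>n\<in>X. a n * e n z)"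
text \<open>The squared l2 norm is kept without the root because it is additive over partitions, so
  that bounds for the blocks of a set can be summed.\<close>

definition mass :: "int set \<Rightarrow> real" where "mass X = (\<Sum>n\<in>X. (cmod (a n))\<^sup>2)"

lemma F_meas [measurable]: "F X \<in> borel_measurable M"
  unfolding F_def by measurable

lemma mass_nonneg [simp]: "mass X \<ge> 0"
  unfolding mass_def by (intro sum_nonneg) auto

lemma mass_mono: "finite Y \<Longrightarrow> X \<subseteq> Y \<Longrightarrow> mass X \<le> mass Y"
  unfolding mass_def by (intro sum_mono2) auto

definition total :: real where "total = measure M (space M)"

lemma total_nonneg [simp]: "total \<ge> 0" unfolding total_def by simp

lemma norm_F_le: "cmod (F X z) \<le> (\<Sum>n\<in>X. cmod (a n))"
  unfolding F_def by (rule order_trans[OF norm_sum]) (simp add: norm_mult norm_e)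

lemma norm_F_sq_le:
  assumes "finite X" shows "(cmod (F X z))\<^sup>2 \<le> card X * mass X"
proof -
  have "(cmod (F X z))\<^sup>2 \<le> (\<Sum>n\<in>X. cmod (a n))\<^sup>2"
    by (intro power_mono norm_F_le) auto
  also have "\<dots> \<le> card X * mass X"
    using Cauchy_Schwarz_ineq_sum[of "\<lambda>_. 1" "\<lambda>n. cmod (a n)" X]
    by (simp add: mass_def)
  finally show ?thesis .
qed

lemma integrable_bounded:
  fixes f :: "'m \<Rightarrow> 'b :: {banach, second_countable_topology}"
  assumes "f \<in> borel_measurable M" "\<And>z. norm (f z) \<le> B"
  shows "integrable M f"
  using assms by (intro integrable_const_bound[of _ B]) auto

lemma integrable_prod6:
  "integrable M (\<lambda>z. F X1 z * F X2 z * F X3 z * cnj (F Y1 z * F Y2 z * F Y3 z))"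
proof (rule integrable_bounded)
  let ?s = "\<lambda>X. \<Sum>n\<in>X. cmod (a n)"
  show "norm (F X1 z * F X2 z * F X3 z * cnj (F Y1 z * F Y2 z * F Y3 z)) \<le> ?s X1 * ?s X2 * ?s X3 * (?s Y1 * ?s Y2 * ?s Y3)" for z
    unfolding norm_mult complex_mod_cnj
    by (intro mult_mono norm_F_le mult_nonneg_nonneg norm_ge_zero sum_nonneg)
qed measurable

lemma integrable_norm_prod: "integrable M (\<lambda>z. (cmod (F X z))^i * (cmod (F Y z))^j)"
proof (rule integrable_bounded)
  let ?s = "\<lambda>X. \<Sum>n\<in>X. cmod (a n)"
  show "norm ((cmod (F X z))^i * (cmod (F Y z))^j) \<le> ?s X ^ i * ?s Y ^ j" for z
    unfolding real_norm_def abs_mult power_abs abs_norm_cancel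
    by (intro mult_mono power_mono norm_F_le mult_nonneg_nonneg norm_ge_zero sum_nonneg zero_le_power)
qed measurable

lemma integrable_norm_pow: "integrable M (\<lambda>z. (cmod (F X z))^i)"
  using integrable_norm_prod[of X i X 0] by simp

lemma integral_prod6_eq_0:
  assumes "\<And>x1 x2 x3 y1 y2 y3. x1 \<in> X1 \<Longrightarrow> x2 \<in> X2 \<Longrightarrow> x3 \<in> X3 \<Longrightarrow> y1 \<in> Y1 \<Longrightarrow> y2 \<in> Y2 \<Longrightarrow> y3 \<in> Y3 \<Longrightarrow>
    x1 + x2 + x3 \<noteq> y1 + y2 + y3 \<or> \<bar>h x1 + h x2 + h x3 - h y1 - h y2 - h y3\<bar> \<ge> 1"
  shows "(LINT z|M. F X1 z * F X2 z * F X3 z * cnj (F Y1 z * F Y2 z * F Y3 z)) = 0"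
proof -
  let ?E = "\<lambda>x1 x2 x3 y1 y2 y3 z. a x1 * a x2 * a x3 * cnj (a y1 * a y2 * a y3) *
    (e x1 z * e x2 z * e x3 z * cnj (e y1 z * e y2 z * e y3 z))"
  have int: "integrable M (?E x1 x2 x3 y1 y2 y3)" for x1 x2 x3 y1 y2 y3
    by (rule integrable_bounded[where B="cmod (a x1 * a x2 * a x3 * cnj (a y1 * a y2 * a y3))"])
       (simp_all add: norm_mult norm_e)
  have "(LINT z|M. F X1 z * F X2 z * F X3 z * cnj (F Y1 z * F Y2 z * F Y3 z)) =
    (LINT z|M. (\<Sum>x1\<in>X1. \<Sum>x2\<in>X2. \<Sum>x3\<in>X3. \<Sum>y1\<in>Y1. \<Sum>y2\<in>Y2. \<Sum>y3\<in>Y3. ?E x1 x2 x3 y1 y2 y3 z))"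
  proof (intro Bochner_Integration.integral_cong refl)
    fix z
    have "F X1 z * F X2 z * F X3 z * cnj (F Y1 z * F Y2 z * F Y3 z) =
      F X1 z * (F X2 z * (F X3 z * (cnj (F Y1 z) * (cnj (F Y2 z) * cnj (F Y3 z)))))"
      by (simp add: mult.assoc)
    also have "\<dots> = (\<Sum>x1\<in>X1. \<Sum>x2\<in>X2. \<Sum>x3\<in>X3. \<Sum>y1\<in>Y1. \<Sum>y2\<in>Y2. \<Sum>y3\<in>Y3.
        a x1 * e x1 z * (a x2 * e x2 z * (a x3 * e x3 z * (cnj (a y1 * e y1 z) * (cnj (a y2 * e y2 z) * cnj (a y3 * e y3 z))))))"
      unfolding F_def cnj_sum
      \<comment> \<open>The first pass opens the left factor of each nested product, the second
        moves the inner sums outwards; this produces the sums in the order from \<open>X1\<close> to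
        \<open>Y3\<close>.\<close>
      by (simp only: sum_distrib_right) (simp only: sum_distrib_left)
    also have "\<dots> = (\<Sum>x1\<in>X1. \<Sum>x2\<in>X2. \<Sum>x3\<in>X3. \<Sum>y1\<in>Y1. \<Sum>y2\<in>Y2. \<Sum>y3\<in>Y3. ?E x1 x2 x3 y1 y2 y3 z)"
      by (intro sum.cong refl) (simp add: mult_ac)
    finally show "F X1 z * F X2 z * F X3 z * cnj (F Y1 z * F Y2 z * F Y3 z) = \<dots>" .
  qed
  also have "\<dots> = (\<Sum>x1\<in>X1. \<Sum>x2\<in>X2. \<Sum>x3\<in>X3. \<Sum>y1\<in>Y1. \<Sum>y2\<in>Y2. \<Sum>y3\<in>Y3. LINT z|M. ?E x1 x2 x3 y1 y2 y3 z)"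
    using int by (simp add: Bochner_Integration.integrable_sum)
  also have "\<dots> = 0"
  proof (intro sum.neutral ballI)
    fix x1 x2 x3 y1 y2 y3
    assume *: "x1 \<in> X1" "x2 \<in> X2" "x3 \<in> X3" "y1 \<in> Y1" "y2 \<in> Y2" "y3 \<in> Y3"
    show "(LINT z|M. ?E x1 x2 x3 y1 y2 y3 z) = 0"
      using orth[OF assms[OF *]] by simp
  qed
  finally show ?thesis .
qed


section \<open>Mixed moments of two blocks\<close>

lemma F_partition:
  assumes "finite X" "finite K" "\<beta> ` X \<subseteq> K"
  shows "F X z = (\<Sum>k\<in>K. F {n\<in>X. \<beta> n = k} z)"
  unfolding F_def using sum.group[OF assms, of "\<lambda>n. a n * e n z"] by simp

lemma mass_partition:
  assumes "finite X" "finite K" "\<beta> ` X \<subseteq> K"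
  shows "mass X = (\<Sum>k\<in>K. mass {n\<in>X. \<beta> n = k})"
  unfolding mass_def using sum.group[OF assms, of "\<lambda>n. (cmod (a n))\<^sup>2"] by simp

text \<open>The weights 2 and 4 serve two purposes. The square of \<open>F X\<close> puts one
  frequency of \<open>X\<close> on each side of a six-term resonance, which then controls their
  distance; and a single use of Cauchy--Schwarz exchanges the weights at the price of a pure sixth
  moment.\<close>

definition mixed :: "int set \<Rightarrow> int set \<Rightarrow> real"
  where "mixed X Y = (LINT z|M. (cmod (F X z))\<^sup>2 * (cmod (F Y z)) ^ 4)"

lemma mixed_nonneg [simp]: "mixed X Y \<ge> 0"
  unfolding mixed_def by (intro integral_nonneg_AE) auto

text \<open>Almost orthogonality in \<open>X\<close>: after expanding over the fibres of
  \<open>\<beta>\<close>, cross terms at distance more than \<open>r\<close> vanish by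
  \<open>off\<close>, the others are split by the arithmetic-geometric mean inequality, and each
  fibre has at most 2 r + 1 neighbours, itself included. The sum over \<open>Y\<close> is never
  decomposed.\<close>

lemma mixed_le_diagonal:
  assumes X: "finite X" and Y: "finite Y"
    and off: "\<And>x y z1 z2 z3 z4. x \<in> X \<Longrightarrow> y \<in> X \<Longrightarrow> int r < \<bar>\<beta> x - \<beta> y\<bar> \<Longrightarrow>
      z1 \<in> Y \<Longrightarrow> z2 \<in> Y \<Longrightarrow> z3 \<in> Y \<Longrightarrow> z4 \<in> Y \<Longrightarrow>
      x + z1 + z2 \<noteq> y + z3 + z4 \<or> \<bar>h x + h z1 + h z2 - h y - h z3 - h z4\<bar> \<ge> 1"
  shows "mixed X Y \<le> (2 * r + 1) * (\<Sum>k\<in>\<beta> ` X. mixed {n\<in>X. \<beta> n = k} Y)"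
proof -
  let ?K = "\<beta> ` X"
  let ?X = "\<lambda>k. {n\<in>X. \<beta> n = k}"
  define P where "P k l = (LINT z|M. F (?X k) z * F Y z * F Y z * cnj (F (?X l) z * F Y z * F Y z))" for k l
  let ?I = "\<lambda>k. mixed (?X k) Y"
  have fK: "finite ?K" using X by simp
  have P0: "P k l = 0" if "int r < \<bar>k - l\<bar>" for k l
    unfolding P_def using that by (intro integral_prod6_eq_0 off) auto
  have P1: "cmod (P k l) \<le> (?I k + ?I l) / 2" for k l
  proof -
    have "cmod (P k l) \<le> (LINT z|M. cmod (F (?X k) z * F Y z * F Y z * cnj (F (?X l) z * F Y z * F Y z)))"
      unfolding P_def by (rule integral_norm_bound)
    also have "\<dots> \<le> (LINT z|M. ((cmod (F (?X k) z))\<^sup>2 * (cmod (F Y z)) ^ 4 + (cmod (F (?X l) z))\<^sup>2 * (cmod (F Y z)) ^ 4) / 2)"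
    proof (intro integral_mono integrable_norm integrable_prod6 integrable_divide Bochner_Integration.integrable_add integrable_norm_prod)
      fix z
      let ?u = "cmod (F (?X k) z)" and ?v = "cmod (F (?X l) z)" and ?w = "cmod (F Y z)"
      have "2 * (?u * ?v) * ?w ^ 4 \<le> (?u\<^sup>2 + ?v\<^sup>2) * ?w ^ 4"
        using sum_squares_bound[of ?u ?v] by (intro mult_right_mono) auto
      then show "cmod (F (?X k) z * F Y z * F Y z * cnj (F (?X l) z * F Y z * F Y z)) \<le> (?u\<^sup>2 * ?w ^ 4 + ?v\<^sup>2 * ?w ^ 4) / 2"
        by (simp add: norm_mult power4_eq_xxxx algebra_simps)
    qed
    also have "\<dots> = (?I k + ?I l) / 2"
      unfolding mixed_def by (simp add: integrable_norm_prod)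
    finally show ?thesis .
  qed
  have "complex_of_real (mixed X Y) = (LINT z|M. complex_of_real ((cmod (F X z))\<^sup>2 * (cmod (F Y z)) ^ 4))"
    unfolding mixed_def by (rule integral_complex_of_real[symmetric])
  also have "\<dots> = (LINT z|M. (\<Sum>k\<in>?K. \<Sum>l\<in>?K. F (?X k) z * F Y z * F Y z * cnj (F (?X l) z * F Y z * F Y z)))"
  proof (intro Bochner_Integration.integral_cong refl)
    fix z
    have "complex_of_real ((cmod (F X z))\<^sup>2 * (cmod (F Y z)) ^ 4) = F X z * cnj (F X z) * ((F Y z * F Y z) * cnj (F Y z * F Y z))"
    proof -
      have "complex_of_real ((cmod (F X z))\<^sup>2 * (cmod (F Y z)) ^ 4) = of_real ((cmod (F X z))\<^sup>2) * (of_real ((cmod (F Y z))\<^sup>2))\<^sup>2"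
        by (simp flip: power_mult)
      also have "\<dots> = F X z * cnj (F X z) * ((F Y z * F Y z) * cnj (F Y z * F Y z))"
        unfolding complex_norm_square by (simp add: power2_eq_square mult_ac)
      finally show ?thesis .
    qed
    also have "\<dots> = (\<Sum>k\<in>?K. F (?X k) z) * (\<Sum>l\<in>?K. cnj (F (?X l) z)) * ((F Y z * F Y z) * cnj (F Y z * F Y z))"
      using F_partition[OF X fK subset_refl, of z] by (simp add: cnj_sum)
    also have "\<dots> = (\<Sum>k\<in>?K. \<Sum>l\<in>?K. F (?X k) z * F Y z * F Y z * cnj (F (?X l) z * F Y z * F Y z))"
      unfolding sum_product by (simp add: sum_distrib_left sum_distrib_right mult_ac)
    finally show "complex_of_real ((cmod (F X z))\<^sup>2 * (cmod (F Y z)) ^ 4) = \<dots>" .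
  qed
  also have "\<dots> = (\<Sum>k\<in>?K. \<Sum>l\<in>?K. P k l)"
    unfolding P_def by (subst Bochner_Integration.integral_sum, intro Bochner_Integration.integrable_sum integrable_prod6,
        subst Bochner_Integration.integral_sum, intro integrable_prod6, rule refl)
  finally have "mixed X Y = cmod (\<Sum>k\<in>?K. \<Sum>l\<in>?K. P k l)"
    by (metis abs_of_nonneg mixed_nonneg norm_of_real)
  also have "\<dots> \<le> (\<Sum>k\<in>?K. \<Sum>l\<in>?K. cmod (P k l))"
    by (intro order_trans[OF norm_sum] sum_mono order_trans[OF norm_sum] order_refl)
  also have "\<dots> \<le> (\<Sum>k\<in>?K. \<Sum>l\<in>?K. (if \<bar>k - l\<bar> \<le> int r then ?I k / 2 else 0) + (if \<bar>l - k\<bar> \<le> int r then ?I l / 2 else 0))"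
  proof (intro sum_mono)
    fix k l
    show "cmod (P k l) \<le> (if \<bar>k - l\<bar> \<le> int r then ?I k / 2 else 0) + (if \<bar>l - k\<bar> \<le> int r then ?I l / 2 else 0)"
      using P0[of k l] P1[of k l] by (cases "\<bar>k - l\<bar> \<le> int r") (auto simp: add_divide_distrib abs_minus_commute)
  qed
  also have "\<dots> = (\<Sum>k\<in>?K. \<Sum>l\<in>?K. if \<bar>k - l\<bar> \<le> int r then ?I k / 2 else 0) * 2"
    unfolding sum.distrib by (subst (2) sum.swap) simp
  also have "\<dots> \<le> (\<Sum>k\<in>?K. (2 * r + 1) * (?I k / 2)) * 2"
  proof (intro mult_right_mono sum_mono)
    fix k
    have "(\<Sum>l\<in>?K. if \<bar>k - l\<bar> \<le> int r then ?I k / 2 else 0) = card {l\<in>?K. \<bar>k - l\<bar> \<le> int r} * (?I k / 2)"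
      using fK by (simp add: sum.If_cases Int_def)
    also have "\<dots> \<le> (2 * r + 1) * (?I k / 2)"
    proof (intro mult_right_mono)
      have "card {l\<in>?K. \<bar>k - l\<bar> \<le> int r} \<le> card {k - int r..k + int r}"
        by (intro card_mono) auto
      then show "real (card {l\<in>?K. \<bar>k - l\<bar> \<le> int r}) \<le> real (2 * r + 1)"
        by simp
    qed simp
    finally show "(\<Sum>l\<in>?K. if \<bar>k - l\<bar> \<le> int r then ?I k / 2 else 0) \<le> (2 * r + 1) * (?I k / 2)" .
  qed simp
  also have "\<dots> = (2 * r + 1) * (\<Sum>k\<in>?K. ?I k)"
    by (simp add: sum_distrib_left[symmetric] sum_divide_distrib[symmetric])
  finally show ?thesis by (simp add: add_ac)
qed

text \<open>The integrand is |F X|^2 |F Y| times |F Y|^3: the square of the first factor is the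
  integrand of \<open>mixed Y X\<close>, that of the second is |F Y|^6.\<close>

lemma mixed_le_swap:
  "(mixed X Y)\<^sup>2 \<le> mixed Y X * (LINT z|M. (cmod (F Y z)) ^ 6)"
proof -
  have "(mixed X Y)\<^sup>2 = (LINT z|M. ((cmod (F X z))\<^sup>2 * cmod (F Y z)) * (cmod (F Y z)) ^ 3)\<^sup>2"
    unfolding mixed_def by (simp add: power4_eq_xxxx power3_eq_cube mult_ac)
  also have "\<dots> \<le> (LINT z|M. ((cmod (F X z))\<^sup>2 * cmod (F Y z))\<^sup>2) * (LINT z|M. ((cmod (F Y z)) ^ 3)\<^sup>2)"
  proof (rule Cauchy_Schwarz_integral)
    show "integrable M (\<lambda>x. ((cmod (F X x))\<^sup>2 * cmod (F Y x))\<^sup>2)"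
      using integrable_norm_prod[of X 4 Y 2] by (simp add: power_mult_distrib flip: power_mult)
    show "integrable M (\<lambda>x. ((cmod (F Y x)) ^ 3)\<^sup>2)"
      using integrable_norm_pow[of Y 6] by (simp flip: power_mult)
    show "integrable M (\<lambda>x. (cmod (F X x))\<^sup>2 * cmod (F Y x) * (cmod (F Y x)) ^ 3)"
      using integrable_norm_prod[of X 2 Y 4] by (simp add: power4_eq_xxxx power3_eq_cube mult_ac)
  qed auto
  also have "\<dots> = mixed Y X * (LINT z|M. (cmod (F Y z)) ^ 6)"
    unfolding mixed_def by (simp add: power_mult_distrib mult_ac flip: power_mult)
  finally show ?thesis .
qed

text \<open>If all four points of \<open>Y\<close> equal n, the linear condition x + 2n = y + 2n
  alone forces x = y. Orthogonality in \<open>X\<close> is then exact, which is the case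
  \<open>r\<close> = 0 and \<open>\<beta>\<close> = \<open>id\<close> of the diagonal
  estimate.\<close>

lemma mixed_singleton_le:
  assumes "finite X"
  shows "mixed X {n} \<le> total * mass X * (mass {n})\<^sup>2"
proof -
  have "mixed X {n} \<le> (\<Sum>k\<in>X. mixed {m\<in>X. m = k} {n})"
    using mixed_le_diagonal[OF assms, of "{n}" 0 id] by simp
  also have "\<dots> = (\<Sum>k\<in>X. total * (cmod (a k))\<^sup>2 * (mass {n})\<^sup>2)"
  proof (intro sum.cong refl)
    fix k assume "k \<in> X"
    then have "{m \<in> X. m = k} = {k}" by auto
    then show "mixed {m \<in> X. m = k} {n} = total * (cmod (a k))\<^sup>2 * (mass {n})\<^sup>2"
      by (simp add: mixed_def F_def mass_def norm_mult norm_e total_def flip: power_mult)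
  qed
  also have "\<dots> = total * mass X * (mass {n})\<^sup>2"
    by (simp add: mass_def[of X] sum_distrib_left sum_distrib_right)
  finally show ?thesis .
qed

section \<open>Separated blocks and the descent through the scales\<close>

definition separated :: "int \<Rightarrow> int set \<Rightarrow> int set \<Rightarrow> bool"
  where "separated s X Y \<longleftrightarrow> (\<forall>x\<in>X. \<forall>y\<in>Y. x + s \<le> y) \<or> (\<forall>x\<in>X. \<forall>y\<in>Y. y + s \<le> x)"

lemma separated_sym: "separated s X Y \<longleftrightarrow> separated s Y X"
  unfolding separated_def by auto

lemma separated_mono: "separated s X Y \<Longrightarrow> X' \<subseteq> X \<Longrightarrow> Y' \<subseteq> Y \<Longrightarrow> separated s X' Y'"
  unfolding separated_def by blast

text \<open>
  Subtracting the tangent at a point of \<open>Y\<close> makes the phases on \<open>Y\<close> of size \<open>lam * b\<^sup>2\<close>, while the phase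
  is steep, of slope at least \<open>lam * s\<close>, on the separated set \<open>X\<close>.
\<close>
lemma separated_resonance:
  assumes J: "X \<subseteq> J" "Y \<subseteq> J" and sep: "separated s X Y" and s: "s \<ge> 0"
    and Y: "Y \<subseteq> {d..<d + b}"
    and X: "x \<in> X" "y \<in> X" and z: "z1 \<in> Y" "z2 \<in> Y" "z3 \<in> Y" "z4 \<in> Y"
    and lin: "x + z1 + z2 = y + z3 + z4"
    and phase: "\<bar>h x + h z1 + h z2 - h y - h z3 - h z4\<bar> < 1"
  shows "of_int (s * \<bar>x - y\<bar>) \<le> 1 + 4 * C * (of_int b)\<^sup>2"
proof -
  define \<psi> where "\<psi> z = h z - h z1 - g z1 * (z - z1)" for z
  have \<psi>: "\<bar>\<psi> z\<bar> \<le> C * lam * (of_int b)\<^sup>2" if "z \<in> Y" for z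
  proof -
    have "\<bar>z - z1\<bar> \<le> b" using that z Y by (auto simp: subset_iff) (smt (verit))
    then have "\<bar>real_of_int (z - z1)\<bar> \<le> of_int b" by linarith
    then have "(real_of_int (z - z1))\<^sup>2 \<le> (of_int b)\<^sup>2"
      using power_mono[of "\<bar>real_of_int (z - z1)\<bar>" "of_int b" 2] by simp
    then have "C * lam * (real_of_int (z - z1))\<^sup>2 \<le> C * lam * (of_int b)\<^sup>2"
      using C_nonneg lam_ge_1 by (intro mult_left_mono) auto
    with tangent[of z z1] that z J show ?thesis
      unfolding \<psi>_def by (auto simp: subset_iff)
  qed
  have "lam * of_int s * \<bar>of_int x - of_int y\<bar> \<le> \<bar>h x - h y - g z1 * (of_int x - of_int y)\<bar>"
  proof (rule transversal)
    show "x \<in> J" "y \<in> J" "z1 \<in> J" using J X z by auto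
    \<comment> \<open>This is where \<open>X\<close> has to lie entirely on one side of
      \<open>Y\<close>: with z1 between x and y the mean slope from x to y could equal the slope at
      z1.\<close>
    show "z1 + s \<le> x \<and> z1 + s \<le> y \<or> x + s \<le> z1 \<and> y + s \<le> z1"
      using sep X z unfolding separated_def by blast
  qed (use s in simp)
  \<comment> \<open>By \<open>lin\<close> the difference x - y is the opposite of the difference on
    \<open>Y\<close>, so the tangent correction moves from x and y to the four points of
    \<open>Y\<close>.\<close>
  also have "h x - h y - g z1 * (of_int x - of_int y) =
    (h x + h z1 + h z2 - h y - h z3 - h z4) - (\<psi> z1 + \<psi> z2 - \<psi> z3 - \<psi> z4)"
  proof -
    have "real_of_int x - of_int y = of_int z3 + of_int z4 - of_int z1 - of_int z2"
      using lin by linarith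
    then have "g z1 * (of_int x - of_int y) = g z1 * (of_int z3 + of_int z4 - of_int z1 - of_int z2)"
      by (simp only:)
    then show ?thesis unfolding \<psi>_def by (simp add: algebra_simps)
  qed
  also have "\<bar>\<dots>\<bar> \<le> 1 + 4 * (C * lam * (of_int b)\<^sup>2)"
    using \<psi>[of z1] \<psi>[of z2] \<psi>[of z3] \<psi>[of z4] z phase by linarith
  \<comment> \<open>Since \<open>lam\<close> is at least 1 it absorbs the unit tolerance of the
    resonance; the curvature then cancels and leaves a bound free of it.\<close>
  also have "\<dots> \<le> lam * (1 + 4 * C * (of_int b)\<^sup>2)"
    using lam_ge_1 by (simp add: algebra_simps)
  finally have "lam * (of_int s * \<bar>of_int x - of_int y\<bar>) \<le> lam * (1 + 4 * C * (of_int b)\<^sup>2)"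
    by (simp add: mult.assoc)
  then show ?thesis using lam_ge_1 by (simp add: mult_le_cancel_left_pos)
qed

text \<open>Position, length and subset are quantified together, so that the bound can be applied to
  every block at every scale. It is expressed by the length of a covering interval, since blocks are
  cut from intervals while the sets themselves may be sparse.\<close>

definition sixth_bound :: "real \<Rightarrow> real \<Rightarrow> bool"
  where "sixth_bound A \<eta> \<longleftrightarrow> (\<forall>X n m. X \<subseteq> J \<longrightarrow> X \<subseteq> {n..<n + int m} \<longrightarrow> m \<ge> 1 \<longrightarrow>
    (LINT z|M. (cmod (F X z)) ^ 6) \<le> A * real m powr \<eta> * (mass X) ^ 3)"

text \<open>
  Write \<open>B j = R ^ (2^k - 2^j)\<close> and \<open>S = R ^ (2^k)\<close>, so that \<open>(B j)\<^sup>2 = S * B (Suc j)\<close>. By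
  \<open>separated_resonance\<close> only nearby blocks of length \<open>B (Suc j)\<close> of \<open>X\<close> interact, and on each of them
  Cauchy--Schwarz exchanges the roles of \<open>X\<close> and \<open>Y\<close>; at \<open>j = k\<close> the blocks are single points. The
  exponents \<open>w j = 2^k - 2^j * (1 + (k - j) / 2)\<close> solve \<open>2 * w j = w (Suc j) + (2^k - 2^j)\<close>, \<open>w k = 0\<close>.
\<close>
lemma mixed_separated_le:
  fixes R k L :: nat and A \<eta> :: real
  defines "G \<equiv> (2 * real L + 1)\<^sup>2 * A + total"
  assumes bound: "sixth_bound A \<eta>" and A: "A \<ge> 0" and R: "R \<ge> 1" and L: "1 + 4 * C \<le> real L"
    and "j \<le> k"
    and "X \<subseteq> J" "finite X" "Y \<subseteq> J" "Y \<subseteq> {d..<d + int R ^ (2^k - 2^j)}" "separated (int R ^ (2^k)) X Y"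
  shows "mixed X Y \<le> G * real R powr (\<eta> * (2^k - 2^j * (1 + (real k - real j) / 2))) * mass X * (mass Y)\<^sup>2"
  using assms(6-)
proof (induction j arbitrary: X Y d rule: inc_induct)
  case base
  have Y: "Y \<subseteq> {d}" using base by auto
  then have *: "mixed X Y \<le> total * mass X * (mass Y)\<^sup>2"
    using mixed_singleton_le[of X d] base
    by (cases "Y = {}") (auto simp: mixed_def F_def mass_def subset_singleton_iff)
  also have "total * mass X * (mass Y)\<^sup>2 \<le> G * mass X * (mass Y)\<^sup>2"
    unfolding G_def using A by (intro mult_right_mono) auto
  finally show ?case using R by simp
next
  case (step j)
  define b b' S :: int where "b = int R ^ (2^k - 2^j)" and "b' = int R ^ (2^k - 2^Suc j)" and "S = int R ^ (2^k)"
  have jk: "(2::nat)^Suc j \<le> 2^k" using step.hyps by (intro power_increasing) auto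
  have bb: "b\<^sup>2 = S * b'"
  proof -
    have "(2^k - 2^j) * 2 = 2^k + (2^k - 2^Suc j::nat)" using jk by simp
    then show ?thesis unfolding b_def b'_def S_def power_mult[symmetric] power_add[symmetric] by simp
  qed
  have pos: "b \<ge> 1" "b' \<ge> 1" "S \<ge> 1" unfolding b_def b'_def S_def using R by simp_all
  have fY: "finite Y" using step.prems finite_subset by blast
  let ?X = "\<lambda>\<kappa>. {n\<in>X. n div b' = \<kappa>}"
  define \<rho> \<rho>' where "\<rho> = real R powr (\<eta> * (2^k - 2^j * (1 + (real k - real j) / 2)))"
    and "\<rho>' = real R powr (\<eta> * (2^k - 2^Suc j * (1 + (real k - real (Suc j)) / 2)))"
  have \<rho>: "\<rho>\<^sup>2 = \<rho>' * real (nat b) powr \<eta>"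
  proof -
    have "(2::nat)^j \<le> 2^k" using step.hyps by simp
    then have e: "real (2^k - 2^j) = 2^k - 2^j" by (simp add: of_nat_diff)
    have "real (nat b) = real R powr (2^k - 2^j)"
      unfolding b_def e[symmetric] using R by (simp add: powr_realpow nat_power_eq)
    then have "real (nat b) powr \<eta> = real R powr ((2^k - 2^j) * \<eta>)" by (simp add: powr_powr)
    moreover have "\<rho>\<^sup>2 = real R powr (\<eta> * (2^k - 2^j * (1 + (real k - real j) / 2)) * 2)"
      unfolding \<rho>_def using R by (simp add: powr_powr flip: powr_numeral)
    moreover have "\<eta> * (2^k - 2^j * (1 + (real k - real j) / 2)) * 2 =
        \<eta> * (2^k - 2^Suc j * (1 + (real k - real (Suc j)) / 2)) + (2^k - 2^j) * \<eta>"
      by (simp add: field_simps)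
    ultimately show ?thesis
      unfolding \<rho>'_def by (simp add: powr_add[symmetric])
  qed
  \<comment> \<open>The two summands of \<open>G\<close> serve the two ends of the induction:
    \<open>total\<close> dominates the base case, and (2 L + 1)^2 A gives G A \<le> (G / (2 L +
    1))^2, so the loss 2 L + 1 of each diagonal estimate is recovered and the constant stays the
    same at every level.\<close>
  have G: "(2 * real L + 1)\<^sup>2 * A \<le> G" "G \<ge> 0" unfolding G_def using A by simp_all
  have "mixed X Y \<le> (2 * real L + 1) * (\<Sum>\<kappa>\<in>(\<lambda>n. n div b') ` X. mixed (?X \<kappa>) Y)"
  proof (rule mixed_le_diagonal[OF \<open>finite X\<close> fY])
    fix x y z1 z2 z3 z4
    assume *: "x \<in> X" "y \<in> X" "int L < \<bar>x div b' - y div b'\<bar>" "z1 \<in> Y" "z2 \<in> Y" "z3 \<in> Y" "z4 \<in> Y"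
    show "x + z1 + z2 \<noteq> y + z3 + z4 \<or> 1 \<le> \<bar>h x + h z1 + h z2 - h y - h z3 - h z4\<bar>"
    proof (rule ccontr)
      assume "\<not> ?thesis"
      then have "of_int (S * \<bar>x - y\<bar>) \<le> 1 + 4 * C * (of_int b)\<^sup>2"
        using * step.prems pos by (intro separated_resonance[of X Y S d b x y z1 z2 z3 z4]) (auto simp: b_def S_def)
      also have "\<dots> \<le> (1 + 4 * C) * (of_int b)\<^sup>2"
        using pos by (simp add: distrib_right one_le_power)
      also have "\<dots> \<le> real L * (of_int b)\<^sup>2" using L by (intro mult_right_mono) auto
      also have "\<dots> = of_int (S * (int L * b'))"
        by (simp flip: of_int_power add: bb)
      finally have "S * \<bar>x - y\<bar> \<le> S * (int L * b')" by (simp only: of_int_le_iff)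
      then have "\<bar>x - y\<bar> \<le> int L * b'" using pos by simp
      from div_diff_le[OF _ this] pos *(3) show False by simp
    qed
  qed
  also have "\<dots> \<le> (2 * real L + 1) * (\<Sum>\<kappa>\<in>(\<lambda>n. n div b') ` X. G / (2 * real L + 1) * \<rho> * mass (?X \<kappa>) * (mass Y)\<^sup>2)"
  proof (intro mult_left_mono sum_mono)
    fix \<kappa>
    have block: "?X \<kappa> \<subseteq> {\<kappa> * b'..<\<kappa> * b' + b'}"
    proof
      fix n assume "n \<in> ?X \<kappa>"
      then have "n div b' = \<kappa>" by simp
      moreover have "b' > 0" using pos by simp
      ultimately show "n \<in> {\<kappa> * b'..<\<kappa> * b' + b'}" using div_eq_bounds by (metis atLeastLessThan_iff)
    qed
    \<comment> \<open>The roles are exchanged: the block of \<open>X\<close>, of length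
      \<open>b'\<close>, is short enough to be the second argument at level \<open>Suc j\<close>,
      and \<open>Y\<close> becomes the first.\<close>
    have IH: "mixed Y (?X \<kappa>) \<le> G * \<rho>' * mass Y * (mass (?X \<kappa>))\<^sup>2"
      unfolding \<rho>'_def
    proof (rule step.IH)
      show "?X \<kappa> \<subseteq> {\<kappa> * b'..<\<kappa> * b' + int R ^ (2^k - 2^Suc j)}"
        using block unfolding b'_def[symmetric] .
      have "separated (int R ^ (2^k)) (?X \<kappa>) Y"
        by (rule separated_mono[OF \<open>separated (int R ^ (2^k)) X Y\<close>]) auto
      then show "separated (int R ^ (2^k)) Y (?X \<kappa>)" by (simp only: separated_sym)
    qed (use \<open>X \<subseteq> J\<close> \<open>Y \<subseteq> J\<close> fY in auto)
    have "(LINT z|M. (cmod (F Y z)) ^ 6) \<le> A * real (nat b) powr \<eta> * (mass Y) ^ 3"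
      using bound[unfolded sixth_bound_def, rule_format, of Y d "nat b"] step.prems pos
      by (simp add: b_def[symmetric])
    then have "(mixed (?X \<kappa>) Y)\<^sup>2 \<le> (G * \<rho>' * mass Y * (mass (?X \<kappa>))\<^sup>2) * (A * real (nat b) powr \<eta> * (mass Y) ^ 3)"
      using IH G by (intro order_trans[OF mixed_le_swap] mult_mono) (auto simp: \<rho>'_def)
    also have "\<dots> = (G * A) * (\<rho> * mass (?X \<kappa>) * (mass Y)\<^sup>2)\<^sup>2"
      unfolding power_mult_distrib \<rho> by (simp add: power2_eq_square power3_eq_cube)
    also have "\<dots> \<le> (G / (2 * real L + 1))\<^sup>2 * (\<rho> * mass (?X \<kappa>) * (mass Y)\<^sup>2)\<^sup>2"
    proof (intro mult_right_mono)
      have "G * A * (2 * real L + 1)\<^sup>2 \<le> G * G" using G by (simp add: mult_left_mono mult.assoc mult.commute[of A])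
      then show "G * A \<le> (G / (2 * real L + 1))\<^sup>2"
        by (simp add: power_divide pos_le_divide_eq power2_eq_square[of G])
    qed simp
    also have "\<dots> = (G / (2 * real L + 1) * \<rho> * mass (?X \<kappa>) * (mass Y)\<^sup>2)\<^sup>2"
      by (simp only: power_mult_distrib mult.assoc)
    finally show "mixed (?X \<kappa>) Y \<le> G / (2 * real L + 1) * \<rho> * mass (?X \<kappa>) * (mass Y)\<^sup>2"
      by (rule power2_le_imp_le) (use G in \<open>auto simp: \<rho>_def\<close>)
  qed simp
  also have "\<dots> = G * \<rho> * mass X * (mass Y)\<^sup>2"
    using \<open>finite X\<close> by (subst mass_partition[of X "(\<lambda>n. n div b') ` X" "\<lambda>n. n div b'"])
       (simp_all add: sum_distrib_left sum_distrib_right mult_ac)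
  finally show ?case unfolding \<rho>_def .
qed

end

section \<open>Decoupling for the sixth moment\<close>

lemma add_pow6_le:
  fixes u v :: real
  assumes "u \<ge> 0" "v \<ge> 0"
  shows "(u + v) ^ 6 \<le> 32 * (u ^ 6 + v ^ 6)"
proof -
  have sq: "(u + v)\<^sup>2 \<le> 2 * (u\<^sup>2 + v\<^sup>2)"
    using zero_le_power2[of "u - v"] by (simp add: power2_eq_square algebra_simps)
  have cube: "(x + y) ^ 3 \<le> 4 * (x ^ 3 + y ^ 3)" if "x \<ge> 0" "y \<ge> 0" for x y :: real
  proof -
    have "4 * (x ^ 3 + y ^ 3) - (x + y) ^ 3 = 3 * (x + y) * (x - y)\<^sup>2"
      by (simp add: power2_eq_square power3_eq_cube algebra_simps)
    moreover have "\<dots> \<ge> 0" using that by simp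
    ultimately show ?thesis by linarith
  qed
  have "(u + v) ^ 6 = ((u + v)\<^sup>2) ^ 3" by (simp flip: power_mult)
  also have "\<dots> \<le> (2 * (u\<^sup>2 + v\<^sup>2)) ^ 3" using sq by (intro power_mono) auto
  also have "\<dots> = 8 * (u\<^sup>2 + v\<^sup>2) ^ 3"
      unfolding power_mult_distrib by simp
  also have "\<dots> \<le> 8 * (4 * ((u\<^sup>2) ^ 3 + (v\<^sup>2) ^ 3))" by (intro mult_left_mono cube) auto
  finally show ?thesis by (simp flip: power_mult)
qed

lemma finite_argmax:
  fixes f :: "'a \<Rightarrow> real"
  assumes "finite S" "S \<noteq> {}"
  obtains s where "s \<in> S" "\<And>t. t \<in> S \<Longrightarrow> f t \<le> f s"
proof -
  have "Max (f ` S) \<in> f ` S" using assms by (intro Max_in) auto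
  then obtain s where s: "s \<in> S" "f s = Max (f ` S)" by (metis imageE)
  have "f t \<le> f s" if "t \<in> S" for t
    unfolding s(2) using assms that by (intro Max_ge) auto
  with s(1) show ?thesis by (rule that)
qed

context curve_system begin

text \<open>Bourgain--Guth dichotomy: \<open>\<beta>\<close> assigns fine blocks and
  \<open>\<gamma>\<close> their coarse parents. Let j be the fine block with the largest sum at
  \<open>z\<close>. Fine blocks with parents adjacent to that of j make up the narrow part, at most
  three coarse blocks. The rest is at most \<open>P\<close> times its largest term, at some i far
  from j, and |F_i| \<le> |F_j| turns |F_i|^6 into a product of weights 2 and 4. As i and j depend
  on \<open>z\<close>, sums over all choices take their place.\<close>

lemma broad_narrow:
  fixes \<beta> \<gamma> :: "int \<Rightarrow> int" and K1 K2 :: "int set" and P :: nat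
  assumes X: "finite X" and K: "finite K1" "finite K2" "K2 \<noteq> {}" "card K2 \<le> P"
    and \<beta>: "\<beta> ` X \<subseteq> K2" and \<gamma>: "\<gamma> ` K2 \<subseteq> K1"
  defines "far j \<equiv> {i\<in>K2. 2 \<le> \<bar>\<gamma> i - \<gamma> j\<bar>}"
  shows "(cmod (F X z)) ^ 6 \<le>
    32 * (\<Sum>k\<in>K1. (cmod (F {n\<in>X. \<bar>\<gamma> (\<beta> n) - k\<bar> \<le> 1} z)) ^ 6) +
    32 * real P ^ 6 * (\<Sum>j\<in>K2. \<Sum>i\<in>far j. (cmod (F {n\<in>X. \<beta> n = i} z))\<^sup>2 * (cmod (F {n\<in>X. \<beta> n = j} z)) ^ 4)"
    (is "_ \<le> 32 * ?N + 32 * _ * ?B")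
proof -
  let ?X = "\<lambda>i. {n\<in>X. \<beta> n = i}"
  let ?f = "\<lambda>i. cmod (F (?X i) z)"
  obtain j where j: "j \<in> K2" "\<And>i. i \<in> K2 \<Longrightarrow> ?f i \<le> ?f j"
    using finite_argmax[OF K(2,3), of ?f] by blast
  define N where "N = {n\<in>X. \<bar>\<gamma> (\<beta> n) - \<gamma> j\<bar> \<le> 1}"
  have fin: "finite (far j)" unfolding far_def using K by simp
  have "F X z = (\<Sum>i\<in>K2. F (?X i) z)" by (rule F_partition[OF X K(2) \<beta>])
  also have "\<dots> = (\<Sum>i\<in>K2 - far j. F (?X i) z) + (\<Sum>i\<in>far j. F (?X i) z)"
    using K by (intro sum.subset_diff) (auto simp: far_def)
  also have "(\<Sum>i\<in>K2 - far j. F (?X i) z) = (\<Sum>i\<in>K2 - far j. F {n\<in>N. \<beta> n = i} z)"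
  proof (intro sum.cong refl)
    fix i assume "i \<in> K2 - far j"
    then have "?X i = {n\<in>N. \<beta> n = i}" by (auto simp: N_def far_def)
    then show "F (?X i) z = F {n\<in>N. \<beta> n = i} z" by simp
  qed
  also have "\<dots> = F N z"
    using X K \<beta> by (intro F_partition[symmetric]) (auto simp: N_def far_def)
  finally have "cmod (F X z) \<le> cmod (F N z) + (\<Sum>i\<in>far j. ?f i)"
    by (simp only:) (intro order_trans[OF norm_triangle_ineq] add_left_mono norm_sum)
  then have "(cmod (F X z)) ^ 6 \<le> (cmod (F N z) + (\<Sum>i\<in>far j. ?f i)) ^ 6"
    by (intro power_mono) auto
  also have "\<dots> \<le> 32 * ((cmod (F N z)) ^ 6 + (\<Sum>i\<in>far j. ?f i) ^ 6)"
    by (intro add_pow6_le sum_nonneg) auto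
  also have "(cmod (F N z)) ^ 6 \<le> ?N"
    unfolding N_def using j \<gamma> K by (intro member_le_sum[of "\<gamma> j" K1 "\<lambda>k. (cmod (F {n\<in>X. \<bar>\<gamma> (\<beta> n) - k\<bar> \<le> 1} z)) ^ 6"]) auto
  also have "(\<Sum>i\<in>far j. ?f i) ^ 6 \<le> real P ^ 6 * ?B"
  proof (cases "far j = {}")
    case True
    then show ?thesis by (simp add: sum_nonneg)
  next
    case False
    then obtain i where i: "i \<in> far j" "\<And>i'. i' \<in> far j \<Longrightarrow> ?f i' \<le> ?f i"
      using finite_argmax[OF fin, of ?f] by blast
    have "card (far j) \<le> P"
      using K card_mono[OF K(2), of "far j"] by (auto simp: far_def)
    then have "(\<Sum>i\<in>far j. ?f i) \<le> P * ?f i"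
      by (intro order_trans[OF sum_bounded_above[of "far j" ?f, OF i(2)]] mult_right_mono) auto
    then have "(\<Sum>i\<in>far j. ?f i) ^ 6 \<le> (P * ?f i) ^ 6"
      by (intro power_mono sum_nonneg) auto
    also have "\<dots> = real P ^ 6 * (?f i ^ 2 * ?f i ^ 4)"
      by (simp add: power_mult_distrib flip: power_add)
    also have "\<dots> \<le> real P ^ 6 * (?f i ^ 2 * ?f j ^ 4)"
      using i j by (intro mult_left_mono power_mono) (auto simp: far_def)
    also have "?f i ^ 2 * ?f j ^ 4 \<le> (\<Sum>i\<in>far j. ?f i ^ 2 * ?f j ^ 4)"
      using i fin by (intro member_le_sum[of i "far j" "\<lambda>i. ?f i ^ 2 * ?f j ^ 4"]) auto
    also have "\<dots> \<le> ?B"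
      using j K by (intro member_le_sum[of j K2 "\<lambda>j. \<Sum>i\<in>far j. ?f i ^ 2 * ?f j ^ 4"]) (auto intro: sum_nonneg)
    finally show ?thesis by (simp add: mult_left_mono)
  qed
  finally show ?thesis by (simp add: algebra_simps)
qed

text \<open>
  The broad part gains a factor \<open>R\<close> to the power \<open>\<eta> * (1 + k / 2)\<close>, which for large \<open>k\<close> pays for the loss
  \<open>R ^ 12\<close> in \<open>broad_narrow\<close>.
\<close>
lemma sixth_bound_step:
  fixes R k L :: nat and A \<eta> :: real
  defines "G \<equiv> (2 * real L + 1)\<^sup>2 * A + total"
  assumes bound: "sixth_bound A \<eta>" and A: "A \<ge> 0" and R: "R \<ge> 1" and L: "1 + 4 * C \<le> real L"
    and \<eta>: "\<eta> \<ge> 0" "\<eta> * (1 + real k / 2) \<ge> 12"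
    and X: "X \<subseteq> J" "X \<subseteq> {n0..<n0 + int R ^ (2^k + 1)}"
  shows "(LINT z|M. (cmod (F X z)) ^ 6) \<le> (96 * 3 powr \<eta> * A + 32 * G) * real R powr (\<eta> * 2^k) * (mass X) ^ 3"
proof -
  \<comment> \<open>\<open>S\<close> is the gap and \<open>b\<close> the block length that
    \<open>mixed_separated_le\<close> requires at level 0. The interval consists of \<open>r\<close>
    coarse blocks of length \<open>S\<close>, each consisting of \<open>r\<close> fine blocks of
    length \<open>b\<close>.\<close>
  define b S r :: int where "b = int R ^ (2^k - 1)" and "S = int R ^ (2^k)" and "r = int R"
  have pos: "b \<ge> 1" "S \<ge> 1" "r \<ge> 1" unfolding b_def S_def r_def using R by simp_all
  have "(2::nat)^k - 1 + 1 = 2^k" by simp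
  then have Sb: "S = b * r" unfolding S_def b_def r_def by (metis power_add power_one_right)
  have fX: "finite X" using X finite_subset by blast
  define \<beta> where "\<beta> n = (n - n0) div b" for n
  define \<gamma> where "\<gamma> i = i div r" for i
  have \<gamma>\<beta>: "\<gamma> (\<beta> n) = (n - n0) div S" for n
    unfolding \<gamma>_def \<beta>_def Sb using pos by (simp add: zdiv_zmult2_eq)
  define K1 K2 where "K1 = {0..<r}" and "K2 = {0..<r\<^sup>2}"
  define far where "far j = {i\<in>K2. 2 \<le> \<bar>\<gamma> i - \<gamma> j\<bar>}" for j
  let ?X = "\<lambda>i. {n\<in>X. \<beta> n = i}"
  let ?N = "\<lambda>k. {n\<in>X. \<bar>\<gamma> (\<beta> n) - k\<bar> \<le> 1}"
  have K: "finite K1" "finite K2" "K2 \<noteq> {}" unfolding K1_def K2_def using pos by auto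
  have card: "card K2 \<le> R\<^sup>2" unfolding K2_def r_def by (simp add: nat_power_eq)
  have \<beta>: "\<beta> ` X \<subseteq> K2"
  proof
    fix i assume "i \<in> \<beta> ` X"
    then obtain n where n: "n \<in> X" "i = \<beta> n" by blast
    have "int R ^ (2^k + 1) = r\<^sup>2 * b"
      using Sb by (simp add: S_def r_def power2_eq_square)
    then have "0 \<le> n - n0" "n - n0 < r\<^sup>2 * b" using n X by auto
    then show "i \<in> K2"
      unfolding n(2) \<beta>_def K2_def using pos div_int_less[of b "n - n0" "r\<^sup>2"]
      by (simp add: pos_imp_zdiv_nonneg_iff)
  qed
  have \<gamma>: "\<gamma> ` K2 \<subseteq> K1"
  proof
    fix k assume "k \<in> \<gamma> ` K2"
    then obtain i where i: "0 \<le> i" "i < r * r" "k = i div r"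
      unfolding K2_def \<gamma>_def by (auto simp: power2_eq_square)
    then show "k \<in> K1" unfolding K1_def using pos div_int_less[of r i r]
      by (simp add: pos_imp_zdiv_nonneg_iff)
  qed
  have cpos: "0 \<le> A * (3 powr \<eta> * real R powr (\<eta> * 2^k))" using A by simp
  have S': "S = int (R ^ (2^k))" unfolding S_def by simp
  have narrow: "(LINT z|M. (cmod (F (?N i) z)) ^ 6) \<le> A * (3 powr \<eta> * real R powr (\<eta> * 2^k)) * mass (?N i) * (mass X)\<^sup>2" for i
  proof -
    have N: "?N i \<subseteq> {n0 + (i - 1) * S..<n0 + (i - 1) * S + int (3 * R ^ (2^k))}"
    proof
      fix n assume "n \<in> ?N i"
      then have n: "\<bar>(n - n0) div S - i\<bar> \<le> 1" by (simp add: \<gamma>\<beta>)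
      have "(n - n0) div S * S \<le> n - n0" "n - n0 < (n - n0) div S * S + S"
        using div_eq_bounds[of S "n - n0" "(n - n0) div S"] pos by simp_all
      moreover have "(i - 1) * S \<le> (n - n0) div S * S" "(n - n0) div S * S \<le> (i + 1) * S"
        using n pos by (intro mult_right_mono; linarith)+
      ultimately show "n \<in> {n0 + (i - 1) * S..<n0 + (i - 1) * S + int (3 * R ^ (2^k))}"
        unfolding of_nat_mult S'[symmetric] by (simp add: algebra_simps)
    qed
    have R3: "3 * R ^ (2^k) \<ge> 1" using R by simp
    have "?N i \<subseteq> J" using X by auto
    with bound[unfolded sixth_bound_def, rule_format, OF _ N R3]
    have "(LINT z|M. (cmod (F (?N i) z)) ^ 6) \<le> A * real (3 * R ^ (2^k)) powr \<eta> * (mass (?N i)) ^ 3"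
      by blast
    also have "real (3 * R ^ (2^k)) powr \<eta> = 3 powr \<eta> * real R powr (\<eta> * 2^k)"
      using R by (simp add: powr_mult powr_powr mult.commute flip: powr_realpow)
    also have "A * (3 powr \<eta> * real R powr (\<eta> * 2^k)) * (mass (?N i)) ^ 3 =
        A * (3 powr \<eta> * real R powr (\<eta> * 2^k)) * mass (?N i) * (mass (?N i))\<^sup>2"
      by (simp add: power2_eq_square power3_eq_cube)
    also have "\<dots> \<le> A * (3 powr \<eta> * real R powr (\<eta> * 2^k)) * mass (?N i) * (mass X)\<^sup>2"
      using cpos fX by (intro mult_left_mono power_mono mass_mono mult_nonneg_nonneg[OF cpos]) auto
    finally show ?thesis .
  qed
  \<comment> \<open>Each n lies in at most three narrow sets. Only one of the three mass factors is
    summed, the other two having been bounded by \<open>mass X\<close>.\<close>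
  have sumN: "(\<Sum>i\<in>K1. mass (?N i)) \<le> 3 * mass X"
  proof -
    have "(\<Sum>i\<in>K1. mass (?N i)) = (\<Sum>i\<in>K1. \<Sum>n\<in>X. if \<bar>\<gamma> (\<beta> n) - i\<bar> \<le> 1 then (cmod (a n))\<^sup>2 else 0)"
      unfolding mass_def using fX by (simp add: sum.inter_filter)
    also have "\<dots> = (\<Sum>n\<in>X. \<Sum>i\<in>K1. if \<bar>\<gamma> (\<beta> n) - i\<bar> \<le> 1 then (cmod (a n))\<^sup>2 else 0)"
      by (rule sum.swap)
    also have "\<dots> \<le> (\<Sum>n\<in>X. 3 * (cmod (a n))\<^sup>2)"
    proof (intro sum_mono)
      fix n
      have "(\<Sum>i\<in>K1. if \<bar>\<gamma> (\<beta> n) - i\<bar> \<le> 1 then (cmod (a n))\<^sup>2 else 0) =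
          card {i\<in>K1. \<bar>\<gamma> (\<beta> n) - i\<bar> \<le> 1} * (cmod (a n))\<^sup>2"
        using K by (simp add: sum.If_cases Int_def)
      also have "card {i\<in>K1. \<bar>\<gamma> (\<beta> n) - i\<bar> \<le> 1} \<le> card {\<gamma> (\<beta> n) - 1..\<gamma> (\<beta> n) + 1}"
        by (intro card_mono) auto
      finally show "(\<Sum>i\<in>K1. if \<bar>\<gamma> (\<beta> n) - i\<bar> \<le> 1 then (cmod (a n))\<^sup>2 else 0) \<le> 3 * (cmod (a n))\<^sup>2"
        by (simp add: mult_right_mono)
    qed
    finally show ?thesis by (simp add: mass_def sum_distrib_left)
  qed
  have G0: "G \<ge> 0" unfolding G_def using A by simp
  define D where "D = G * real R powr (\<eta> * (2^k - (1 + real k / 2)))"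
  have D0: "D \<ge> 0" unfolding D_def using G0 by simp
  define c where "c = A * (3 powr \<eta> * real R powr (\<eta> * 2^k))"
  have c0: "c \<ge> 0" unfolding c_def by (rule cpos)
  have broad: "mixed (?X i) (?X j) \<le> D * mass (?X i) * (mass (?X j))\<^sup>2" if "i \<in> far j" for i j
  proof -
    have blk: "i * b \<le> n - n0 \<and> n - n0 < i * b + b \<and> \<gamma> i * S \<le> n - n0 \<and> n - n0 < \<gamma> i * S + S" if "n \<in> ?X i" for n i
    proof -
      have *: "(n - n0) div b = i" "(n - n0) div S = \<gamma> i"
        using that \<gamma>\<beta>[of n] unfolding \<beta>_def by auto
      have "b > 0" "S > 0" using pos by auto
      from div_eq_bounds[OF this(1) *(1)] div_eq_bounds[OF this(2) *(2)] show ?thesis by blast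
    qed
    \<comment> \<open>Parents at distance at least 2 leave a whole coarse block of length
      \<open>S\<close> in between; adjacent parents would guarantee no gap at all.\<close>
    have "separated S (?X i) (?X j)"
    proof (cases "\<gamma> i + 2 \<le> \<gamma> j")
      case True
      then have "(\<gamma> i + 2) * S \<le> \<gamma> j * S" using pos by (intro mult_right_mono) auto
      then have "x + S \<le> y" if "x \<in> ?X i" "y \<in> ?X j" for x y
        using blk[OF that(1)] blk[OF that(2)] by (simp add: algebra_simps)
      then show ?thesis unfolding separated_def by blast
    next
      case False
      then have "\<gamma> j + 2 \<le> \<gamma> i" using that unfolding far_def by auto
      then have "(\<gamma> j + 2) * S \<le> \<gamma> i * S" using pos by (intro mult_right_mono) auto
      then have "y + S \<le> x" if "x \<in> ?X i" "y \<in> ?X j" for x y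
        using blk[OF that(1)] blk[OF that(2)] by (simp add: algebra_simps)
      then show ?thesis unfolding separated_def by blast
    qed
    moreover have "?X j \<subseteq> {n0 + j * b..<n0 + j * b + int R ^ (2^k - 2^0)}"
    proof
      fix n assume "n \<in> ?X j"
      from blk[OF this] have "n0 + j * b \<le> n" "n < n0 + j * b + b" by linarith+
      then show "n \<in> {n0 + j * b..<n0 + j * b + int R ^ (2^k - 2^0)}"
        unfolding power_0 b_def[symmetric] by (simp only: atLeastLessThan_iff)
    qed
    ultimately have "mixed (?X i) (?X j) \<le> G * real R powr (\<eta> * (2^k - 2^0 * (1 + (real k - real 0) / 2))) * mass (?X i) * (mass (?X j))\<^sup>2"
      using X fX unfolding G_def S_def by (intro mixed_separated_le[OF bound A R L, of 0 k "?X i" "?X j" "n0 + j * b"]) auto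
    then show ?thesis unfolding D_def by simp
  qed
  have sumB: "(\<Sum>j\<in>K2. \<Sum>i\<in>far j. mass (?X i) * (mass (?X j))\<^sup>2) \<le> (mass X) ^ 3"
  proof -
    have mX: "mass X = (\<Sum>i\<in>K2. mass (?X i))" by (rule mass_partition[OF fX K(2) \<beta>])
    have "(\<Sum>j\<in>K2. \<Sum>i\<in>far j. mass (?X i) * (mass (?X j))\<^sup>2) \<le> (\<Sum>j\<in>K2. mass X * (mass X * mass (?X j)))"
    proof (intro sum_mono)
      fix j
      have "(\<Sum>i\<in>far j. mass (?X i) * (mass (?X j))\<^sup>2) \<le> (\<Sum>i\<in>K2. mass (?X i) * (mass (?X j))\<^sup>2)"
        using K by (intro sum_mono2) (auto simp: far_def)
      also have "\<dots> = mass X * (mass (?X j) * mass (?X j))"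
        unfolding mX sum_distrib_right by (simp add: power2_eq_square)
      also have "\<dots> \<le> mass X * (mass X * mass (?X j))"
        using fX by (intro mult_left_mono mult_right_mono mass_mono) auto
      finally show "(\<Sum>i\<in>far j. mass (?X i) * (mass (?X j))\<^sup>2) \<le> mass X * (mass X * mass (?X j))" .
    qed
    also have "\<dots> = mass X * (mass X * mass X)"
      by (simp only: sum_distrib_left[symmetric] mX[symmetric])
    finally show ?thesis by (simp add: power3_eq_cube)
  qed
  have "(LINT z|M. (cmod (F X z)) ^ 6) \<le> (LINT z|M.
    32 * (\<Sum>k\<in>K1. (cmod (F (?N k) z)) ^ 6) +
    32 * real (R\<^sup>2) ^ 6 * (\<Sum>j\<in>K2. \<Sum>i\<in>far j. (cmod (F (?X i) z))\<^sup>2 * (cmod (F (?X j) z)) ^ 4))"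
    unfolding far_def
    by (rule integral_mono[OF integrable_norm_pow _ broad_narrow[OF fX K card \<beta> \<gamma>]])
       (intro integrable_norm_pow Bochner_Integration.integrable_add
        integrable_mult_right Bochner_Integration.integrable_sum integrable_norm_prod)
  also have "\<dots> = 32 * (\<Sum>k\<in>K1. LINT z|M. (cmod (F (?N k) z)) ^ 6) +
      32 * real (R\<^sup>2) ^ 6 * (\<Sum>j\<in>K2. \<Sum>i\<in>far j. mixed (?X i) (?X j))"
    unfolding mixed_def
    by (simp only: Bochner_Integration.integral_add Bochner_Integration.integral_sum integral_mult_right_zero
        integrable_norm_pow integrable_norm_prod Bochner_Integration.integrable_sum integrable_mult_right)
  also have "\<dots> \<le> 32 * (c * (mass X)\<^sup>2 * (\<Sum>i\<in>K1. mass (?N i))) +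
      32 * real (R\<^sup>2) ^ 6 * (D * (\<Sum>j\<in>K2. \<Sum>i\<in>far j. mass (?X i) * (mass (?X j))\<^sup>2))"
  proof (intro add_mono mult_left_mono)
    show "(\<Sum>k\<in>K1. LINT z|M. (cmod (F (?N k) z)) ^ 6) \<le> c * (mass X)\<^sup>2 * (\<Sum>i\<in>K1. mass (?N i))"
      unfolding sum_distrib_left
    proof (rule sum_mono)
      fix i
      show "(LINT z|M. (cmod (F (?N i) z)) ^ 6) \<le> c * (mass X)\<^sup>2 * mass (?N i)"
        using narrow[of i] unfolding c_def by (simp only: mult_ac)
    qed
    show "(\<Sum>j\<in>K2. \<Sum>i\<in>far j. mixed (?X i) (?X j)) \<le> D * (\<Sum>j\<in>K2. \<Sum>i\<in>far j. mass (?X i) * (mass (?X j))\<^sup>2)"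
      unfolding sum_distrib_left
    proof (intro sum_mono)
      fix j i assume "i \<in> far j"
      from broad[OF this] show "mixed (?X i) (?X j) \<le> D * (mass (?X i) * (mass (?X j))\<^sup>2)"
        by (simp only: mult.assoc)
    qed
  qed auto
  also have "\<dots> \<le> 32 * (c * (mass X)\<^sup>2 * (3 * mass X)) + 32 * real (R\<^sup>2) ^ 6 * (D * (mass X) ^ 3)"
    by (rule add_mono[OF mult_left_mono[OF mult_left_mono[OF sumN]] mult_left_mono[OF mult_left_mono[OF sumB D0]]])
       (simp_all only: c0 zero_le_mult_iff zero_le_power2 zero_le_numeral zero_le_power of_nat_0_le_iff simp_thms)
  also have "\<dots> = 96 * c * (mass X) ^ 3 + 32 * (real (R\<^sup>2) ^ 6 * D) * (mass X) ^ 3"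
    by (simp add: power2_eq_square power3_eq_cube)
  also have "\<dots> \<le> 96 * c * (mass X) ^ 3 + 32 * (G * real R powr (\<eta> * 2^k)) * (mass X) ^ 3"
  proof (intro add_left_mono mult_right_mono mult_left_mono)
    have "real (R\<^sup>2) ^ 6 = real R ^ 12" by (simp flip: power_mult)
    also have "\<dots> = real R powr 12" using R by (simp add: powr_numeral)
    finally have "real (R\<^sup>2) ^ 6 = real R powr 12" .
    then have "real (R\<^sup>2) ^ 6 * D = G * real R powr (12 + \<eta> * (2^k - (1 + real k / 2)))"
      unfolding D_def by (simp add: powr_add)
    also have "\<dots> \<le> G * real R powr (\<eta> * 2^k)"
    proof (intro mult_left_mono powr_mono)
      have "\<eta> * (2^k - (1 + real k / 2)) = \<eta> * 2^k - \<eta> * (1 + real k / 2)" by (rule right_diff_distrib)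
      then show "12 + \<eta> * (2^k - (1 + real k / 2)) \<le> \<eta> * 2^k" using \<eta>(2) by linarith
    qed (use R G0 in auto)
    finally show "real (R\<^sup>2) ^ 6 * D \<le> G * real R powr (\<eta> * 2^k)" .
  qed auto
  also have "\<dots> = (96 * 3 powr \<eta> * A + 32 * G) * real R powr (\<eta> * 2^k) * (mass X) ^ 3"
    unfolding c_def by (simp add: algebra_simps)
  finally show ?thesis .
qed

text \<open>The interval of length m is placed inside one of length R^(2^k + 1) with
  \<open>R\<close> about m^(1/(2^k + 1)), so the bound with R^(\<eta> 2^k) becomes one with the
  smaller exponent. Rounding \<open>R\<close> up at most doubles it, whence the factor 2^(\<eta>
  2^k).\<close>

lemma sixth_bound_improve:
  fixes k L :: nat and A \<eta> :: real
  defines "G \<equiv> (2 * real L + 1)\<^sup>2 * A + total"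
  assumes bound: "sixth_bound A \<eta>" and A: "A \<ge> 0" and L: "1 + 4 * C \<le> real L"
    and \<eta>: "\<eta> \<ge> 0" "\<eta> * (1 + real k / 2) \<ge> 12"
  shows "sixth_bound ((96 * 3 powr \<eta> * A + 32 * G) * 2 powr (\<eta> * 2^k)) (\<eta> * (2^k / (2^k + 1)))"
  unfolding sixth_bound_def
proof (intro allI impI)
  fix X n m assume X: "X \<subseteq> J" "X \<subseteq> {n..<n + int m}" and m: "m \<ge> 1"
  define q where "q = real (2^k + 1)"
  have q: "q = 2^k + 1" "q > 0" unfolding q_def by (simp_all add: add_pos_pos)
  define R where "R = nat \<lceil>real m powr (1 / q)\<rceil>"
  have m1: "real m powr (1 / q) \<ge> 1" using m q by (simp add: ge_one_powr_ge_zero)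
  have Rl: "real m powr (1 / q) \<le> real R" unfolding R_def by linarith
  have Ru: "real R \<le> 2 * real m powr (1 / q)" using m1 unfolding R_def by linarith
  have R: "R \<ge> 1" using m1 Rl by linarith
  have "real m = (real m powr (1 / q)) powr q" using m q by (simp add: powr_powr)
  also have "\<dots> \<le> real R powr q" using Rl q by (intro powr_mono2) auto
  also have "\<dots> = real (R ^ (2^k + 1))" unfolding q_def using R by (subst powr_realpow) auto
  finally have "m \<le> R ^ (2^k + 1)" by linarith
  then have "int m \<le> int R ^ (2^k + 1)" by (metis of_nat_le_iff of_nat_power)
  then have "{n..<n + int m} \<subseteq> {n..<n + int R ^ (2^k + 1)}" by (intro ivl_subset[THEN iffD2]) linarith
  with X(2) have "X \<subseteq> {n..<n + int R ^ (2^k + 1)}" by (rule subset_trans)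
  then have "(LINT z|M. (cmod (F X z)) ^ 6) \<le> (96 * 3 powr \<eta> * A + 32 * G) * real R powr (\<eta> * 2^k) * (mass X) ^ 3"
    unfolding G_def by (intro sixth_bound_step bound A R L \<eta> X)
  also have "real R powr (\<eta> * 2^k) \<le> (2 * real m powr (1 / q)) powr (\<eta> * 2^k)"
    using Ru \<eta> by (intro powr_mono2) auto
  also have "\<dots> = 2 powr (\<eta> * 2^k) * real m powr (\<eta> * (2^k / (2^k + 1)))"
    by (simp add: powr_mult powr_powr q(1))
  finally show "(LINT z|M. (cmod (F X z)) ^ 6) \<le> (96 * 3 powr \<eta> * A + 32 * G) * 2 powr (\<eta> * 2^k) * real m powr (\<eta> * (2^k / (2^k + 1))) * (mass X) ^ 3"
    using A by (simp add: G_def mult_left_mono mult_right_mono mult.assoc)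
qed

text \<open>Starting point of the iteration: pointwise Cauchy--Schwarz bounds the sixth power by the
  cube of length times mass.\<close>

lemma sixth_bound_trivial: "sixth_bound total 3"
  unfolding sixth_bound_def
proof (intro allI impI)
  fix X n m assume X: "X \<subseteq> J" "X \<subseteq> {n..<n + int m}" and m: "m \<ge> 1"
  have fX: "finite X" using X finite_subset by blast
  have "card X \<le> card {n..<n + int m}" using X by (intro card_mono) auto
  then have c: "real (card X) \<le> real m" by simp
  have "(cmod (F X z)) ^ 6 \<le> (m * mass X) ^ 3" for z
  proof -
    have "(cmod (F X z)) ^ 6 = ((cmod (F X z))\<^sup>2) ^ 3" by (simp flip: power_mult)
    also have "\<dots> \<le> (m * mass X) ^ 3"
      using c by (intro power_mono order_trans[OF norm_F_sq_le[OF fX]] mult_right_mono) auto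
    finally show ?thesis .
  qed
  then have "(LINT z|M. (cmod (F X z)) ^ 6) \<le> (LINT z|M. (m * mass X) ^ 3)"
    by (intro integral_mono integrable_norm_pow) auto
  also have "\<dots> = total * real m powr 3 * (mass X) ^ 3"
    using m by (simp add: total_def power_mult_distrib powr_numeral)
  finally show "(LINT z|M. (cmod (F X z)) ^ 6) \<le> total * real m powr 3 * (mass X) ^ 3" .
qed

lemma sixth_bound_mono:
  assumes "sixth_bound A \<eta>" "A \<ge> 0" "\<eta> \<le> \<eta>'"
  shows "sixth_bound A \<eta>'"
  unfolding sixth_bound_def
proof (intro allI impI)
  fix X n m assume X: "X \<subseteq> J" "X \<subseteq> {n..<n + int m}" and m: "(m::nat) \<ge> 1"
  have "(LINT z|M. (cmod (F X z)) ^ 6) \<le> A * real m powr \<eta> * (mass X) ^ 3"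
    using assms(1) X m unfolding sixth_bound_def by blast
  also have "\<dots> \<le> A * real m powr \<eta>' * (mass X) ^ 3"
    using assms m by (intro mult_right_mono mult_left_mono powr_mono) auto
  finally show "(LINT z|M. (cmod (F X z)) ^ 6) \<le> A * real m powr \<eta>' * (mass X) ^ 3" .
qed

end

text \<open>The order of quantifiers is the point: \<open>A\<close> is fixed before the measure, the
  curve, \<open>lam\<close> and the coefficients, so that one constant serves all dyadic blocks.
  Apart from \<open>\<epsilon>\<close> it depends only on \<open>C\<close> and on the total mass
  \<open>T\<close>.\<close>

theorem curve_system_sixth_moment:
  fixes C \<epsilon> T :: real
  assumes "\<epsilon> > 0"
  shows "\<exists>A\<ge>0. \<forall>(M :: 'm measure) e h g J lam a. curve_system M e h g J C lam \<longrightarrow> measure M (space M) = T \<longrightarrow>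
    curve_system.sixth_bound M e J a A \<epsilon>"
proof (cases "T \<ge> 0")
  case False
  then show ?thesis by (intro exI[of _ 0]) (auto simp: measure_nonneg)
next
  case True
  \<comment> \<open>The choice gives \<epsilon> k / 2 \<ge> 12, which is the condition under which
    the broad part repays its loss.\<close>
  obtain k :: nat where k: "24 / \<epsilon> \<le> real k" using real_arch_simple by blast
  obtain L :: nat where L: "1 + 4 * C \<le> real L" using real_arch_simple by blast
  define \<theta> :: real where "\<theta> = 2^k / (2^k + 1)"
  have \<theta>: "0 < \<theta>" "\<theta> < 1" unfolding \<theta>_def by (simp_all add: add_pos_pos divide_simps)
  \<comment> \<open>Truncating the exponents at \<open>\<epsilon>\<close> keeps the condition on
    \<open>k\<close> valid, so a single \<open>k\<close>, and with it a single factor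
    \<open>\<theta>\<close>, serves all rounds; after finitely many of them the maximum is
    \<open>\<epsilon>\<close>.\<close>
  define \<eta> where "\<eta> l = max \<epsilon> (3 * \<theta> ^ l)" for l
  have step: "\<exists>A\<ge>0. \<forall>(M :: 'm measure) e h g J lam a. curve_system M e h g J C lam \<longrightarrow> measure M (space M) = T \<longrightarrow>
    curve_system.sixth_bound M e J a A (\<eta> l)" for l
  proof (induction l)
    case 0
    show ?case
    proof (intro exI[of _ T] conjI allI impI)
      fix M :: "'m measure" and e h g J lam a
      assume "curve_system M e h g J C lam" and T: "measure M (space M) = T"
      then interpret curve_system M e h g J C lam a by blast
      show "sixth_bound T (\<eta> 0)"
        using sixth_bound_mono[OF sixth_bound_trivial, of "\<eta> 0"] T True unfolding total_def \<eta>_def by simp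
    qed (use True in simp)
  next
    case (Suc l)
    then obtain A where A: "A \<ge> 0" and IH: "\<And>(M :: 'm measure) e h g J lam a. curve_system M e h g J C lam \<Longrightarrow> measure M (space M) = T \<Longrightarrow>
      curve_system.sixth_bound M e J a A (\<eta> l)" by blast
    have \<eta>: "\<eta> l \<ge> \<epsilon>" unfolding \<eta>_def by simp
    have \<eta>k: "\<eta> l * (1 + real k / 2) \<ge> 12"
    proof -
      have "12 \<le> \<epsilon> * (real k / 2)" using k assms by (simp add: field_simps)
      also have "\<dots> \<le> \<eta> l * (1 + real k / 2)" using \<eta> assms by (intro mult_mono) auto
      finally show ?thesis .
    qed
    let ?A = "(96 * 3 powr \<eta> l * A + 32 * ((2 * real L + 1)\<^sup>2 * A + T)) * 2 powr (\<eta> l * 2^k)"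
    have A': "?A \<ge> 0" using A True by simp
    have le: "\<eta> l * \<theta> \<le> \<eta> (Suc l)"
    proof -
      have "\<eta> l * \<theta> = max (\<epsilon> * \<theta>) (3 * \<theta> ^ l * \<theta>)"
        unfolding \<eta>_def using \<theta> by (simp add: max_mult_distrib_right)
      also have "\<dots> \<le> max \<epsilon> (3 * \<theta> ^ Suc l)"
        using \<theta> assms by (intro max.mono) (auto simp: mult_ac mult_left_le)
      finally show ?thesis unfolding \<eta>_def .
    qed
    show ?case
    proof (intro exI[of _ ?A] conjI A' allI impI)
      fix M :: "'m measure" and e h g J lam a
      assume cs: "curve_system M e h g J C lam" and T: "measure M (space M) = T"
      then interpret curve_system M e h g J C lam a by blast
      have "sixth_bound ?A (\<eta> l * \<theta>)"
        using sixth_bound_improve[OF IH[OF cs T] A L _ \<eta>k] T \<eta> assms unfolding total_def \<theta>_def by simp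
      then show "sixth_bound ?A (\<eta> (Suc l))" by (rule sixth_bound_mono[OF _ A' le])
    qed
  qed
  obtain l where "\<theta> ^ l < \<epsilon> / 3" using real_arch_pow_inv[of "\<epsilon> / 3" \<theta>] \<theta> assms by auto
  then have "\<eta> l = \<epsilon>" unfolding \<eta>_def by simp
  with step[of l] show ?thesis by simp
qed

section \<open>A weight with compactly supported Fourier transform\<close>

lemma integrable_sinc_sq: "integrable lborel (\<lambda>t. (sinc t)\<^sup>2)"
proof (rule Bochner_Integration.integrable_bound)
  have "integrable lborel (\<lambda>x::real. inverse (1 + x\<^sup>2))"
    using integrable_inverse_1_plus_square by (simp add: set_integrable_def)
  then show "integrable lborel (\<lambda>x::real. 2 * inverse (1 + x\<^sup>2))" by simp
  show "AE t in lborel. norm ((sinc t)\<^sup>2) \<le> norm (2 * inverse (1 + t\<^sup>2))"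
  proof (intro AE_I2)
    fix t :: real
    show "norm ((sinc t)\<^sup>2) \<le> norm (2 * inverse (1 + t\<^sup>2))"
    proof (cases "t = 0")
      case False
      have "(sin t)\<^sup>2 \<le> t\<^sup>2" using abs_sin_x_le_abs_x[of t] by (simp add: abs_le_square_iff)
      moreover have "(sin t)\<^sup>2 \<le> 1" by (simp add: abs_square_le_1)
      then have "(sin t)\<^sup>2 * t\<^sup>2 \<le> 1 * t\<^sup>2" by (intro mult_right_mono) auto
      ultimately have "(sin t)\<^sup>2 * (1 + t\<^sup>2) \<le> 2 * t\<^sup>2" by (simp add: algebra_simps)
      then have "(sin t)\<^sup>2 / t\<^sup>2 \<le> 2 / (1 + t\<^sup>2)"
        using False by (simp add: divide_le_eq le_divide_eq pos_le_divide_eq pos_divide_le_eq add_pos_nonneg mult.commute)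
      moreover have "norm ((sinc t)\<^sup>2) = (sin t)\<^sup>2 / t\<^sup>2" using False by (simp add: power_divide)
      moreover have "norm (2 * inverse (1 + t\<^sup>2)) = 2 / (1 + t\<^sup>2)" by (simp add: divide_inverse)
      ultimately show ?thesis by simp
    qed simp
  qed
qed measurable

lemma iexp_minus_iexp_neg: "iexp t - iexp (- t) = 2 * \<i> * of_real (sin t)"
  by (simp add: complex_eq_iff Re_exp Im_exp)

lemma char_uniform: "char (uniform_measure lborel {-1..1}) t = of_real (sinc t)"
proof -
  have "char (uniform_measure lborel {-1..1}) t = (CLINT x|density lborel (\<lambda>x. ennreal (indicator {-1..1} x / 2)). iexp (t * x))"
    unfolding char_def uniform_measure_def
    by (simp add: ennreal_indicator divide_ennreal[symmetric] flip: ennreal_numeral)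
  also have "\<dots> = (CLINT x|lborel. (indicator {-1..1} x / 2) *\<^sub>R iexp (t * x))"
    by (subst integral_density) auto
  also have "\<dots> = (CLINT x|lborel. indicator {-1..1} x *\<^sub>R iexp (t * x)) / 2"
    unfolding integral_divide_zero[symmetric]
    by (intro Bochner_Integration.integral_cong) (auto simp: indicator_def scaleR_conv_of_real)
  also have "\<dots> = of_real (sinc t)"
  proof (cases "t = 0")
    case True
    then show ?thesis by (simp add: scaleR_conv_of_real)
  next
    case False
    have "(CLINT x|lborel. indicator {-1..1} x *\<^sub>R iexp (t * x)) = iexp (t * 1) / (\<i> * t) - iexp (t * (-1)) / (\<i> * t)"
    proof (rule integral_FTC_atLeastAtMost)
      show "continuous_on {-1..1} (\<lambda>x. iexp (t * x))" by (intro continuous_intros)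
      fix x :: real
      have "((\<lambda>z. exp (\<i> * (of_real t * z)) / (\<i> * of_real t)) has_field_derivative exp (\<i> * (of_real t * of_real x))) (at (of_real x))"
        using False by (auto intro!: derivative_eq_intros simp: mult_ac)
      from has_vector_derivative_real_field[OF this]
      show "((\<lambda>x. iexp (t * x) / (\<i> * complex_of_real t)) has_vector_derivative iexp (t * x)) (at x within {-1..1})"
        by (auto simp: o_def intro: has_vector_derivative_at_within)
    qed simp
    also have "\<dots> = (iexp t - iexp (- t)) / (\<i> * t)" by (simp add: diff_divide_distrib)
    also have "\<dots> = 2 * of_real (sin t / t)"
      unfolding iexp_minus_iexp_neg using False by simp
    finally show ?thesis using False by simp
  qed
  finally show ?thesis .
qed

text \<open>
  The uniform distribution on \<open>{-1..1}\<close> has characteristic function \<open>sinc\<close>; Levy inversion on an interval of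
  length 2 centred at \<open>- \<tau>\<close> produces a second factor \<open>sinc\<close>.
\<close>
lemma fourier_sinc_sq:
  fixes \<tau> :: real
  assumes "\<bar>\<tau>\<bar> \<ge> 2"
  shows "(CLINT t|lborel. of_real ((sinc t)\<^sup>2) * iexp (\<tau> * t)) = 0"
proof -
  let ?U = "uniform_measure lborel {-1..1::real}"
  interpret U: real_distribution ?U
  proof (intro real_distribution.intro real_distribution_axioms.intro)
    show "prob_space ?U" by (rule prob_space_uniform_measure) auto
  qed simp
  have zero: "measure ?U B = 0" if "B \<in> sets borel" "B \<inter> {-1..1} \<subseteq> {c}" for B c
  proof -
    have "emeasure lborel ({-1..1} \<inter> B) \<le> emeasure lborel {c}"
      using that by (intro emeasure_mono) auto
    then show ?thesis using that by (simp add: measure_def emeasure_uniform_measure)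
  qed
  define a b where "a = - \<tau> - 1" and "b = - \<tau> + 1"
  let ?f = "\<lambda>t. of_real ((sinc t)\<^sup>2) * iexp (\<tau> * t) :: complex"
  have int: "integrable lborel ?f"
    by (rule Bochner_Integration.integrable_bound[OF integrable_sinc_sq]) (measurable, intro AE_I2, unfold norm_mult norm_of_real norm_exp_i_times, simp)
  have "(\<lambda>T. 1 / (2 * pi) * (CLBINT t=-real T..real T. (iexp (-(t * a)) - iexp (-(t * b))) / (\<i> * t) * char ?U t))
      \<longlonglongrightarrow> measure ?U {a<..b}"
  proof -
    have "a \<le> b" by (simp add: a_def b_def)
    moreover have "measure ?U {a} = 0" "measure ?U {b} = 0" by (rule zero; auto)+
    ultimately show ?thesis
      using U.Levy_Inversion[of a b] by (simp only: of_int_minus of_int_of_nat_eq)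
  qed
  \<comment> \<open>The half-open interval meets {-1..1} at most in -1 if \<tau> \<ge> 2, and
    nowhere if \<tau> \<le> -2; in the second case 0 is just a dummy point.\<close>
  moreover have "measure ?U {a<..b} = 0"
  proof (cases "\<tau> \<ge> 2")
    case True
    then show ?thesis by (intro zero[of _ "-1"]) (auto simp: a_def b_def)
  next
    case False
    then show ?thesis using assms by (intro zero[of _ 0]) (auto simp: a_def b_def)
  qed
  moreover have "(CLBINT t=-real T..real T. (iexp (-(t * a)) - iexp (-(t * b))) / (\<i> * t) * char ?U t) =
      2 * (CLINT t|lborel. indicator {-real T..real T} t *\<^sub>R ?f t)" for T :: nat
  proof -
    have "(CLBINT t=-real T..real T. (iexp (-(t * a)) - iexp (-(t * b))) / (\<i> * t) * char ?U t) =
      (CLBINT t=-real T..real T. 2 * ?f t)"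
    \<comment> \<open>At t = 0 the quotient is 0 by the convention for division while the right-hand
      side is 2, so this one point has to be excepted.\<close>
    proof (rule interval_integral_discrete_difference[of "{0}"])
      fix t :: real assume "t \<notin> {0}" 
      then have t: "t \<noteq> 0" by simp
      have "iexp (-(t * a)) - iexp (-(t * b)) = iexp (\<tau> * t) * (iexp t - iexp (- t))"
        unfolding a_def b_def by (simp add: exp_add[symmetric] algebra_simps)
      also have "iexp t - iexp (- t) = 2 * \<i> * of_real (sin t)"
        by (rule iexp_minus_iexp_neg)
      finally show "(iexp (-(t * a)) - iexp (-(t * b))) / (\<i> * t) * char ?U t = 2 * ?f t"
        using t by (simp add: char_uniform power2_eq_square field_simps)
    qed auto
    also have "\<dots> = (CLINT t|lborel. indicator {-real T..real T} t *\<^sub>R (2 * ?f t))"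
      unfolding set_lebesgue_integral_def[symmetric] by (rule interval_integral_Icc) simp
    also have "\<dots> = (CLINT t|lborel. 2 * (indicator {-real T..real T} t *\<^sub>R ?f t))"
      by (intro Bochner_Integration.integral_cong refl) simp
    also have "\<dots> = 2 * (CLINT t|lborel. indicator {-real T..real T} t *\<^sub>R ?f t)"
      by (rule integral_mult_right_zero)
    finally show ?thesis .
  qed
  moreover have "(\<lambda>T::nat. CLINT t|lborel. indicator {-real T..real T} t *\<^sub>R ?f t) \<longlonglongrightarrow> (CLINT t|lborel. ?f t)"
  proof (rule integral_dominated_convergence[where w="\<lambda>t. norm (?f t)"])
    show "AE t in lborel. (\<lambda>T::nat. indicator {-real T..real T} t *\<^sub>R ?f t) \<longlonglongrightarrow> ?f t"
    proof (intro AE_I2 tendsto_eventually)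
      fix t :: real
      obtain n :: nat where "\<bar>t\<bar> \<le> real n" using real_arch_simple by blast
      then have "indicator {-real T..real T} t *\<^sub>R ?f t = ?f t" if "T \<ge> n" for T
        using that by (auto simp: indicator_def)
      then show "\<forall>\<^sub>F T in sequentially. indicator {-real T..real T} t *\<^sub>R ?f t = ?f t"
        unfolding eventually_sequentially by blast
    qed
    show "AE t in lborel. norm (indicator {-real T..real T} t *\<^sub>R ?f t) \<le> norm (?f t)" for T :: nat
      by (auto simp: indicator_def)
  qed (use int in auto)
  then have "(\<lambda>T::nat. 1 / (2 * pi) * (2 * (CLINT t|lborel. indicator {-real T..real T} t *\<^sub>R ?f t))) \<longlonglongrightarrow> 1 / (2 * pi) * (2 * (CLINT t|lborel. ?f t))"
    by (intro tendsto_mult tendsto_const)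
  ultimately have "1 / (2 * pi) * (2 * (CLINT t|lborel. ?f t)) = 0"
    by (simp only: LIMSEQ_unique of_real_0)
  then show ?thesis by simp
qed


text \<open>In the first variable one full period, over which distinct integer frequencies are
  orthogonal; in the second the weight on the whole line. Both factors carry Borel sets, so every
  Borel function on the plane is measurable for the product.\<close>

definition kernel_measure :: "(real \<times> real) measure"
  where "kernel_measure = restrict_space lborel {0..1} \<Otimes>\<^sub>M density lborel (\<lambda>t. ennreal ((sinc t)\<^sup>2))"

lemma finite_measure_unit: "finite_measure (restrict_space lborel {0..1::real})"
  by (intro finite_measureI) (simp add: emeasure_restrict_space)

lemma finite_measure_sinc_sq: "finite_measure (density lborel (\<lambda>t. ennreal ((sinc t)\<^sup>2)))"
proof (intro finite_measureI)
  have "(\<integral>\<^sup>+t. ennreal ((sinc t)\<^sup>2) \<partial>lborel) < \<infinity>"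
    using integrable_sinc_sq by (subst (asm) integrable_iff_bounded) simp
  then show "emeasure (density lborel (\<lambda>t. ennreal ((sinc t)\<^sup>2))) (space (density lborel (\<lambda>t. ennreal ((sinc t)\<^sup>2)))) \<noteq> \<infinity>"
    by (simp add: emeasure_density)
qed

lemma finite_measure_kernel_measure: "finite_measure kernel_measure"
  unfolding kernel_measure_def by (rule finite_measure_pair_measure[OF finite_measure_sinc_sq finite_measure_unit])

lemma borel_measurable_e1 [measurable]: "e1 \<in> borel_measurable borel"
  by (intro borel_measurable_continuous_onI continuous_intros)

lemma norm_e1 [simp]: "cmod (e1 y) = 1"
  using norm_exp_i_times[of "2 * pi * y"] by (simp add: e1_def mult_ac)

lemma kernel_measure_measurable [measurable (raw)]:
  assumes "f \<in> borel_measurable (borel :: (real \<times> real) measure)"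
  shows "f \<in> borel_measurable kernel_measure"
proof -
  have "(\<lambda>x. x) \<in> restrict_space lborel {0..1} \<rightarrow>\<^sub>M (borel :: real measure)"
    by (rule measurable_restrict_space1) simp
  then have "fst \<in> kernel_measure \<rightarrow>\<^sub>M (borel :: real measure)"
    unfolding kernel_measure_def by (rule measurable_compose[OF measurable_fst])
  moreover have "snd \<in> kernel_measure \<rightarrow>\<^sub>M (borel :: real measure)"
    unfolding kernel_measure_def by (rule measurable_compose[OF measurable_snd]) simp
  ultimately have "(\<lambda>z. (fst z, snd z)) \<in> kernel_measure \<rightarrow>\<^sub>M borel \<Otimes>\<^sub>M borel"
    by (rule measurable_Pair)
  then have "(\<lambda>z. z) \<in> kernel_measure \<rightarrow>\<^sub>M borel" by (simp add: borel_prod)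
  from measurable_compose[OF this assms] show ?thesis .
qed

lemma borel_measurable_plane_wave [measurable]:
  "(\<lambda>z::real \<times> real. e1 (k * fst z + s * snd z)) \<in> borel_measurable borel"
  by (intro borel_measurable_continuous_onI continuous_intros)

lemma integral_unit_lebesgue_on:
  fixes f :: "real \<Rightarrow> complex"
  assumes "f \<in> borel_measurable borel"
  shows "(LINT x|restrict_space lborel {0..1}. f x) = (LINT x|lebesgue_on {0..1}. f x)"
  using assms by (simp add: integral_restrict_space integral_completion)

text \<open>The integral factors. A nonzero \<open>k\<close> annihilates the first factor; otherwise
  the weight is tested at frequency 2 \<pi> s, outside the support of its transform because 2 \<pi>
  exceeds 2.\<close>

lemma kernel_measure_resonance:
  fixes k :: int and s :: real
  assumes "k \<noteq> 0 \<or> \<bar>s\<bar> \<ge> 1"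
  shows "(LINT z|kernel_measure. e1 (of_int k * fst z + s * snd z)) = 0"
proof -
  let ?U = "restrict_space lborel {0..1::real}" and ?D = "density lborel (\<lambda>t. ennreal ((sinc t)\<^sup>2))"
  interpret U: finite_measure ?U by (rule finite_measure_unit)
  interpret D: finite_measure ?D by (rule finite_measure_sinc_sq)
  interpret K: finite_measure kernel_measure by (rule finite_measure_kernel_measure)
  interpret P: pair_sigma_finite ?U ?D ..
  have "integrable kernel_measure (\<lambda>z. e1 (of_int k * fst z + s * snd z))"
    by (intro K.integrable_const_bound[of _ 1] kernel_measure_measurable borel_measurable_plane_wave) simp
  then have "(LINT z|kernel_measure. e1 (of_int k * fst z + s * snd z)) =
      (LINT x|?U. LINT t|?D. e1 (of_int k * x + s * t))"
    unfolding kernel_measure_def by (subst P.integral_fst'[symmetric]) auto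
  also have "\<dots> = (LINT x|?U. e1 (of_int k * x)) * (LINT t|?D. e1 (s * t))"
    by (simp add: e1_add)
  also have "\<dots> = 0"
  proof (cases "k = 0")
    case True
    then have "1 * 1 \<le> pi * \<bar>s\<bar>" using assms pi_gt3 by (intro mult_mono) auto
    then have "\<bar>2 * pi * s\<bar> \<ge> 2" by (simp add: abs_mult)
    from fourier_sinc_sq[OF this] have "(LINT t|?D. e1 (s * t)) = 0"
      by (subst integral_density) (auto simp: e1_def scaleR_conv_of_real mult_ac)
    then show ?thesis by simp
  next
    case False
    then have "(LINT x|?U. e1 (of_int k * x)) = 0"
      by (subst integral_unit_lebesgue_on) (auto simp: integral_e1)
    then show ?thesis by simp
  qed
  finally show ?thesis .
qed

lemma cnj_e1: "cnj (e1 x) = e1 (- x)"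
  by (simp add: e1_def exp_cnj)

lemma e1_mult_cnj: "e1 x * cnj (e1 y) = e1 (x - y)"
  by (simp add: cnj_e1 e1_add[symmetric])

text \<open>A product of plane waves and conjugates is again a plane wave, so \<open>orth\<close> is
  an instance of \<open>kernel_measure_resonance\<close> and only the geometry of \<open>h\<close>
  is left as a hypothesis.\<close>

lemma curve_system_kernel_measure:
  fixes h g :: "int \<Rightarrow> real"
  assumes "C \<ge> 0" "lam \<ge> 1"
    and "\<And>x d. x \<in> J \<Longrightarrow> d \<in> J \<Longrightarrow> \<bar>h x - h d - g d * of_int (x - d)\<bar> \<le> C * lam * (of_int (x - d))\<^sup>2"
    and "\<And>x y d s. x \<in> J \<Longrightarrow> y \<in> J \<Longrightarrow> d \<in> J \<Longrightarrow> s \<ge> 0 \<Longrightarrow>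
      d + s \<le> x \<and> d + s \<le> y \<or> x + s \<le> d \<and> y + s \<le> d \<Longrightarrow>
      lam * of_int s * \<bar>of_int x - of_int y\<bar> \<le> \<bar>h x - h y - g d * (of_int x - of_int y)\<bar>"
  shows "curve_system kernel_measure (\<lambda>n z. e1 (of_int n * fst z + h n * snd z)) h g J C lam"
proof (intro curve_system.intro curve_system_axioms.intro finite_measure_kernel_measure)
  fix x1 x2 x3 y1 y2 y3
  assume *: "x1 + x2 + x3 \<noteq> y1 + y2 + y3 \<or> 1 \<le> \<bar>h x1 + h x2 + h x3 - h y1 - h y2 - h y3\<bar>"
  let ?e = "\<lambda>n z. e1 (of_int n * fst z + h n * snd z)"
  have "?e x1 z * ?e x2 z * ?e x3 z * cnj (?e y1 z * ?e y2 z * ?e y3 z) =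
      e1 (of_int (x1 + x2 + x3 - (y1 + y2 + y3)) * fst z + (h x1 + h x2 + h x3 - h y1 - h y2 - h y3) * snd z)" for z :: "real \<times> real"
    unfolding e1_add[symmetric] e1_mult_cnj by (simp add: algebra_simps)
  then show "(LINT z|kernel_measure. ?e x1 z * ?e x2 z * ?e x3 z * cnj (?e y1 z * ?e y2 z * ?e y3 z)) = 0"
    using * by (simp only:) (rule kernel_measure_resonance, auto)
next
  show "(\<lambda>z. e1 (real_of_int n * fst z + h n * snd z)) \<in> borel_measurable kernel_measure" for n
    by (intro kernel_measure_measurable borel_measurable_plane_wave)
qed (use assms in auto)

lemma sinc_sq_ge:
  assumes "0 \<le> t" "t \<le> 1"
  shows "1 / 4 \<le> (sinc t)\<^sup>2"
proof (cases "t = 0")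
  case False
  have "\<bar>sin t - (\<Sum>m<3. sin_coeff m * t ^ m)\<bar> \<le> inverse (fact 3) * \<bar>t\<bar> ^ 3"
    by (rule Maclaurin_sin_bound)
  then have "\<bar>sin t - t\<bar> \<le> t ^ 3 / 6"
    using assms by (simp add: sin_coeff_def eval_nat_numeral)
  moreover have "t ^ 3 \<le> t" using power_decreasing[of 1 3 t] assms by simp
  ultimately have "t / 2 \<le> sin t" using assms by linarith
  then have "1 / 2 \<le> sin t / t" using assms False by (simp add: field_simps)
  then have "(1 / 2)\<^sup>2 \<le> (sin t / t)\<^sup>2" by (intro power_mono) auto
  then show ?thesis using False by (simp add: power2_eq_square)
qed simp

text \<open>In the variable t / T the unit time interval becomes {0..1/T}, contained in {0..1}
  because T \<ge> 1, and there the weight is at least 1/4. The factor is thus the Jacobian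
  \<open>T\<close> times 4.\<close>

lemma nn_integral_square_le_kernel:
  fixes G :: "real \<times> real \<Rightarrow> ennreal"
  assumes [measurable]: "G \<in> borel_measurable borel" and T: "T \<ge> 1"
  shows "(\<integral>\<^sup>+z. G z * indicator ({0..1} \<times> {0..1}) z \<partial>lborel) \<le> ennreal (4 * T) * (\<integral>\<^sup>+z. G (fst z, T * snd z) \<partial>kernel_measure)"
proof -
  let ?U = "restrict_space lborel {0..1::real}" and ?D = "density lborel (\<lambda>t. ennreal ((sinc t)\<^sup>2))"
  interpret D: finite_measure ?D by (rule finite_measure_sinc_sq)
  have [measurable]: "G \<in> borel_measurable (borel \<Otimes>\<^sub>M borel)" by (simp add: borel_prod)
  have inner: "(\<integral>\<^sup>+t. G (x, t) * indicator {0..1} t \<partial>lborel) \<le> ennreal (4 * T) * (\<integral>\<^sup>+t. G (x, T * t) \<partial>?D)" for x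
  proof -
    have "(\<integral>\<^sup>+t. G (x, t) * indicator {0..1} t \<partial>lborel) = \<bar>T\<bar> * (\<integral>\<^sup>+t. G (x, 0 + T * t) * indicator {0..1} (0 + T * t) \<partial>lborel)"
      using T by (intro nn_integral_real_affine) auto
    also have "\<dots> = T * (\<integral>\<^sup>+t. G (x, T * t) * indicator {0..1} (T * t) \<partial>lborel)" using T by simp
    also have "\<dots> \<le> T * (\<integral>\<^sup>+t. 4 * (ennreal ((sinc t)\<^sup>2) * G (x, T * t)) \<partial>lborel)"
    proof (intro mult_left_mono nn_integral_mono)
      fix t
      show "G (x, T * t) * indicator {0..1} (T * t) \<le> 4 * (ennreal ((sinc t)\<^sup>2) * G (x, T * t))"
      proof (cases "T * t \<in> {0..1}")
        case True
        then have t: "0 \<le> t" "T * t \<le> 1" using T by (auto simp: zero_le_mult_iff)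
        moreover have "1 * t \<le> T * t" using T t by (intro mult_right_mono) auto
        ultimately have "1 / 4 \<le> (sinc t)\<^sup>2" by (intro sinc_sq_ge) auto
        then have "ennreal 1 \<le> ennreal (4 * (sinc t)\<^sup>2)" by (intro ennreal_leI) auto
        then have "1 * G (x, T * t) \<le> 4 * ennreal ((sinc t)\<^sup>2) * G (x, T * t)"
          by (intro mult_right_mono) (auto simp: ennreal_mult)
        then show ?thesis using True by (simp add: mult.assoc)
      qed simp
    qed simp
    also have "\<dots> = T * (4 * (\<integral>\<^sup>+t. G (x, T * t) \<partial>?D))"
      by (subst nn_integral_density) (auto simp: nn_integral_cmult)
    finally show ?thesis using T by (simp add: ennreal_mult mult_ac)
  qed
  have "(\<integral>\<^sup>+z. G z * indicator ({0..1} \<times> {0..1}) z \<partial>lborel) =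
      (\<integral>\<^sup>+z. G z * indicator ({0..1} \<times> {0..1}) z \<partial>(lborel \<Otimes>\<^sub>M lborel))"
    by (simp add: lborel_prod)
  also have "\<dots> = (\<integral>\<^sup>+x. \<integral>\<^sup>+t. G (x, t) * indicator ({0..1} \<times> {0..1}) (x, t) \<partial>lborel \<partial>lborel)"
    by (subst lborel.nn_integral_fst[symmetric]) auto
  also have "\<dots> = (\<integral>\<^sup>+x. (\<integral>\<^sup>+t. G (x, t) * indicator {0..1} t \<partial>lborel) * indicator {0..1} x \<partial>lborel)"
    by (subst nn_integral_multc[symmetric]) (auto simp: indicator_times mult_ac intro!: nn_integral_cong)
  also have "\<dots> \<le> (\<integral>\<^sup>+x. ennreal (4 * T) * ((\<integral>\<^sup>+t. G (x, T * t) \<partial>?D) * indicator {0..1} x) \<partial>lborel)"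
    unfolding mult.assoc[symmetric] by (intro nn_integral_mono mult_right_mono inner) auto
  also have "\<dots> = ennreal (4 * T) * (\<integral>\<^sup>+x. (\<integral>\<^sup>+t. G (x, T * t) \<partial>?D) * indicator {0..1} x \<partial>lborel)"
    by (intro nn_integral_cmult) measurable
  also have "(\<integral>\<^sup>+x. (\<integral>\<^sup>+t. G (x, T * t) \<partial>?D) * indicator {0..1} x \<partial>lborel) = (\<integral>\<^sup>+x. (\<integral>\<^sup>+t. G (x, T * t) \<partial>?D) \<partial>?U)"
    by (subst nn_integral_restrict_space) auto
  also have "\<dots> = (\<integral>\<^sup>+z. G (fst z, T * snd z) \<partial>kernel_measure)"
  proof -
    have "continuous_on UNIV (\<lambda>z::real \<times> real. (fst z, T * snd z))" by (intro continuous_intros)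
    from measurable_compose[OF borel_measurable_continuous_onI[OF this] assms(1)]
    have "(\<lambda>z. G (fst z, T * snd z)) \<in> borel_measurable kernel_measure" by (rule kernel_measure_measurable)
    from D.nn_integral_fst[OF this[unfolded kernel_measure_def]] show ?thesis
      unfolding kernel_measure_def by simp
  qed
  finally show ?thesis .
qed

section \<open>Dyadic blocks of the fractional dispersion relation\<close>

lemma mean_value_between:
  fixes f :: "real \<Rightarrow> real"
  assumes "\<And>x. \<alpha> \<le> x \<Longrightarrow> x \<le> \<beta> \<Longrightarrow> (f has_real_derivative f' x) (at x)" "u \<in> {\<alpha>..\<beta>}" "v \<in> {\<alpha>..\<beta>}"
  obtains z where "min u v \<le> z" "z \<le> max u v" "f u - f v = (u - v) * f' z"
proof (cases u v rule: linorder_cases)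
  case less
  then have "\<exists>z>u. z < v \<and> f v - f u = (v - u) * f' z"
    using assms by (intro MVT2) auto
  then obtain z where "u < z" "z < v" "f v - f u = (v - u) * f' z" by blast
  then show ?thesis by (intro that[of z]) (auto simp: algebra_simps)
next
  case greater
  then have "\<exists>z>v. z < u \<and> f u - f v = (u - v) * f' z"
    using assms by (intro MVT2) auto
  then obtain z where "v < z" "z < u" "f u - f v = (u - v) * f' z" by blast
  then show ?thesis by (intro that[of z]) auto
qed (use that[of u] in auto)

section \<open>Curves with second derivative between \<open>lam\<close> and
  \<open>C * lam\<close>\<close>

context
  fixes h g g' :: "real \<Rightarrow> real" and \<alpha> \<beta> lam C :: real
  assumes dh: "\<And>x. \<alpha> \<le> x \<Longrightarrow> x \<le> \<beta> \<Longrightarrow> (h has_real_derivative g x) (at x)"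
    and dg: "\<And>x. \<alpha> \<le> x \<Longrightarrow> x \<le> \<beta> \<Longrightarrow> (g has_real_derivative g' x) (at x)"
    and g'_ge: "\<And>x. \<alpha> \<le> x \<Longrightarrow> x \<le> \<beta> \<Longrightarrow> lam \<le> g' x"
    and g'_le: "\<And>x. \<alpha> \<le> x \<Longrightarrow> x \<le> \<beta> \<Longrightarrow> g' x \<le> C * lam"
    and lam: "lam \<ge> 0"
begin

lemma slope_bounds:
  assumes "u \<in> {\<alpha>..\<beta>}" "v \<in> {\<alpha>..\<beta>}"
  shows "lam * \<bar>u - v\<bar> \<le> \<bar>g u - g v\<bar>" "\<bar>g u - g v\<bar> \<le> C * lam * \<bar>u - v\<bar>"
proof -
  obtain z where z: "min u v \<le> z" "z \<le> max u v" "g u - g v = (u - v) * g' z"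
    using mean_value_between[OF dg assms] by blast
  then have "\<alpha> \<le> z" "z \<le> \<beta>" using assms by auto
  then have "lam \<le> g' z" "\<bar>g' z\<bar> \<le> C * lam" "\<bar>g' z\<bar> = g' z" using g'_ge[of z] g'_le[of z] lam by auto
  then show "lam * \<bar>u - v\<bar> \<le> \<bar>g u - g v\<bar>" "\<bar>g u - g v\<bar> \<le> C * lam * \<bar>u - v\<bar>"
    unfolding z(3) abs_mult by (simp_all add: mult.commute[of "\<bar>u - v\<bar>"] mult_right_mono)
qed

text \<open>The mean value theorem is used for \<open>h\<close> and then for \<open>g\<close>;
  compared with Taylor's formula this loses a factor 2, which only affects constants.\<close>

lemma curvature_tangent:
  assumes "x \<in> {\<alpha>..\<beta>}" "d \<in> {\<alpha>..\<beta>}"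
  shows "\<bar>h x - h d - g d * (x - d)\<bar> \<le> C * lam * (x - d)\<^sup>2"
proof -
  obtain z where z: "min x d \<le> z" "z \<le> max x d" "h x - h d = (x - d) * g z"
    using mean_value_between[OF dh assms] by blast
  have Cl: "C * lam \<ge> 0" using g'_ge[of x] g'_le[of x] lam assms by auto
  have "\<bar>h x - h d - g d * (x - d)\<bar> = \<bar>x - d\<bar> * \<bar>g z - g d\<bar>"
    unfolding z(3) abs_mult[symmetric] by (simp add: algebra_simps)
  also have "\<bar>g z - g d\<bar> \<le> C * lam * \<bar>z - d\<bar>"
    using z assms by (intro slope_bounds) auto
  also have "\<bar>z - d\<bar> \<le> \<bar>x - d\<bar>" using z by auto
  finally have "\<bar>h x - h d - g d * (x - d)\<bar> \<le> \<bar>x - d\<bar> * (C * lam * \<bar>x - d\<bar>)"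
    using Cl by (simp add: mult_left_mono)
  also have "\<dots> = C * lam * \<bar>x - d\<bar>\<^sup>2" by (simp only: power2_eq_square mult_ac)
  finally show ?thesis by simp
qed

text \<open>The mean slope from x to y is \<open>g z\<close> with z between them, hence on the same
  side of d and at distance at least s from it; monotonicity of \<open>g\<close> with rate
  \<open>lam\<close> does the rest.\<close>

lemma curvature_transversal:
  assumes "x \<in> {\<alpha>..\<beta>}" "y \<in> {\<alpha>..\<beta>}" "d \<in> {\<alpha>..\<beta>}" "s \<ge> 0"
    and "d + s \<le> x \<and> d + s \<le> y \<or> x + s \<le> d \<and> y + s \<le> d"
  shows "lam * s * \<bar>x - y\<bar> \<le> \<bar>h x - h y - g d * (x - y)\<bar>"
proof -
  obtain z where z: "min x y \<le> z" "z \<le> max x y" "h x - h y = (x - y) * g z"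
    using mean_value_between[OF dh assms(1,2)] by blast
  have "s \<le> \<bar>z - d\<bar>" using assms z by auto
  then have "lam * s \<le> lam * \<bar>z - d\<bar>" using lam by (rule mult_left_mono)
  also have "\<dots> \<le> \<bar>g z - g d\<bar>" using z assms by (intro slope_bounds) auto
  finally have "lam * s * \<bar>x - y\<bar> \<le> \<bar>g z - g d\<bar> * \<bar>x - y\<bar>" by (rule mult_right_mono) simp
  also have "\<dots> = \<bar>h x - h y - g d * (x - y)\<bar>"
    unfolding z(3) abs_mult[symmetric] by (simp add: algebra_simps)
  finally show ?thesis .
qed

end

text \<open>The minimum and the maximum treat both signs of the exponent at once; it will be \<nu> -
  1, which is negative for \<nu> < 1.\<close>

lemma powr_dyadic_bounds:
  fixes x M \<mu> :: real
  assumes "M > 0" "M \<le> x" "x \<le> 2 * M"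
  shows "min 1 (2 powr \<mu>) * M powr \<mu> \<le> x powr \<mu>" "x powr \<mu> \<le> max 1 (2 powr \<mu>) * M powr \<mu>"
proof -
  have eq: "x powr \<mu> = (x / M) powr \<mu> * M powr \<mu>"
    using assms by (simp add: powr_mult[symmetric])
  have q: "1 \<le> x / M" "x / M \<le> 2" using assms by (simp_all add: field_simps)
  have "min 1 (2 powr \<mu>) \<le> (x / M) powr \<mu> \<and> (x / M) powr \<mu> \<le> max 1 (2 powr \<mu>)"
  proof (cases "\<mu> \<ge> 0")
    case True
    then have "1 \<le> (x / M) powr \<mu>" using q by (simp add: ge_one_powr_ge_zero)
    moreover have "(x / M) powr \<mu> \<le> 2 powr \<mu>" using q True by (intro powr_mono2) auto
    ultimately show ?thesis by auto
  next
    case False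
    then have "(x / M) powr \<mu> \<le> 1 powr \<mu>" using q by (intro powr_mono2') auto
    moreover have "2 powr \<mu> \<le> (x / M) powr \<mu>" using q False by (intro powr_mono2') auto
    ultimately show ?thesis by auto
  qed
  then show "min 1 (2 powr \<mu>) * M powr \<mu> \<le> x powr \<mu>" "x powr \<mu> \<le> max 1 (2 powr \<mu>) * M powr \<mu>"
    unfolding eq by (simp_all add: mult_right_mono)
qed

text \<open>The second derivative of T x^(1 + \<nu>) is T (1 + \<nu>) \<nu> x^(\<nu> - 1). Its least
  value on {M..2M} serves as \<open>lam\<close>, and \<open>C\<close> is the quotient of its extreme
  values there, in which T and M cancel.\<close>

lemma curve_system_dyadic:
  fixes \<nu> M T :: real
  defines "c \<equiv> (1 + \<nu>) * \<nu> * min 1 (2 powr (\<nu> - 1))"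
    and "C \<equiv> max 1 (2 powr (\<nu> - 1)) / min 1 (2 powr (\<nu> - 1))"
  assumes \<nu>: "\<nu> > 0" and M: "M > 0" and lam: "T * c * M powr (\<nu> - 1) \<ge> 1"
  shows "curve_system kernel_measure (\<lambda>n z. e1 (of_int n * fst z + T * of_int n powr (1 + \<nu>) * snd z))
    (\<lambda>n. T * of_int n powr (1 + \<nu>)) (\<lambda>n. T * (1 + \<nu>) * of_int n powr \<nu>)
    {n. M \<le> of_int n \<and> of_int n \<le> 2 * M} C (T * c * M powr (\<nu> - 1))"
proof -
  let ?lam = "T * c * M powr (\<nu> - 1)"
  have c: "c > 0" unfolding c_def using \<nu> by simp
  have T: "T > 0"
  proof (rule ccontr)
    assume "\<not> T > 0"
    then have "T * (c * M powr (\<nu> - 1)) \<le> 0" using c by (intro mult_nonpos_nonneg) auto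
    then show False using lam by (simp add: mult.assoc)
  qed
  let ?h = "\<lambda>x. T * x powr (1 + \<nu>)" and ?g = "\<lambda>x. T * (1 + \<nu>) * x powr \<nu>"
    and ?g' = "\<lambda>x. T * (1 + \<nu>) * (\<nu> * x powr (\<nu> - 1))"
  have dh: "(?h has_real_derivative ?g x) (at x)" if "M \<le> x" "x \<le> 2 * M" for x
    using that M by (auto intro!: derivative_eq_intros)
  have dg: "(?g has_real_derivative ?g' x) (at x)" if "M \<le> x" "x \<le> 2 * M" for x
    using that M by (auto intro!: derivative_eq_intros)
  have lo: "?lam \<le> ?g' x" if "M \<le> x" "x \<le> 2 * M" for x
  proof -
    have "T * (1 + \<nu>) * \<nu> * (min 1 (2 powr (\<nu> - 1)) * M powr (\<nu> - 1)) \<le> T * (1 + \<nu>) * \<nu> * x powr (\<nu> - 1)"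
      using T \<nu> by (intro mult_left_mono powr_dyadic_bounds that M) auto
    then show ?thesis unfolding c_def by (simp add: mult_ac)
  qed
  have hi: "?g' x \<le> C * ?lam" if "M \<le> x" "x \<le> 2 * M" for x
  proof -
    have "T * (1 + \<nu>) * \<nu> * x powr (\<nu> - 1) \<le> T * (1 + \<nu>) * \<nu> * (max 1 (2 powr (\<nu> - 1)) * M powr (\<nu> - 1))"
      using T \<nu> by (intro mult_left_mono powr_dyadic_bounds that M) auto
    also have "\<dots> = C * ?lam"
    proof -
      have "min 1 (2 powr (\<nu> - 1)) \<noteq> 0" by (simp add: min_def)
      then have "max 1 (2 powr (\<nu> - 1)) = C * min 1 (2 powr (\<nu> - 1))" unfolding C_def by simp
      then show ?thesis unfolding c_def by (simp only: mult_ac)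
    qed
    finally show ?thesis by (simp add: mult_ac)
  qed
  have lam0: "?lam \<ge> 0" using lam by linarith
  note tan = curvature_tangent[of M "2 * M" ?h ?g ?g' ?lam C, OF dh dg lo hi lam0]
  note tra = curvature_transversal[of M "2 * M" ?h ?g ?g' ?lam C, OF dh dg lo hi lam0]
  show ?thesis
  proof (rule curve_system_kernel_measure)
    show "C \<ge> 0" unfolding C_def by simp
    show "\<bar>?h (of_int x) - ?h (of_int d) - ?g (of_int d) * of_int (x - d)\<bar> \<le> C * ?lam * (of_int (x - d))\<^sup>2"
      if "x \<in> {n. M \<le> of_int n \<and> of_int n \<le> 2 * M}" "d \<in> {n. M \<le> of_int n \<and> of_int n \<le> 2 * M}" for x d :: int
      using tan[of "of_int x" "of_int d"] that by simp
    fix x y d s :: int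
    assume *: "x \<in> {n. M \<le> of_int n \<and> of_int n \<le> 2 * M}" "y \<in> {n. M \<le> of_int n \<and> of_int n \<le> 2 * M}"
      "d \<in> {n. M \<le> of_int n \<and> of_int n \<le> 2 * M}" "0 \<le> s" "d + s \<le> x \<and> d + s \<le> y \<or> x + s \<le> d \<and> y + s \<le> d"
    have "real_of_int d + real_of_int s \<le> real_of_int x \<and> real_of_int d + real_of_int s \<le> real_of_int y \<or>
      real_of_int x + real_of_int s \<le> real_of_int d \<and> real_of_int y + real_of_int s \<le> real_of_int d"
      using *(5) by linarith
    with * show "?lam * of_int s * \<bar>of_int x - of_int y\<bar> \<le> \<bar>?h (of_int x) - ?h (of_int y) - ?g (of_int d) * (of_int x - of_int y)\<bar>"
      by (intro tra) auto
  qed (rule lam)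
qed

lemma dyadic_sixth_moment:
  fixes \<nu> \<epsilon> :: real
  assumes \<nu>: "\<nu> > 0" and \<epsilon>: "\<epsilon> > 0"
  shows "\<exists>A\<ge>0. \<forall>i (X :: nat set) a. X \<subseteq> {2^i..<2^Suc i} \<longrightarrow>
    (\<integral>\<^sup>+z. ennreal ((cmod (\<Sum>n\<in>X. a n * e1 (real n * fst z + real n powr (1 + \<nu>) * snd z))) ^ 6) * indicator ({0..1} \<times> {0..1}) z \<partial>lborel)
      \<le> ennreal (A * (2^i) powr (max 0 (1 - \<nu>) + \<epsilon>) * (\<Sum>n\<in>X. (cmod (a n))\<^sup>2) ^ 3)"
proof -
  define c where "c = (1 + \<nu>) * \<nu> * min 1 (2 powr (\<nu> - 1))"
  define C where "C = max 1 (2 powr (\<nu> - 1)) / min 1 (2 powr (\<nu> - 1))"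
  define E where "E = max 0 (1 - \<nu>)"
  \<comment> \<open>At least 1/c, so that the stretched curve has curvature at least 1; at least 1,
    so that T \<ge> 1 as the comparison with the weight demands.\<close>
  define K where "K = max 1 (1 / c)"
  have c: "c > 0" unfolding c_def using \<nu> by simp
  have K: "K \<ge> 1" "K * c \<ge> 1"
  proof -
    have "1 = 1 / c * c" using c by simp
    also have "\<dots> \<le> K * c" unfolding K_def using c by (intro mult_right_mono) auto
    finally show "K * c \<ge> 1" .
  qed (simp add: K_def)
  obtain A where A: "A \<ge> 0" and bound: "\<And>(M :: (real \<times> real) measure) e h g J lam a. curve_system M e h g J C lam \<Longrightarrow>
      measure M (space M) = measure kernel_measure (space kernel_measure) \<Longrightarrow> curve_system.sixth_bound M e J a A \<epsilon>"
    using curve_system_sixth_moment[OF \<epsilon>] by metis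
  show ?thesis
  proof (intro exI[of _ "4 * K * A"] conjI allI impI)
    show "0 \<le> 4 * K * A" using A K by simp
    fix i :: nat and X :: "nat set" and a :: "nat \<Rightarrow> complex"
    assume X: "X \<subseteq> {2^i..<2^Suc i}"
    define M :: real where "M = 2^i"
    have M: "M \<ge> 1" "M > 0" unfolding M_def by simp_all
    define T where "T = K * M powr E"
    have T: "T \<ge> 1"
    proof -
      have "1 * 1 \<le> K * M powr E" using K M by (intro mult_mono) (auto simp: E_def ge_one_powr_ge_zero)
      then show ?thesis by (simp add: T_def)
    qed
    have lam: "T * c * M powr (\<nu> - 1) \<ge> 1"
    proof -
      have "1 * 1 \<le> (K * c) * M powr (E + (\<nu> - 1))"
        using K M by (intro mult_mono) (auto simp: E_def ge_one_powr_ge_zero)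
      then show ?thesis unfolding T_def by (simp add: powr_add mult_ac)
    qed
    let ?J = "{n. M \<le> real_of_int n \<and> real_of_int n \<le> 2 * M}"
    let ?e = "\<lambda>n z. e1 (of_int n * fst z + T * of_int n powr (1 + \<nu>) * snd z)"
    have cs: "curve_system kernel_measure ?e
      (\<lambda>n. T * of_int n powr (1 + \<nu>)) (\<lambda>n. T * (1 + \<nu>) * of_int n powr \<nu>) ?J C (T * c * M powr (\<nu> - 1))"
      using curve_system_dyadic[OF \<nu> M(2)] lam unfolding c_def C_def by blast
    define b where "b n = a (nat n)" for n
    interpret cs: curve_system kernel_measure ?e
      "\<lambda>n. T * of_int n powr (1 + \<nu>)" "\<lambda>n. T * (1 + \<nu>) * of_int n powr \<nu>" ?J C "T * c * M powr (\<nu> - 1)" b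
      by (rule cs)
    have sb: "cs.sixth_bound A \<epsilon>" by (rule bound[OF cs refl])
    let ?X = "int ` X"
    have F: "cs.F ?X z = (\<Sum>n\<in>X. a n * e1 (real n * fst z + real n powr (1 + \<nu>) * (T * snd z)))" for z
      unfolding cs.F_def by (subst sum.reindex) (auto simp: b_def mult_ac)
    have mass: "cs.mass ?X = (\<Sum>n\<in>X. (cmod (a n))\<^sup>2)"
      unfolding cs.mass_def by (subst sum.reindex) (auto simp: b_def)
    have XJ: "?X \<subseteq> ?J"
    proof
      fix n assume "n \<in> ?X"
      then obtain m where m: "m \<in> X" "n = int m" by blast
      then have "2^i \<le> m" "m \<le> 2^Suc i" using X by auto
      then have "real (2^i) \<le> real m" "real m \<le> real (2^Suc i)" by (simp_all only: of_nat_le_iff)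
      then show "n \<in> ?J" unfolding m(2) M_def by simp
    qed
    have XI: "?X \<subseteq> {2^i..<2^i + int (2^i)}"
    proof
      fix n assume "n \<in> ?X"
      then obtain m where m: "m \<in> X" "n = int m" by blast
      then have "2^i \<le> m" "m < 2^i + 2^i" using X by auto
      then have "int (2^i) \<le> int m" "int m < int (2^i + 2^i)" by (simp_all only: of_nat_le_iff of_nat_less_iff)
      then show "n \<in> {2^i..<2^i + int (2^i)}" unfolding m(2) by simp
    qed
    have main: "(LINT z|kernel_measure. (cmod (cs.F ?X z)) ^ 6) \<le> A * M powr \<epsilon> * (cs.mass ?X) ^ 3"
      using sb[unfolded cs.sixth_bound_def, rule_format, OF XJ XI] by (simp add: M_def)
    let ?f = "\<lambda>z. \<Sum>n\<in>X. a n * e1 (real n * fst z + real n powr (1 + \<nu>) * snd z)"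
    have "(\<integral>\<^sup>+z. ennreal ((cmod (?f z)) ^ 6) * indicator ({0..1} \<times> {0..1}) z \<partial>lborel)
      \<le> ennreal (4 * T) * (\<integral>\<^sup>+z. ennreal ((cmod (?f (fst z, T * snd z))) ^ 6) \<partial>kernel_measure)"
    proof (rule nn_integral_square_le_kernel)
      show "(\<lambda>z. ennreal ((cmod (?f z)) ^ 6)) \<in> borel_measurable borel" by measurable
    qed (rule T)
    also have "(\<integral>\<^sup>+z. ennreal ((cmod (?f (fst z, T * snd z))) ^ 6) \<partial>kernel_measure)
      = (\<integral>\<^sup>+z. ennreal ((cmod (cs.F ?X z)) ^ 6) \<partial>kernel_measure)"
      unfolding F by simp
    also have "\<dots> = ennreal (LINT z|kernel_measure. (cmod (cs.F ?X z)) ^ 6)"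
      by (intro nn_integral_eq_integral cs.integrable_norm_pow) auto
    also have "ennreal (4 * T) * \<dots> \<le> ennreal (4 * T) * ennreal (A * M powr \<epsilon> * (cs.mass ?X) ^ 3)"
      by (intro mult_left_mono ennreal_leI main) auto
    also have "\<dots> = ennreal (4 * K * A * M powr (E + \<epsilon>) * (\<Sum>n\<in>X. (cmod (a n))\<^sup>2) ^ 3)"
      using T unfolding mass by (subst ennreal_mult'[symmetric]) (auto simp: T_def powr_add mult_ac)
    finally show "(\<integral>\<^sup>+z. ennreal ((cmod (?f z)) ^ 6) * indicator ({0..1} \<times> {0..1}) z \<partial>lborel)
      \<le> ennreal (4 * K * A * (2^i) powr (max 0 (1 - \<nu>) + \<epsilon>) * (\<Sum>n\<in>X. (cmod (a n))\<^sup>2) ^ 3)"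
      unfolding M_def E_def .
  qed
qed

section \<open>Moments of the fractional exponential sum\<close>

abbreviation (input) unit_square :: "(real \<times> real) set" where "unit_square \<equiv> {0..1} \<times> {0..1}"

text \<open>A bridge between the completed measure of the final statement and the Borel measure,
  where Fubini and the comparison with the kernel take place.\<close>

lemma integral_unit_square:
  fixes f :: "real \<times> real \<Rightarrow> real"
  assumes "continuous_on unit_square f" "f \<in> borel_measurable borel" "\<And>z. f z \<ge> 0"
  shows "integrable (lebesgue_on unit_square) f"
    and "ennreal (LINT z|lebesgue_on unit_square. f z) = (\<integral>\<^sup>+z. ennreal (f z) * indicator unit_square z \<partial>lborel)"
proof -
  have "compact unit_square" by (intro compact_Times compact_Icc)
  from borel_integrable_compact[OF this assms(1)]
  have int: "integrable lborel (\<lambda>z. indicator unit_square z *\<^sub>R f z)"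
    by (simp add: indicator_scaleR_eq_if)
  have sets: "unit_square \<inter> space lebesgue \<in> sets lebesgue" by (simp add: borel_closed closed_Times)
  show "integrable (lebesgue_on unit_square) f"
    using int sets by (subst integrable_restrict_space) (auto simp: integrable_completion borel_measurable_integrable)
  have "(LINT z|lebesgue_on unit_square. f z) = (LINT z|lebesgue. indicator unit_square z *\<^sub>R f z)"
    using sets by (rule integral_restrict_space)
  also have "\<dots> = (LINT z|lborel. indicator unit_square z *\<^sub>R f z)"
    using int by (intro integral_completion) auto
  finally have "ennreal (LINT z|lebesgue_on unit_square. f z) = (\<integral>\<^sup>+z. ennreal (indicator unit_square z *\<^sub>R f z) \<partial>lborel)"
    using int assms(3) by (subst nn_integral_eq_integral) auto
  also have "\<dots> = (\<integral>\<^sup>+z. ennreal (f z) * indicator unit_square z \<partial>lborel)"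
    by (intro nn_integral_cong) (auto simp: indicator_def)
  finally show "ennreal (LINT z|lebesgue_on unit_square. f z) = (\<integral>\<^sup>+z. ennreal (f z) * indicator unit_square z \<partial>lborel)" .
qed

lemma continuous_on_frac_sum: "continuous_on S (frac_sum \<nu> N a)"
  unfolding frac_sum_def case_prod_unfold by (intro continuous_intros)

lemma borel_measurable_frac_sum [measurable]: "frac_sum \<nu> N a \<in> borel_measurable borel"
  by (intro borel_measurable_continuous_onI continuous_on_frac_sum)

lemma integral_frac_sum_power:
  shows "integrable (lebesgue_on unit_square) (\<lambda>z. (cmod (frac_sum \<nu> N a z)) ^ k)"
    and "ennreal (LINT z|lebesgue_on unit_square. (cmod (frac_sum \<nu> N a z)) ^ k) =
      (\<integral>\<^sup>+z. ennreal ((cmod (frac_sum \<nu> N a z)) ^ k) * indicator unit_square z \<partial>lborel)"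
  by (rule integral_unit_square; (intro continuous_intros continuous_on_frac_sum | simp))+

text \<open>Only the conjugate factor is expanded; the integrals that appear are then the known
  Fourier coefficients.\<close>

lemma parseval_trig_poly:
  "(LINT x|lebesgue_on {0..1}. (cmod (trig_poly N a x))\<^sup>2) = (\<Sum>n=1..N. (cmod (a n))\<^sup>2)"
proof -
  have "complex_of_real (LINT x|lebesgue_on {0..1}. (cmod (trig_poly N a x))\<^sup>2) =
      (LINT x|lebesgue_on {0..1}. complex_of_real ((cmod (trig_poly N a x))\<^sup>2))"
    by (rule integral_complex_of_real[symmetric])
  also have "\<dots> = (LINT x|lebesgue_on {0..1}. (\<Sum>n=1..N. cnj (a n) * (trig_poly N a x * e1 (- (of_int (int n) * x)))))"
  proof (intro Bochner_Integration.integral_cong refl)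
    fix x
    have "cnj (trig_poly N a x) = (\<Sum>n=1..N. cnj (a n) * e1 (- (of_int (int n) * x)))"
      unfolding trig_poly_def by (simp add: cnj_sum cnj_e1)
    then show "complex_of_real ((cmod (trig_poly N a x))\<^sup>2) = (\<Sum>n=1..N. cnj (a n) * (trig_poly N a x * e1 (- (of_int (int n) * x))))"
      unfolding complex_norm_square by (simp add: sum_distrib_left mult_ac)
  qed
  also have "\<dots> = (\<Sum>n=1..N. cnj (a n) * fourier_coeff (trig_poly N a) (int n))"
    unfolding fourier_coeff_def
    by (subst Bochner_Integration.integral_sum)
       (intro integrable_continuous_01 continuous_intros continuous_on_trig_poly, simp)
  also have "\<dots> = (\<Sum>n=1..N. complex_of_real ((cmod (a n))\<^sup>2))"
    unfolding fourier_coeff_trig_poly complex_norm_square by (intro sum.cong) (auto simp: mult.commute)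
  finally have "complex_of_real (LINT x|lebesgue_on {0..1}. (cmod (trig_poly N a x))\<^sup>2) = complex_of_real (\<Sum>n=1..N. (cmod (a n))\<^sup>2)"
    by simp
  then show ?thesis by (simp only: of_real_eq_iff)
qed

lemma nn_integral_trig_poly_sq:
  "(\<integral>\<^sup>+x. ennreal ((cmod (trig_poly N a x))\<^sup>2) * indicator {0..1} x \<partial>lborel) = ennreal (\<Sum>n=1..N. (cmod (a n))\<^sup>2)"
proof -
  have int: "integrable lborel (\<lambda>x. indicator {0..1} x *\<^sub>R (cmod (trig_poly N a x))\<^sup>2)"
  proof -
    have "continuous_on {0..1} (\<lambda>x. (cmod (trig_poly N a x))\<^sup>2)"
      by (intro continuous_intros continuous_on_trig_poly)
    from borel_integrable_compact[OF compact_Icc this] show ?thesis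
      by (simp only: indicator_scaleR_eq_if)
  qed
  have "(\<Sum>n=1..N. (cmod (a n))\<^sup>2) = (LINT x|lebesgue. indicator {0..1} x *\<^sub>R (cmod (trig_poly N a x))\<^sup>2)"
    unfolding parseval_trig_poly[symmetric] by (rule integral_restrict_space) simp
  also have "\<dots> = (LINT x|lborel. indicator {0..1} x *\<^sub>R (cmod (trig_poly N a x))\<^sup>2)"
    using int by (intro integral_completion) auto
  finally have "ennreal (\<Sum>n=1..N. (cmod (a n))\<^sup>2) = (\<integral>\<^sup>+x. ennreal (indicator {0..1} x *\<^sub>R (cmod (trig_poly N a x))\<^sup>2) \<partial>lborel)"
    using int by (subst nn_integral_eq_integral) auto
  also have "\<dots> = (\<integral>\<^sup>+x. ennreal ((cmod (trig_poly N a x))\<^sup>2) * indicator {0..1} x \<partial>lborel)"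
    by (intro nn_integral_cong) (auto simp: indicator_def)
  finally show ?thesis ..
qed

text \<open>For fixed t the time factors only rotate the coefficients, so Parseval in x gives a
  value independent of t.\<close>

lemma frac_sum_second_moment:
  "(LINT z|lebesgue_on unit_square. (cmod (frac_sum \<nu> N a z))\<^sup>2) = (\<Sum>n=1..N. (cmod (a n))\<^sup>2)"
proof -
  let ?f = "frac_sum \<nu> N a"
  have [measurable]: "?f \<in> borel_measurable (borel \<Otimes>\<^sub>M borel)" by (simp add: borel_prod)
  have "ennreal (LINT z|lebesgue_on unit_square. (cmod (?f z))\<^sup>2) =
      (\<integral>\<^sup>+z. ennreal ((cmod (?f z))\<^sup>2) * indicator unit_square z \<partial>(lborel \<Otimes>\<^sub>M lborel))"
    unfolding integral_frac_sum_power(2) lborel_prod ..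
  also have "\<dots> = (\<integral>\<^sup>+t. \<integral>\<^sup>+x. ennreal ((cmod (?f (x, t)))\<^sup>2) * indicator unit_square (x, t) \<partial>lborel \<partial>lborel)"
    by (subst lborel_pair.nn_integral_snd[symmetric]) auto
  also have "\<dots> = (\<integral>\<^sup>+t. (\<integral>\<^sup>+x. ennreal ((cmod (?f (x, t)))\<^sup>2) * indicator {0..1} x \<partial>lborel) * indicator {0..1} t \<partial>lborel)"
    by (subst nn_integral_multc[symmetric]) (auto simp: indicator_times mult_ac intro!: nn_integral_cong)
  also have "\<dots> = (\<integral>\<^sup>+t. ennreal (\<Sum>n=1..N. (cmod (a n))\<^sup>2) * indicator {0..1::real} t \<partial>lborel)"
    unfolding frac_sum_eq_trig_poly nn_integral_trig_poly_sq by (simp add: norm_mult)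
  also have "\<dots> = ennreal (\<Sum>n=1..N. (cmod (a n))\<^sup>2)"
    by (subst nn_integral_cmult_indicator) auto
  finally show ?thesis
    by (subst (asm) ennreal_inj) (auto intro!: sum_nonneg integral_nonneg_AE)
qed

lemma norm_frac_sum_sq_le:
  "(cmod (frac_sum \<nu> N a z))\<^sup>2 \<le> real N * (\<Sum>n=1..N. (cmod (a n))\<^sup>2)"
proof -
  have "cmod (frac_sum \<nu> N a z) \<le> (\<Sum>n=1..N. cmod (a n))"
    unfolding frac_sum_def case_prod_unfold by (rule order_trans[OF norm_sum]) (simp add: norm_mult)
  then have "(cmod (frac_sum \<nu> N a z))\<^sup>2 \<le> (\<Sum>n=1..N. 1 * cmod (a n))\<^sup>2"
    by (intro power_mono) auto
  also have "\<dots> \<le> (\<Sum>n=1..N. 1\<^sup>2) * (\<Sum>n=1..N. (cmod (a n))\<^sup>2)"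
    by (rule Cauchy_Schwarz_ineq_sum)
  finally show ?thesis by simp
qed

text \<open>Comparison with the largest term loses l^6 where Hoelder's inequality loses l^5; this is
  harmless for a logarithmic number of blocks.\<close>

lemma sum_pow6_le:
  fixes f :: "nat \<Rightarrow> real"
  assumes "\<And>i. f i \<ge> 0"
  shows "(\<Sum>i<l. f i) ^ 6 \<le> real l ^ 6 * (\<Sum>i<l. f i ^ 6)"
proof (cases "l = 0")
  case False
  then obtain j where j: "j \<in> {..<l}" "\<And>i. i \<in> {..<l} \<Longrightarrow> f i \<le> f j"
    using finite_argmax[of "{..<l}" f] by auto
  have "(\<Sum>i<l. f i) \<le> real l * f j"
    using sum_bounded_above[of "{..<l}" f "f j"] j by simp
  then have "(\<Sum>i<l. f i) ^ 6 \<le> (real l * f j) ^ 6"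
    using assms by (intro power_mono sum_nonneg) auto
  also have "\<dots> = real l ^ 6 * f j ^ 6" by (rule power_mult_distrib)
  also have "\<dots> \<le> real l ^ 6 * (\<Sum>i<l. f i ^ 6)"
    using assms j member_le_sum[of j "{..<l}" "\<lambda>i. f i ^ 6"] by (intro mult_left_mono) auto
  finally show ?thesis .
qed simp

lemma log_pow6_le_powr:
  fixes \<epsilon> :: real
  assumes "\<epsilon> > 0"
  shows "\<exists>B>0. \<forall>x\<ge>1. (1 + log 2 x) ^ 6 \<le> B * x powr \<epsilon>"
proof -
  define b where "b = 1 + 6 / (\<epsilon> * ln 2)"
  have b: "b > 0" unfolding b_def using assms by (simp add: add_pos_pos)
  have "(1 + log 2 x) ^ 6 \<le> b ^ 6 * x powr \<epsilon>" if x: "x \<ge> 1" for x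
  proof -
    have "ln x \<le> x powr (\<epsilon> / 6) / (\<epsilon> / 6)" using x assms by (intro ln_powr_bound) auto
    then have "log 2 x \<le> 6 / (\<epsilon> * ln 2) * x powr (\<epsilon> / 6)"
      unfolding log_def by (simp add: field_simps)
    moreover have "1 \<le> x powr (\<epsilon> / 6)" using x assms by (simp add: ge_one_powr_ge_zero)
    ultimately have "1 + log 2 x \<le> b * x powr (\<epsilon> / 6)"
      unfolding b_def by (simp add: distrib_right)
    then have "(1 + log 2 x) ^ 6 \<le> (b * x powr (\<epsilon> / 6)) ^ 6"
      using x by (intro power_mono) auto
    also have "\<dots> = b ^ 6 * x powr \<epsilon>"
      using x by (simp add: power_mult_distrib powr_power)
    finally show ?thesis .
  qed
  then show ?thesis using b by (intro exI[of _ "b ^ 6"]) auto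
qed

text \<open>The dyadic blocks are combined by the triangle inequality alone. Half of
  \<open>\<epsilon>\<close> is spent inside the blocks, the other half on the sixth power of their
  number.\<close>

lemma frac_sum_sixth_moment:
  fixes \<nu> \<epsilon> :: real
  assumes \<nu>: "\<nu> > 0" and \<epsilon>: "\<epsilon> > 0"
  shows "\<exists>A>0. \<forall>N\<ge>1. \<forall>a. (LINT z|lebesgue_on unit_square. (cmod (frac_sum \<nu> N a z)) ^ 6)
      \<le> A * real N powr (max 0 (1 - \<nu>) + \<epsilon>) * (\<Sum>n=1..N. (cmod (a n))\<^sup>2) ^ 3"
proof -
  define E where "E = max 0 (1 - \<nu>) + \<epsilon> / 2"
  have E: "E \<ge> 0" unfolding E_def using \<epsilon> by simp
  obtain A where A: "A \<ge> 0" and dyadic: "\<And>i (X :: nat set) a. X \<subseteq> {2^i..<2^Suc i} \<Longrightarrow>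
    (\<integral>\<^sup>+z. ennreal ((cmod (\<Sum>n\<in>X. a n * e1 (real n * fst z + real n powr (1 + \<nu>) * snd z))) ^ 6) * indicator unit_square z \<partial>lborel)
      \<le> ennreal (A * (2^i) powr E * (\<Sum>n\<in>X. (cmod (a n))\<^sup>2) ^ 3)"
    using dyadic_sixth_moment[OF \<nu>, of "\<epsilon> / 2"] \<epsilon> unfolding E_def by auto
  obtain B where B: "B > 0" "\<And>x. x \<ge> 1 \<Longrightarrow> (1 + log 2 x) ^ 6 \<le> B * x powr (\<epsilon> / 2)"
    using log_pow6_le_powr[of "\<epsilon> / 2"] \<epsilon> by auto
  show ?thesis
  proof (intro exI[of _ "B * A + 1"] conjI allI impI)
    \<comment> \<open>\<open>A\<close> is only known to be nonnegative; adding 1 makes the constant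
      positive.\<close>
    show "B * A + 1 > 0" using A B by (simp add: add_nonneg_pos)
    fix N :: nat and a :: "nat \<Rightarrow> complex"
    assume N: "N \<ge> 1"
    define l where "l = nat \<lfloor>log 2 N\<rfloor> + 1"
    have log0: "log 2 N \<ge> 0" using N by simp
    have l: "real l \<le> 1 + log 2 N" unfolding l_def using log0 by simp
    have l': "2^i \<le> real N" if "i < l" for i
    proof -
      have "real i \<le> log 2 N" using that log0 unfolding l_def by linarith
      then have "2 powr real i \<le> real N" using N by (simp add: le_log_iff)
      then show ?thesis by (simp add: powr_realpow)
    qed
    define \<beta> where "\<beta> n = nat \<lfloor>log 2 (real n)\<rfloor>" for n :: nat
    define X where "X i = {n\<in>{1..N}. \<beta> n = i}" for i
    have X: "X i \<subseteq> {2^i..<2^Suc i}" for i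
    proof
      fix n assume "n \<in> X i"
      then have n: "n \<ge> 1" "nat \<lfloor>log 2 (real n)\<rfloor> = i" unfolding X_def \<beta>_def by auto
      moreover have "log 2 (real n) \<ge> 0" using n by simp
      ultimately have "\<lfloor>log 2 (real n)\<rfloor> = int i" by linarith
      then show "n \<in> {2^i..<2^Suc i}" using n floor_log_nat_eq_powr_iff[of 2 n i] by simp
    qed
    have \<beta>: "\<beta> ` {1..N} \<subseteq> {..<l}"
    proof
      fix i assume "i \<in> \<beta> ` {1..N}"
      then obtain n where n: "1 \<le> n" "n \<le> N" "i = \<beta> n" by auto
      then have "\<lfloor>log 2 (real n)\<rfloor> \<le> \<lfloor>log 2 (real N)\<rfloor>" by (intro floor_mono) simp
      then show "i \<in> {..<l}" unfolding n(3) \<beta>_def l_def by simp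
    qed
    define m where "m = (\<Sum>n=1..N. (cmod (a n))\<^sup>2)"
    define mX where "mX i = (\<Sum>n\<in>X i. (cmod (a n))\<^sup>2)" for i
    have mX0: "mX i \<ge> 0" for i unfolding mX_def by (intro sum_nonneg) auto
    have m0: "m \<ge> 0" unfolding m_def by (intro sum_nonneg) auto
    have m_sum: "m = (\<Sum>i<l. mX i)"
      unfolding m_def mX_def X_def by (rule sum.group[symmetric]) (use \<beta> in auto)
    have mX_le: "mX i \<le> m" for i
      unfolding m_def mX_def X_def by (intro sum_mono2) auto
    define f where "f i z = (\<Sum>n\<in>X i. a n * e1 (real n * fst z + real n powr (1 + \<nu>) * snd z))" for i and z :: "real \<times> real"
    have [measurable]: "f i \<in> borel_measurable borel" for i
      unfolding f_def by (intro borel_measurable_continuous_onI continuous_intros)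
    have pointwise: "(cmod (frac_sum \<nu> N a z)) ^ 6 \<le> real l ^ 6 * (\<Sum>i<l. (cmod (f i z)) ^ 6)" for z
    proof -
      have "frac_sum \<nu> N a z = (\<Sum>i<l. f i z)"
        unfolding f_def X_def frac_sum_def case_prod_unfold by (rule sum.group[symmetric]) (use \<beta> in auto)
      then have "cmod (frac_sum \<nu> N a z) \<le> (\<Sum>i<l. cmod (f i z))" by (simp add: norm_sum)
      then have "(cmod (frac_sum \<nu> N a z)) ^ 6 \<le> (\<Sum>i<l. cmod (f i z)) ^ 6" by (intro power_mono) auto
      also have "\<dots> \<le> real l ^ 6 * (\<Sum>i<l. (cmod (f i z)) ^ 6)" by (intro sum_pow6_le) auto
      finally show ?thesis .
    qed
    have "ennreal (LINT z|lebesgue_on unit_square. (cmod (frac_sum \<nu> N a z)) ^ 6) =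
        (\<integral>\<^sup>+z. ennreal ((cmod (frac_sum \<nu> N a z)) ^ 6) * indicator unit_square z \<partial>lborel)"
      by (rule integral_frac_sum_power)
    also have "\<dots> \<le> (\<integral>\<^sup>+z. ennreal (real l ^ 6) * (\<Sum>i<l. ennreal ((cmod (f i z)) ^ 6) * indicator unit_square z) \<partial>lborel)"
    proof (intro nn_integral_mono)
      fix z
      have "ennreal ((cmod (frac_sum \<nu> N a z)) ^ 6) \<le> ennreal (real l ^ 6 * (\<Sum>i<l. (cmod (f i z)) ^ 6))"
        by (rule ennreal_leI[OF pointwise])
      also have "\<dots> = ennreal (real l ^ 6) * (\<Sum>i<l. ennreal ((cmod (f i z)) ^ 6))"
        by (simp add: ennreal_mult sum_nonneg)
      finally have "ennreal ((cmod (frac_sum \<nu> N a z)) ^ 6) * indicator unit_square z \<le>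
          ennreal (real l ^ 6) * (\<Sum>i<l. ennreal ((cmod (f i z)) ^ 6)) * indicator unit_square z"
        by (rule mult_right_mono) simp
      then show "ennreal ((cmod (frac_sum \<nu> N a z)) ^ 6) * indicator unit_square z \<le>
          ennreal (real l ^ 6) * (\<Sum>i<l. ennreal ((cmod (f i z)) ^ 6) * indicator unit_square z)"
        by (simp only: sum_distrib_right mult.assoc)
    qed
    also have "\<dots> = ennreal (real l ^ 6) * (\<Sum>i<l. \<integral>\<^sup>+z. ennreal ((cmod (f i z)) ^ 6) * indicator unit_square z \<partial>lborel)"
    proof -
      have [measurable]: "unit_square \<in> sets borel" by (intro borel_closed closed_Times closed_atLeastAtMost)
      have meas: "(\<lambda>z. ennreal ((cmod (f i z)) ^ 6) * indicator unit_square z) \<in> borel_measurable lborel" for i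
        by measurable
      show ?thesis
        by (subst nn_integral_cmult, intro borel_measurable_sum meas, subst nn_integral_sum[OF meas], rule refl)
    qed
    also have "\<dots> \<le> ennreal (real l ^ 6) * (\<Sum>i<l. ennreal (A * real N powr E * (m\<^sup>2 * mX i)))"
    proof (intro mult_left_mono sum_mono)
      fix i assume i: "i \<in> {..<l}"
      have "(\<integral>\<^sup>+z. ennreal ((cmod (f i z)) ^ 6) * indicator unit_square z \<partial>lborel) \<le> ennreal (A * (2^i) powr E * mX i ^ 3)"
        unfolding f_def mX_def by (rule dyadic[OF X])
      also have "\<dots> \<le> ennreal (A * real N powr E * (m\<^sup>2 * mX i))"
      proof (intro ennreal_leI mult_mono)
        show "(2^i) powr E \<le> real N powr E" using l'[of i] i E by (intro powr_mono2) auto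
        have "mX i ^ 2 * mX i \<le> m\<^sup>2 * mX i" using mX_le mX0 by (intro mult_right_mono power_mono) auto
        then show "mX i ^ 3 \<le> m\<^sup>2 * mX i" by (simp add: power2_eq_square power3_eq_cube)
      qed (use A mX0 in auto)
      finally show "(\<integral>\<^sup>+z. ennreal ((cmod (f i z)) ^ 6) * indicator unit_square z \<partial>lborel) \<le> ennreal (A * real N powr E * (m\<^sup>2 * mX i))" .
    qed simp
    also have "\<dots> = ennreal (real l ^ 6 * (A * real N powr E * m ^ 3))"
    proof -
      have "(\<Sum>i<l. ennreal (A * real N powr E * (m\<^sup>2 * mX i))) = ennreal (\<Sum>i<l. A * real N powr E * (m\<^sup>2 * mX i))"
        using A mX0 by (intro sum_ennreal) auto
      also have "(\<Sum>i<l. A * real N powr E * (m\<^sup>2 * mX i)) = A * real N powr E * m ^ 3"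
        unfolding sum_distrib_left[symmetric] m_sum[symmetric] by (simp add: power2_eq_square power3_eq_cube)
      finally show ?thesis using A m0 by (simp add: ennreal_mult)
    qed
    finally have "(LINT z|lebesgue_on unit_square. (cmod (frac_sum \<nu> N a z)) ^ 6) \<le> real l ^ 6 * (A * real N powr E * m ^ 3)"
      using A m0 by (subst (asm) ennreal_le_iff) auto
    also have "\<dots> \<le> (B * real N powr (\<epsilon> / 2)) * (A * real N powr E * m ^ 3)"
    proof (intro mult_right_mono)
      have "real l ^ 6 \<le> (1 + log 2 N) ^ 6" using l by (intro power_mono) auto
      also have "\<dots> \<le> B * real N powr (\<epsilon> / 2)" using N by (intro B) auto
      finally show "real l ^ 6 \<le> B * real N powr (\<epsilon> / 2)" .
    qed (use A m0 in auto)
    also have "\<dots> = B * A * real N powr (max 0 (1 - \<nu>) + \<epsilon>) * m ^ 3"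
    proof -
      have "max 0 (1 - \<nu>) + \<epsilon> = \<epsilon> / 2 + E" unfolding E_def by simp
      then show ?thesis by (simp add: powr_add mult_ac)
    qed
    also have "\<dots> \<le> (B * A + 1) * real N powr (max 0 (1 - \<nu>) + \<epsilon>) * m ^ 3"
      using m0 by (intro mult_right_mono) auto
    finally show "(LINT z|lebesgue_on unit_square. (cmod (frac_sum \<nu> N a z)) ^ 6)
      \<le> (B * A + 1) * real N powr (max 0 (1 - \<nu>) + \<epsilon>) * (\<Sum>n=1..N. (cmod (a n))\<^sup>2) ^ 3"
      unfolding m_def .
  qed
qed

section \<open>Interpolation\<close>

text \<open>A pointwise substitute for Hoelder's inequality: if \<open>A\<close> and
  \<open>B\<close> bound the second and the sixth moment, the bracket has integral at most 1 over
  the square, and A^(1-s) B^s remains.\<close>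

lemma interpolation_powr:
  fixes y A B s p :: real
  assumes "y \<ge> 0" "A > 0" "B > 0" "0 \<le> s" "s \<le> 1" and p: "p = 2 * (1 - s) + 6 * s"
  shows "y powr p \<le> ((1 - s) * (y\<^sup>2 / A) + s * (y ^ 6 / B)) * (A powr (1 - s) * B powr s)"
proof (cases "y = 0")
  case False
  then have y: "y > 0" using assms by simp
  have "(y\<^sup>2 / A) powr (1 - s) * (y ^ 6 / B) powr s \<le> (1 - s) * (y\<^sup>2 / A) + s * (y ^ 6 / B)"
    using assms y by (intro Youngs_inequality_0) auto
  then have "(y\<^sup>2 / A) powr (1 - s) * (y ^ 6 / B) powr s * (A powr (1 - s) * B powr s)
      \<le> ((1 - s) * (y\<^sup>2 / A) + s * (y ^ 6 / B)) * (A powr (1 - s) * B powr s)"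
    by (rule mult_right_mono) simp
  also have "(y\<^sup>2 / A) powr (1 - s) * (y ^ 6 / B) powr s * (A powr (1 - s) * B powr s) =
      (y\<^sup>2 / A * A) powr (1 - s) * (y ^ 6 / B * B) powr s"
    by (simp only: powr_mult mult_ac)
  also have "\<dots> = (y powr 2) powr (1 - s) * (y powr 6) powr s"
    using assms y by (simp add: powr_numeral)
  also have "\<dots> = y powr p"
    unfolding p powr_powr powr_add[symmetric] ..
  finally show ?thesis .
qed (use assms in simp)

lemma integrable_frac_sum_powr:
  assumes "p > 0"
  shows "integrable (lebesgue_on unit_square) (\<lambda>z. (cmod (frac_sum \<nu> N a z)) powr p)"
proof (rule integral_unit_square)
  show "continuous_on unit_square (\<lambda>z. (cmod (frac_sum \<nu> N a z)) powr p)"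
    using assms by (intro continuous_on_powr' continuous_on_norm continuous_on_const continuous_on_frac_sum) auto
qed auto

lemma Lp_frac_sum_le:
  fixes \<nu> p \<epsilon> :: real
  assumes \<nu>: "\<nu> > 0" and p: "p \<ge> 2" and \<epsilon>: "\<epsilon> > 0"
  shows "\<exists>C>0. \<forall>N\<ge>1. \<forall>a. Lp_norm (lebesgue_on unit_square) p (frac_sum \<nu> N a)
      \<le> C * real N powr (exponent \<nu> p + \<epsilon>) * sqrt (\<Sum>n=1..N. (cmod (a n))\<^sup>2)"
proof -
  define E where "E = max 0 (1 - \<nu>)"
  have E: "E = max (1 + \<nu>) 2 - 1 - \<nu>" unfolding E_def by auto
  obtain A where A: "A > 0" and sixth: "\<And>N a. N \<ge> 1 \<Longrightarrow> (LINT z|lebesgue_on unit_square. (cmod (frac_sum \<nu> N a z)) ^ 6)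
      \<le> A * real N powr (E + \<epsilon>) * (\<Sum>n=1..N. (cmod (a n))\<^sup>2) ^ 3"
    using frac_sum_sixth_moment[OF \<nu> \<epsilon>] unfolding E_def by blast
  \<comment> \<open>The mass is assumed positive because the interpolation divides by it; for mass 0
    the sum vanishes identically.\<close>
  have bound: "\<exists>C>0. \<forall>N\<ge>1. \<forall>a. (\<Sum>n=1..N. (cmod (a n))\<^sup>2) > 0 \<longrightarrow>
      (LINT z|lebesgue_on unit_square. (cmod (frac_sum \<nu> N a z)) powr p)
        \<le> (C * real N powr (exponent \<nu> p + \<epsilon>) * sqrt (\<Sum>n=1..N. (cmod (a n))\<^sup>2)) powr p"
  proof (cases "p \<le> 6")
    case True
    define s where "s = (p - 2) / 4"
    have s: "0 \<le> s" "s \<le> 1" "p = 2 * (1 - s) + 6 * s" using p True by (auto simp: s_def field_simps)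
    show ?thesis
    proof (intro exI[of _ "A powr (s / p)"] conjI allI impI)
      fix N :: nat and a :: "nat \<Rightarrow> complex"
      assume N: "N \<ge> 1" and m: "(\<Sum>n=1..N. (cmod (a n))\<^sup>2) > 0"
      define m where "m = (\<Sum>n=1..N. (cmod (a n))\<^sup>2)"
      define B where "B = A * real N powr (E + \<epsilon>) * m ^ 3"
      have m0: "m > 0" and B: "B > 0" using m N A unfolding m_def B_def by auto
      let ?y = "\<lambda>z. cmod (frac_sum \<nu> N a z)"
      let ?Q = "lebesgue_on unit_square"
      have "(LINT z|?Q. ?y z powr p) \<le> (LINT z|?Q. ((1 - s) * (?y z ^ 2 / m) + s * (?y z ^ 6 / B)) * (m powr (1 - s) * B powr s))"
      proof (rule integral_mono)
        show "integrable ?Q (\<lambda>z. ?y z powr p)"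
          using p by (intro integrable_frac_sum_powr) simp
        show "integrable ?Q (\<lambda>z. ((1 - s) * (?y z ^ 2 / m) + s * (?y z ^ 6 / B)) * (m powr (1 - s) * B powr s))"
          by (intro integrable_mult_left Bochner_Integration.integrable_add integrable_mult_right integrable_divide integral_frac_sum_power)
      qed (rule interpolation_powr, use s m0 B in auto)
      also have "\<dots> = ((1 - s) * ((LINT z|?Q. ?y z ^ 2) / m) + s * ((LINT z|?Q. ?y z ^ 6) / B)) * (m powr (1 - s) * B powr s)"
        by (simp add: integral_frac_sum_power(1))
      also have "\<dots> \<le> ((1 - s) * 1 + s * 1) * (m powr (1 - s) * B powr s)"
      proof (intro mult_right_mono add_mono mult_left_mono)
        show "(LINT z|?Q. ?y z ^ 2) / m \<le> 1" unfolding frac_sum_second_moment m_def using m by simp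
        show "(LINT z|?Q. ?y z ^ 6) / B \<le> 1" using sixth[OF N, of a] B unfolding B_def m_def by simp
      qed (use s in auto)
      also have "\<dots> = m powr (1 - s) * B powr s" by simp
      also have "\<dots> = A powr s * real N powr ((E + \<epsilon>) * s) * m powr (p / 2)"
      proof -
        have "p / 2 = (1 - s) + 3 * s" using s(3) by simp
        then have "m powr (p / 2) = m powr (1 - s) * (m powr 3) powr s"
          by (simp only: powr_add powr_powr)
        then show ?thesis
          unfolding B_def using m0 by (simp add: powr_mult powr_powr powr_numeral mult_ac)
      qed
      also have "\<dots> \<le> A powr s * real N powr ((exponent \<nu> p + \<epsilon>) * p) * m powr (p / 2)"
      proof (intro mult_right_mono mult_left_mono powr_mono)
        \<comment> \<open>The second moment carries no power of N, so the weight \<open>s\<close> of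
          the sixth moment alone determines the exponent for p \<le> 6.\<close>
        have "exponent \<nu> p * p = E * s"
          using p True unfolding exponent_def Let_def E[symmetric] s_def by (simp add: field_simps)
        moreover have "\<epsilon> * s \<le> \<epsilon> * p" using s p \<epsilon> by (intro mult_left_mono) auto
        ultimately show "(E + \<epsilon>) * s \<le> (exponent \<nu> p + \<epsilon>) * p" by (simp add: distrib_right)
      qed (use N in auto)
      also have "\<dots> = (A powr (s / p) * real N powr (exponent \<nu> p + \<epsilon>) * sqrt m) powr p"
        using p m0 A by (simp add: powr_mult powr_powr powr_half_sqrt[symmetric])
      finally show "(LINT z|?Q. ?y z powr p) \<le> (A powr (s / p) * real N powr (exponent \<nu> p + \<epsilon>) * sqrt (\<Sum>n=1..N. (cmod (a n))\<^sup>2)) powr p"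
        unfolding m_def .
    qed (use A in simp)
  next
    case False
    show ?thesis
    proof (intro exI[of _ "A powr (1 / p)"] conjI allI impI)
      fix N :: nat and a :: "nat \<Rightarrow> complex"
      assume N: "N \<ge> 1" and m: "(\<Sum>n=1..N. (cmod (a n))\<^sup>2) > 0"
      define m where "m = (\<Sum>n=1..N. (cmod (a n))\<^sup>2)"
      have m0: "m > 0" using m unfolding m_def by auto
      let ?y = "\<lambda>z. cmod (frac_sum \<nu> N a z)"
      let ?Q = "lebesgue_on unit_square"
      \<comment> \<open>An upper bound for |u|^(p - 6), obtained from Cauchy--Schwarz; it leaves a
        sixth moment.\<close>
      let ?s = "(real N * m) powr ((p - 6) / 2)"
      have "(LINT z|?Q. ?y z powr p) \<le> (LINT z|?Q. ?s * ?y z ^ 6)"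
      proof (rule integral_mono)
        show "integrable ?Q (\<lambda>z. ?y z powr p)"
          using p by (intro integrable_frac_sum_powr) simp
        show "integrable ?Q (\<lambda>z. ?s * ?y z ^ 6)"
          by (intro integrable_mult_right integral_frac_sum_power)
        fix z
        show "?y z powr p \<le> ?s * ?y z ^ 6"
        proof (cases "?y z = 0")
          case nz: False
          then have y: "?y z > 0" by simp
          have "?y z powr p = ?y z powr (2 * ((p - 6) / 2) + 6)" by (simp add: field_simps)
          also have "\<dots> = (?y z powr 2) powr ((p - 6) / 2) * ?y z powr 6"
            by (simp only: powr_add powr_powr)
          also have "\<dots> = ((?y z)\<^sup>2) powr ((p - 6) / 2) * ?y z ^ 6"
            using y by (simp add: powr_numeral)
          also have "\<dots> \<le> ?s * ?y z ^ 6"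
            using False norm_frac_sum_sq_le[of \<nu> N a z] unfolding m_def
            by (intro mult_right_mono powr_mono2) auto
          finally show ?thesis .
        qed simp
      qed
      also have "\<dots> = ?s * (LINT z|?Q. ?y z ^ 6)" by simp
      also have "\<dots> \<le> ?s * (A * real N powr (E + \<epsilon>) * m ^ 3)"
        unfolding m_def by (intro mult_left_mono sixth N) auto
      also have "\<dots> = A * real N powr ((p - 6) / 2 + E + \<epsilon>) * m powr (p / 2)"
      proof -
        have "p / 2 = (p - 6) / 2 + 3" by (simp add: diff_divide_distrib)
        then have "m powr (p / 2) = m powr ((p - 6) / 2) * m powr 3" by (simp only: powr_add)
        then show ?thesis using m0 by (simp add: powr_mult powr_add powr_numeral mult_ac)
      qed
      also have "\<dots> \<le> A * real N powr ((exponent \<nu> p + \<epsilon>) * p) * m powr (p / 2)"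
      proof (intro mult_right_mono mult_left_mono powr_mono)
        \<comment> \<open>With r = 1 + \<nu> + E one has r - 4 - \<nu> = E - 3, so this is the sum
          of (p - 6)/2 from the supremum and \<open>E\<close> from the sixth moment.\<close>
        have "exponent \<nu> p * p = p / 2 + (E - 3)"
          using p False unfolding exponent_def Let_def E by (simp add: field_simps)
        moreover have "\<epsilon> * 1 \<le> \<epsilon> * p" using p \<epsilon> by (intro mult_left_mono) auto
        ultimately show "(p - 6) / 2 + E + \<epsilon> \<le> (exponent \<nu> p + \<epsilon>) * p" by (simp add: distrib_right diff_divide_distrib)
      qed (use N A in auto)
      also have "\<dots> = (A powr (1 / p) * real N powr (exponent \<nu> p + \<epsilon>) * sqrt m) powr p"
        using p m0 A by (simp add: powr_mult powr_powr powr_half_sqrt[symmetric])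
      finally show "(LINT z|?Q. ?y z powr p) \<le> (A powr (1 / p) * real N powr (exponent \<nu> p + \<epsilon>) * sqrt (\<Sum>n=1..N. (cmod (a n))\<^sup>2)) powr p"
        unfolding m_def .
    qed (use A in simp)
  qed
  then obtain C where C: "C > 0" and bound: "\<And>N a. N \<ge> 1 \<Longrightarrow> (\<Sum>n=1..N. (cmod (a n))\<^sup>2) > 0 \<Longrightarrow>
      (LINT z|lebesgue_on unit_square. (cmod (frac_sum \<nu> N a z)) powr p)
        \<le> (C * real N powr (exponent \<nu> p + \<epsilon>) * sqrt (\<Sum>n=1..N. (cmod (a n))\<^sup>2)) powr p"
    by blast
  show ?thesis
  proof (intro exI[of _ C] conjI C allI impI)
    fix N :: nat and a :: "nat \<Rightarrow> complex"
    assume N: "N \<ge> 1"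
    let ?m = "\<Sum>n=1..N. (cmod (a n))\<^sup>2"
    let ?R = "C * real N powr (exponent \<nu> p + \<epsilon>) * sqrt ?m"
    have m: "?m \<ge> 0" by (intro sum_nonneg) auto
    show "Lp_norm (lebesgue_on unit_square) p (frac_sum \<nu> N a) \<le> ?R"
    proof (cases "?m = 0")
      case True
      then have "\<forall>n\<in>{1..N}. (cmod (a n))\<^sup>2 = 0" by (subst (asm) sum_nonneg_eq_0_iff) auto
      then have "frac_sum \<nu> N a z = 0" for z unfolding frac_sum_def case_prod_unfold by (intro sum.neutral) auto
      then show ?thesis using True by (simp add: Lp_norm_def)
    next
      case False
      then have "?m > 0" using m by linarith
      from bound[OF N this]
      have "(LINT z|lebesgue_on unit_square. (cmod (frac_sum \<nu> N a z)) powr p) powr (1 / p) \<le> (?R powr p) powr (1 / p)"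
        using p by (intro powr_mono2) (auto intro!: integral_nonneg_AE)
      also have "\<dots> = ?R"
        using p C m by (simp add: powr_powr)
      finally show ?thesis unfolding Lp_norm_def .
    qed
  qed
qed

section \<open>Uniqueness of classical solutions\<close>

text \<open>The class is closed under linear combinations and frequency shifts. Periodicity is kept
  apart; it enters later as f 1 = f 0.\<close>

definition null_fourier :: "(real \<Rightarrow> complex) \<Rightarrow> bool"
  where "null_fourier f \<longleftrightarrow> continuous_on UNIV f \<and> (\<forall>n. fourier_coeff f n = 0)"

lemma fourier_coeff_add:
  assumes "continuous_on UNIV f" "continuous_on UNIV g"
  shows "fourier_coeff (\<lambda>x. f x + g x) n = fourier_coeff f n + fourier_coeff g n"
  unfolding fourier_coeff_def distrib_right using assms
  by (intro Bochner_Integration.integral_add integrable_continuous_01 continuous_intros)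

lemma fourier_coeff_cmult: "fourier_coeff (\<lambda>x. c * f x) n = c * fourier_coeff f n"
  unfolding fourier_coeff_def mult.assoc by (rule integral_mult_right_zero)

lemma fourier_coeff_shift: "fourier_coeff (\<lambda>x. e1 (of_int m * x) * f x) n = fourier_coeff f (n - m)"
proof -
  have "e1 (of_int m * x) * f x * e1 (- (of_int n * x)) = f x * e1 (- (of_int (n - m) * x))" for x
  proof -
    have "e1 (of_int m * x) * f x * e1 (- (of_int n * x)) = f x * e1 (of_int m * x + - (of_int n * x))"
      unfolding e1_add by (simp only: mult_ac)
    then show ?thesis by (simp add: algebra_simps)
  qed
  then show ?thesis unfolding fourier_coeff_def by (simp only:)
qed

lemma null_fourier_add: "null_fourier f \<Longrightarrow> null_fourier g \<Longrightarrow> null_fourier (\<lambda>x. f x + g x)"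
  unfolding null_fourier_def by (auto simp: fourier_coeff_add intro!: continuous_intros)

lemma null_fourier_cmult: "null_fourier f \<Longrightarrow> null_fourier (\<lambda>x. c * f x)"
  unfolding null_fourier_def by (auto simp: fourier_coeff_cmult intro!: continuous_intros)

lemma null_fourier_shift: "null_fourier f \<Longrightarrow> null_fourier (\<lambda>x. e1 (of_int m * x) * f x)"
  unfolding null_fourier_def by (auto simp: fourier_coeff_shift intro!: continuous_intros)

text \<open>Multiplication by a polynomial in the real and imaginary parts of \<open>e1 x\<close> amounts to finitely many frequency shifts.\<close>
lemma null_fourier_mult_polynomial:
  assumes "real_polynomial_function q" "null_fourier f"
  shows "null_fourier (\<lambda>x. of_real (q (e1 x)) * f x)"
  using assms
proof (induction q arbitrary: f rule: real_polynomial_function.induct)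
  case (linear h)
  interpret h: bounded_linear h by (rule linear.hyps)
  \<comment> \<open>A real-linear functional on the plane has the form p z + q \<open>cnj\<close> z,
    and on the circle z and \<open>cnj\<close> z act as frequency shifts by 1 and -1.\<close>
  define p q where "p = (of_real (h 1) - \<i> * of_real (h \<i>)) / 2" and "q = (of_real (h 1) + \<i> * of_real (h \<i>)) / 2"
  have eq: "of_real (h z) = p * z + q * cnj z" for z
  proof -
    have "z = Re z *\<^sub>R 1 + Im z *\<^sub>R \<i>" by (simp add: complex_eq_iff)
    then have "h z = h (Re z *\<^sub>R 1 + Im z *\<^sub>R \<i>)" by (rule arg_cong)
    also have "\<dots> = Re z * h 1 + Im z * h \<i>" by (simp only: h.add h.scaleR real_scaleR_def)
    also have "of_real \<dots> = p * z + q * cnj z"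
      unfolding p_def q_def by (simp add: complex_eq_iff diff_divide_distrib add_divide_distrib)
    finally show ?thesis .
  qed
  have "of_real (h (e1 x)) * f x = p * (e1 (of_int 1 * x) * f x) + q * (e1 (of_int (- 1) * x) * f x)" for x
    unfolding eq cnj_e1 by (simp add: distrib_right mult.assoc)
  then show ?case
    using linear.prems by (simp only:) (intro null_fourier_add null_fourier_cmult null_fourier_shift)
next
  case (const c)
  then show ?case by (intro null_fourier_cmult)
next
  case (add q1 q2)
  then show ?case by (simp add: distrib_right null_fourier_add)
next
  case (mult q1 q2)
  then show ?case by (simp add: mult.assoc)
qed

section \<open>Fourier coefficients determine a continuous periodic function\<close>

lemma e1_eq_imp:
  assumes "e1 x = e1 y"
  obtains n :: int where "x = y + of_int n"
proof -
  have "e1 (x - y) = e1 x * cnj (e1 y)" by (rule e1_mult_cnj[symmetric])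
  also have "\<dots> = 1" unfolding assms e1_mult_cnj by (simp add: e1_def)
  finally have "e1 (x - y) = 1" .
  then obtain n :: int where "2 * pi * (x - y) = of_int (2 * n) * pi"
    unfolding e1_def exp_eq_1 by auto
  then have "x = y + of_int n" by simp
  then show ?thesis by (rule that)
qed

lemma e1_surj:
  assumes "cmod z = 1"
  obtains x where "x \<in> {0..1}" "e1 x = z"
proof -
  have "z = exp (\<i> * of_real (Arg2pi z))" using Arg2pi_eq[of z] assms by simp
  then have "e1 (Arg2pi z / (2 * pi)) = z" by (simp add: e1_def)
  moreover have "Arg2pi z / (2 * pi) \<in> {0..1}"
    using Arg2pi_ge_0[of z] Arg2pi_lt_2pi[of z] by simp
  ultimately show ?thesis by (rule that[rotated])
qed

text \<open>\<open>e1\<close> maps a compact interval onto the circle and is therefore a closed map,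
  so continuity descends. The chosen preimage of 1 may be either end point, and f 1 = f 0 makes the
  two choices agree.\<close>

lemma periodic_factors_through_circle:
  fixes f :: "real \<Rightarrow> complex"
  assumes cont: "continuous_on UNIV f" and per: "f 1 = f 0"
  obtains g where "continuous_on (sphere 0 1) g" "\<And>x. x \<in> {0..1} \<Longrightarrow> g (e1 x) = f x"
proof -
  define s where "s z = (SOME x. x \<in> {0..1} \<and> e1 x = z)" for z
  have s: "s z \<in> {0..1} \<and> e1 (s z) = z" if "cmod z = 1" for z
    unfolding s_def by (rule someI_ex) (use e1_surj[OF that] in blast)
  define g where "g z = f (s z)" for z
  have g: "g (e1 x) = f x" if x: "x \<in> {0..1}" for x
  proof -
    have "s (e1 x) \<in> {0..1}" "e1 (s (e1 x)) = e1 x" using s[of "e1 x"] by auto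
    then obtain n :: int where n: "s (e1 x) = x + of_int n" "s (e1 x) \<in> {0..1}" using e1_eq_imp by metis
    then have "n = 0 \<or> n = 1 \<and> x = 0 \<or> n = -1 \<and> x = 1"
      using x by auto
    then show ?thesis unfolding g_def using n per by auto
  qed
  have "continuous_on (sphere 0 1) g"
    unfolding continuous_closedin_preimage_eq
  proof (intro allI impI)
    fix T :: "complex set" assume T: "closed T"
    have "sphere 0 1 \<inter> g -` T = e1 ` ({0..1} \<inter> f -` T)"
    proof (intro equalityI subsetI)
      fix z assume z: "z \<in> sphere 0 1 \<inter> g -` T"
      then obtain x where "x \<in> {0..1}" "e1 x = z" using e1_surj[of z] by auto
      then show "z \<in> e1 ` ({0..1} \<inter> f -` T)" using z g by auto
    qed (use g in auto)
    moreover have "compact ({0..1} \<inter> f -` T)"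
      using closed_vimage[OF T cont] by (intro compact_Int_closed) auto
    then have "closed (e1 ` ({0..1} \<inter> f -` T))"
      by (intro compact_imp_closed compact_continuous_image continuous_intros)
    ultimately show "closedin (top_of_set (sphere 0 1)) (sphere 0 1 \<inter> g -` T)"
      by (metis closed_subset inf_le1)
  qed
  with g show ?thesis by (rule that[rotated])
qed

text \<open>By Stone--Weierstrass the conjugate of \<open>f\<close> is within e/B of a polynomial in
  the real and imaginary parts of \<open>e1 x\<close>, where \<open>B\<close> bounds |f|. The
  integral of \<open>f\<close> against that polynomial is 0, so the integral of |f|^2 is at most
  e.\<close>

lemma null_fourier_imp_zero:
  assumes null: "null_fourier f" and per: "f 1 = f 0" and x: "x \<in> {0..1}"
  shows "f x = 0"
proof -
  have cont: "continuous_on UNIV f" using null unfolding null_fourier_def by simp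
  have "compact (f ` {0..1})"
    by (intro compact_continuous_image continuous_on_subset[OF cont]) auto
  then have "bounded (f ` {0..1})" by (rule compact_imp_bounded)
  then obtain B where B: "B > 0" "\<And>x. x \<in> {0..1} \<Longrightarrow> cmod (f x) \<le> B"
    unfolding bounded_pos by auto
  let ?U = "lebesgue_on {0..1::real}"
  have sq: "(LINT x|?U. (cmod (f x))\<^sup>2) \<le> e" if e: "e > 0" for e
  proof -
    obtain g where g: "continuous_on (sphere 0 1) g" "\<And>x. x \<in> {0..1} \<Longrightarrow> g (e1 x) = f x"
      using periodic_factors_through_circle[OF cont per] by blast
    have "compact (sphere (0::complex) 1)" "e / B > 0" using e B by auto
    moreover have "continuous_on (sphere 0 1) (\<lambda>z. cnj (g z))" using g by (intro continuous_intros)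
    ultimately have "\<exists>q. polynomial_function q \<and> (\<forall>z\<in>sphere 0 1. cmod (cnj (g z) - q z) < e / B)"
      using Stone_Weierstrass_polynomial_function[of "sphere 0 1" "\<lambda>z. cnj (g z)" "e / B"] by blast
    then obtain q where q: "polynomial_function q" "\<And>z. z \<in> sphere 0 1 \<Longrightarrow> cmod (cnj (g z) - q z) < e / B"
      by blast
    have qc: "continuous_on UNIV (\<lambda>x. q (e1 x))"
      by (rule continuous_on_compose2[OF continuous_on_polymonial_function[OF q(1)] continuous_on_e1[OF continuous_on_id] subset_UNIV])
    have rp: "real_polynomial_function (Re \<circ> q)" "real_polynomial_function (Im \<circ> q)"
      using q(1) bounded_linear_Re bounded_linear_Im unfolding polynomial_function_def by blast+
    have "null_fourier (\<lambda>x. of_real ((Re \<circ> q) (e1 x)) * f x + \<i> * (of_real ((Im \<circ> q) (e1 x)) * f x))"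
      by (intro null_fourier_add null_fourier_cmult null_fourier_mult_polynomial rp null)
    moreover have "of_real ((Re \<circ> q) (e1 x)) * f x + \<i> * (of_real ((Im \<circ> q) (e1 x)) * f x) = q (e1 x) * f x" for x
    proof -
      have "q (e1 x) = of_real (Re (q (e1 x))) + \<i> * of_real (Im (q (e1 x)))" by (rule complex_eq)
      then have "q (e1 x) * f x = (of_real (Re (q (e1 x))) + \<i> * of_real (Im (q (e1 x)))) * f x" by (rule arg_cong)
      then show ?thesis by (simp only: comp_apply distrib_right mult.assoc)
    qed
    ultimately have "fourier_coeff (\<lambda>x. q (e1 x) * f x) 0 = 0" unfolding null_fourier_def by simp
    then have q0: "(LINT x|?U. q (e1 x) * f x) = 0" by (simp add: fourier_coeff_def e1_def)
    have "complex_of_real (LINT x|?U. (cmod (f x))\<^sup>2) = (LINT x|?U. complex_of_real ((cmod (f x))\<^sup>2))"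
      by (rule integral_complex_of_real[symmetric])
    also have "\<dots> = (LINT x|?U. cnj (f x) * f x)"
      by (intro Bochner_Integration.integral_cong refl) (simp only: complex_norm_square mult.commute)
    also have "\<dots> = (LINT x|?U. cnj (f x) * f x) - (LINT x|?U. q (e1 x) * f x)"
      unfolding q0 by simp
    also have "\<dots> = (LINT x|?U. cnj (f x) * f x - q (e1 x) * f x)"
      by (intro Bochner_Integration.integral_diff[symmetric] integrable_continuous_01 continuous_intros cont qc)
    finally have eq: "complex_of_real (LINT x|?U. (cmod (f x))\<^sup>2) = (LINT x|?U. cnj (f x) * f x - q (e1 x) * f x)" .
    have "(LINT x|?U. (cmod (f x))\<^sup>2) \<le> cmod (LINT x|?U. cnj (f x) * f x - q (e1 x) * f x)"
      unfolding eq[symmetric] norm_of_real by (rule abs_ge_self)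
    also have "\<dots> \<le> (LINT x|?U. cmod (cnj (f x) * f x - q (e1 x) * f x))"
      by (rule integral_norm_bound)
    also have "\<dots> \<le> (LINT x|?U. e)"
    proof (rule integral_mono)
      show "integrable ?U (\<lambda>x. cmod (cnj (f x) * f x - q (e1 x) * f x))"
        by (intro integrable_norm integrable_continuous_01 continuous_intros cont qc)
      show "integrable ?U (\<lambda>x. e)" by simp
      fix x assume "x \<in> space ?U"
      then have x: "x \<in> {0..1}" by simp
      have "cmod (cnj (f x) * f x - q (e1 x) * f x) = cmod (cnj (g (e1 x)) - q (e1 x)) * cmod (f x)"
        unfolding g(2)[OF x] norm_mult[symmetric] by (simp add: left_diff_distrib)
      also have "\<dots> \<le> e / B * B"
        using q(2)[of "e1 x"] B x e by (intro mult_mono) auto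
      finally show "cmod (cnj (f x) * f x - q (e1 x) * f x) \<le> e" using B by simp
    qed
    also have "\<dots> = e" by (simp add: measure_restrict_space)
    finally show ?thesis .
  qed
  have "(LINT x|?U. (cmod (f x))\<^sup>2) \<le> 0" by (rule field_le_epsilon) (use sq in simp)
  moreover have "(LINT x|?U. (cmod (f x))\<^sup>2) \<ge> 0" by (intro integral_nonneg_AE) auto
  ultimately have z: "(LINT x|?U. (cmod (f x))\<^sup>2) = 0" by simp
  have c2: "continuous_on {0..1} (\<lambda>x. (cmod (f x))\<^sup>2)"
    using cont by (intro continuous_intros continuous_on_subset[OF cont]) auto
  have "integral {0..1} (\<lambda>x. (cmod (f x))\<^sup>2) = 0"
    using z continuous_imp_integrable_real[OF c2] by (simp add: lebesgue_integral_eq_integral)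
  then have "(cmod (f x))\<^sup>2 = 0"
    using integral_eq_0_iff[OF c2] x by simp
  then show ?thesis by simp
qed

section \<open>Fourier coefficients of classical solutions\<close>

lemma fourier_coeff_eq_integral:
  assumes "continuous_on UNIV f"
  shows "fourier_coeff f n = integral {0..1} (\<lambda>x. f x * e1 (- (of_int n * x)))"
  unfolding fourier_coeff_def using assms
  by (intro lebesgue_integral_eq_integral integrable_continuous_01 continuous_intros) auto

lemma frac_solution_continuous:
  assumes "continuous_on (UNIV \<times> {0..1}) u" "t \<in> {0..1}"
  shows "continuous_on UNIV (\<lambda>x. u (x, t))"
  using assms(2) by (intro continuous_on_compose2[OF assms(1)] continuous_intros) auto

lemma frac_solution_fourier_coeff:
  assumes sol: "frac_solution \<nu> u0 u" and t: "t \<in> {0..1}"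
  shows "fourier_coeff (\<lambda>x. u (x, t)) n = e1 (\<bar>of_int n\<bar> powr (1 + \<nu>) * t) * fourier_coeff u0 n"
proof -
  define w where "w = \<bar>real_of_int n\<bar> powr (1 + \<nu>)"
  obtain v where cu: "continuous_on (UNIV \<times> {0..1}) u" and cv: "continuous_on (UNIV \<times> {0..1}) v"
    and deriv: "\<And>x t. t \<in> {0..1} \<Longrightarrow> ((\<lambda>s. u (x, s)) has_vector_derivative v (x, t)) (at t within {0..1})"
    and eqn: "\<And>t. t \<in> {0..1} \<Longrightarrow> \<exists>g. is_frac_op \<nu> (\<lambda>x. u (x, t)) g \<and> (\<forall>x. \<i> * v (x, t) + 2 * of_real pi * g x = 0)"
    and init: "\<And>x. u (x, 0) = u0 x"
    using sol unfolding frac_solution_def by blast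
  define c where "c t = fourier_coeff (\<lambda>x. u (x, t)) n" for t
  have v_coeff: "fourier_coeff (\<lambda>x. v (x, t)) n = 2 * of_real pi * \<i> * of_real w * c t" if t: "t \<in> {0..1}" for t
  proof -
    obtain g where g: "is_frac_op \<nu> (\<lambda>x. u (x, t)) g" "\<And>x. \<i> * v (x, t) + 2 * of_real pi * g x = 0"
      using eqn[OF t] by blast
    \<comment> \<open>The equation holds at every point and so identifies \<open>g\<close> with a
      multiple of the continuous function \<open>v\<close>; the multiplier relation thereby becomes
      one for the coefficients of \<open>v\<close>.\<close>
    have "v (x, t) = 2 * of_real pi * \<i> * g x" for x
    proof -
      have "\<i> * (\<i> * v (x, t) + 2 * of_real pi * g x) = 0" unfolding g(2) by simp
      then have "- v (x, t) + \<i> * (2 * of_real pi * g x) = 0" by (simp only: distrib_left complex_i_mult_minus)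
      then show ?thesis by (simp add: algebra_simps)
    qed
    then show ?thesis
      using g(1) unfolding is_frac_op_def by (simp add: fourier_coeff_cmult c_def w_def mult.assoc)
  qed
  have c_deriv: "(c has_vector_derivative 2 * of_real pi * \<i> * of_real w * c t) (at t within {0..1})" if t: "t \<in> {0..1}" for t
  proof -
    let ?e = "\<lambda>x. e1 (- (of_int n * x))"
    have "((\<lambda>t. integral (cbox 0 1) (\<lambda>x. u (x, t) * ?e x)) has_vector_derivative integral (cbox 0 1) (\<lambda>x. v (x, t) * ?e x)) (at t within {0..1})"
    proof (rule leibniz_rule_vector_derivative)
      show "((\<lambda>s. u (x, s) * ?e x) has_vector_derivative v (x, s) * ?e x) (at s within {0..1})" if "s \<in> {0..1}" for s x
        by (intro has_vector_derivative_mult_left deriv that)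
      show "(\<lambda>x. u (x, s) * ?e x) integrable_on cbox 0 1" if "s \<in> {0..1}" for s
        by (intro integrable_continuous continuous_intros continuous_on_subset[OF frac_solution_continuous[OF cu that]]) auto
      have "continuous_on ({0..1} \<times> cbox 0 1) (\<lambda>z. v (snd z, fst z) * ?e (snd z))"
        by (intro continuous_intros continuous_on_compose2[OF cv]) auto
      then show "continuous_on ({0..1} \<times> cbox 0 1) (\<lambda>(s, x). v (x, s) * ?e x)"
        by (simp add: case_prod_unfold)
    qed (use t in auto)
    moreover have "integral (cbox 0 1) (\<lambda>x. v (x, t) * ?e x) = 2 * of_real pi * \<i> * of_real w * c t"
      unfolding v_coeff[OF t, symmetric] fourier_coeff_eq_integral[OF frac_solution_continuous[OF cv t]] by simp
    ultimately have "((\<lambda>t. integral (cbox 0 1) (\<lambda>x. u (x, t) * ?e x)) has_vector_derivative 2 * of_real pi * \<i> * of_real w * c t) (at t within {0..1})"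
      by simp
    then show ?thesis
    proof (rule has_vector_derivative_transform[rotated 2])
      fix s :: real assume s: "s \<in> {0..1}"
      show "c s = integral (cbox 0 1) (\<lambda>x. u (x, s) * ?e x)"
        unfolding c_def fourier_coeff_eq_integral[OF frac_solution_continuous[OF cu s]] by simp
    qed (rule t)
  qed
  \<comment> \<open>An integrating factor for the scalar equation; the summand 0 matches the form
    \<open>c + d * s\<close> in \<open>e1_has_vector_derivative\<close>.\<close>
  have zero: "((\<lambda>t. c t * e1 (0 + (- w) * t)) has_vector_derivative 0) (at t within {0..1})" if t: "t \<in> {0..1}" for t
  proof -
    have "((\<lambda>t. c t * e1 (0 + (- w) * t)) has_vector_derivative
      c t * (2 * of_real pi * \<i> * of_real (- w) * e1 (0 + (- w) * t)) + 2 * of_real pi * \<i> * of_real w * c t * e1 (0 + (- w) * t)) (at t within {0..1})"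
      by (intro has_vector_derivative_mult c_deriv t e1_has_vector_derivative)
    then show ?thesis by (simp add: algebra_simps)
  qed
  obtain k where k: "\<And>t. t \<in> {0..1} \<Longrightarrow> c t * e1 (0 + (- w) * t) = k"
    using has_vector_derivative_zero_constant[OF _ zero] by (metis convex_real_interval(5))
  have "c t * e1 (- (w * t)) = c 0 * e1 0" using k[OF t] k[of 0] by simp
  also have "\<dots> = fourier_coeff u0 n" unfolding c_def init by (simp add: e1_def)
  finally have "e1 (w * t) * fourier_coeff u0 n = c t * (e1 (- (w * t)) * e1 (w * t))" by (simp add: mult_ac)
  also have "e1 (- (w * t)) * e1 (w * t) = 1" unfolding e1_add[symmetric] by (simp add: e1_def)
  finally show ?thesis unfolding c_def w_def by simp
qed

lemma frac_solution_unique: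
  assumes u: "frac_solution \<nu> u0 u" and v: "frac_solution \<nu> u0 v" and x: "x \<in> {0..1}" and t: "t \<in> {0..1}"
  shows "u (x, t) = v (x, t)"
proof -
  have cu: "continuous_on (UNIV \<times> {0..1}) u" and cv: "continuous_on (UNIV \<times> {0..1}) v"
    and pu: "u (0 + 1, t) = u (0, t)" and pv: "v (0 + 1, t) = v (0, t)"
    using u v t unfolding frac_solution_def by blast+
  note c = frac_solution_continuous[OF cu t] frac_solution_continuous[OF cv t]
  \<comment> \<open>The difference is written with the factor -1 so that the rules for sums and
    multiples of coefficients apply.\<close>
  have "null_fourier (\<lambda>x. u (x, t) + (- 1) * v (x, t))"
    unfolding null_fourier_def
  proof (intro conjI allI)
    show "continuous_on UNIV (\<lambda>x. u (x, t) + (- 1) * v (x, t))" using c by (intro continuous_intros)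
    fix n
    have "fourier_coeff (\<lambda>x. u (x, t) + (- 1) * v (x, t)) n =
        fourier_coeff (\<lambda>x. u (x, t)) n + (- 1) * fourier_coeff (\<lambda>x. v (x, t)) n"
      by (subst fourier_coeff_add) (use c in \<open>auto intro!: continuous_intros simp only: fourier_coeff_cmult\<close>)
    then show "fourier_coeff (\<lambda>x. u (x, t) + (- 1) * v (x, t)) n = 0"
      unfolding frac_solution_fourier_coeff[OF u t] frac_solution_fourier_coeff[OF v t] by simp
  qed
  from null_fourier_imp_zero[OF this _ x] pu pv show ?thesis by simp
qed

theorem theorem1p1:
  fixes \<nu> p \<epsilon> :: real
  assumes "\<nu> > 0" and "p \<ge> 2" and "\<epsilon> > 0"
  shows "\<exists>C>0. \<forall>N\<ge>1. \<forall>a :: nat \<Rightarrow> complex.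
    (\<forall>u. frac_solution \<nu> (trig_poly N a) u \<longrightarrow>
      Lp_norm (lebesgue_on ({0..1} \<times> {0..1})) p u
        \<le> C * real N powr (exponent \<nu> p + \<epsilon>) * Lp_norm (lebesgue_on {0..1}) 2 (trig_poly N a)) \<and>
    Lp_norm (lebesgue_on ({0..1} \<times> {0..1})) p
        (\<lambda>(x, t). \<Sum>n=1..N. a n * e1 (real n * x + real n powr (1 + \<nu>) * t))
      \<le> C * real N powr (exponent \<nu> p + \<epsilon>) * sqrt (\<Sum>n=1..N. (norm (a n))\<^sup>2)"
proof -
  obtain C where C: "C > 0" and bound: "\<And>N a. N \<ge> 1 \<Longrightarrow> Lp_norm (lebesgue_on unit_square) p (frac_sum \<nu> N a)
      \<le> C * real N powr (exponent \<nu> p + \<epsilon>) * sqrt (\<Sum>n=1..N. (cmod (a n))\<^sup>2)"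
    using Lp_frac_sum_le[OF assms] by blast
  \<comment> \<open>The norm only sees values on the square, where uniqueness identifies every
    classical solution with the explicit one.\<close>
  have solution: "Lp_norm (lebesgue_on unit_square) p u = Lp_norm (lebesgue_on unit_square) p (frac_sum \<nu> N a)"
    if "frac_solution \<nu> (trig_poly N a) u" for N a u
  proof -
    have "u z = frac_sum \<nu> N a z" if z: "z \<in> unit_square" for z
    proof -
      obtain x t where "z = (x, t)" "x \<in> {0..1}" "t \<in> {0..1}" using z by auto
      then show ?thesis
        using frac_solution_unique[OF \<open>frac_solution \<nu> (trig_poly N a) u\<close> frac_solution_frac_sum] by blast
    qed
    then have "(LINT z|lebesgue_on unit_square. norm (u z) powr p) = (LINT z|lebesgue_on unit_square. norm (frac_sum \<nu> N a z) powr p)"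
      by (intro Bochner_Integration.integral_cong refl) simp
    then show ?thesis unfolding Lp_norm_def by (rule arg_cong)
  qed
  have L2: "Lp_norm (lebesgue_on {0..1}) 2 (trig_poly N a) = sqrt (\<Sum>n=1..N. (cmod (a n))\<^sup>2)" for N a
  proof -
    have "(\<Sum>n=1..N. (cmod (a n))\<^sup>2) \<ge> 0" by (intro sum_nonneg) auto
    then show ?thesis
      using parseval_trig_poly[of N a] unfolding Lp_norm_def by (simp add: powr_numeral powr_half_sqrt)
  qed
  show ?thesis
  proof (intro exI[of _ C] conjI C allI impI)
    fix N :: nat and a :: "nat \<Rightarrow> complex"
    assume N: "N \<ge> 1"
    show "Lp_norm (lebesgue_on unit_square) p u
        \<le> C * real N powr (exponent \<nu> p + \<epsilon>) * Lp_norm (lebesgue_on {0..1}) 2 (trig_poly N a)"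
      if "frac_solution \<nu> (trig_poly N a) u" for u
      unfolding solution[OF that] L2 by (rule bound[OF N])
    show "Lp_norm (lebesgue_on unit_square) p
        (\<lambda>(x, t). \<Sum>n=1..N. a n * e1 (real n * x + real n powr (1 + \<nu>) * t))
      \<le> C * real N powr (exponent \<nu> p + \<epsilon>) * sqrt (\<Sum>n=1..N. (norm (a n))\<^sup>2)"
      using bound[OF N, of a] unfolding frac_sum_def .
  qed
qed

end
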